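(* Let $\Sigma$ be a $d$-dimensional hereditary rational polyhedral fan in $\mathbb{Q}^d$, let $S=\mathbb{Q}[x_1,\ldots,x_d]$, and let $\mathcal{C}=\mathcal{C}(\Sigma)$ be the cellular complex of $S$-modules defined in the context. Suppose that for each $i<d$ the homology module $H_i(\mathcal{C})$ is either zero or a Cohen–Macaulay $S$-module of codimension $d-i+1$. Then the $S$-module $C^0(\Sigma)$ of piecewise polynomial functions on $\Sigma$ is free.
   Context: A fan consists of strongly convex rational polyhedral cones in $\mathbb{Q}^d$ (not necessarily simplicial, not necessarily complete). It is $d$-dimensional and hereditary: for every nonempty face $\sigma$ of $\Sigma$, the dual graph of the star of $\sigma$ (vertices: $d$-dimensional cones containing $\sigma$; edges: pairs of these sharing a $(d-1)$-dimensional face that contains $\sigma$) is connected, and in particular every cone lies in a $d$-dimensional cone. $\Sigma_k$ is the set of $k$-dimensional cones. $\Sigma_k^0\subseteq\Sigma_k$ is the set of interior ones, i.e. those not contained in the boundary of the support $|\Sigma|$, so $\Sigma_d^0=\Sigma_d$. For a cone $\xi$, $\overline{\xi}$ denotes its linear span and $I_\xi\subseteq S$ the ideal of $\overline{\xi}$, generated by the linear forms vanishing on it. Complex $\mathcal{C}$: fix an orientation of each cone. Let $\mathcal{C}_k=\bigoplus_{\xi\in\Sigma_k^0}S/I_\xi$ for $1\le k\le d$ (so $\mathcal{C}_d=\bigoplus_{\sigma\in\Sigma_d}S$) and $\mathcal{C}_k=0$ otherwise. The differential $\partial_k:\mathcal{C}_k\to\mathcal{C}_{k-1}$ is induced by the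 cellular boundary map relative to the boundary of $\Sigma$: the generator of a cone $\alpha$ maps to the sum, with incidence signs $\pm1$, of the generators of its interior facets. $C^0(\Sigma)$ (rational coefficients) is the graded $S$-module of tuples $(f_\sigma)_{\sigma\in\Sigma_d}$, $f_\sigma\in S$, such that $f_\sigma|_\tau=f_{\sigma'}|_\tau$, i.e. $f_\sigma-f_{\sigma'}\in I_\tau$, whenever $\sigma,\sigma'\in\Sigma_d$ share the $(d-1)$-dimensional face $\tau$. It equals $H_d(\mathcal{C})$. *)

theory Defs
  imports
    "HOL-Analysis.Determinants"
    "HOL-Algebra.QuotRing"
    "HOL-Algebra.Module"
    "HOL-Library.Poly_Mapping"
    "HOL-Library.Extended_Nat"
begin

section \<open>Modules over a commutative ring\<close>

definition ring_as_module :: "('a, 'm) ring_scheme \<Rightarrow> ('a, 'a) module" where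
  "ring_as_module R =
    \<lparr>carrier = carrier R, mult = mult R, one = one R, zero = zero R, add = add R,
     smult = mult R\<rparr>"

text \<open>
  In the module records built below, the fields \<open>mult\<close> and \<open>one\<close> (inherited from the ring record
  and not constrained by the locale \<open>module\<close>) carry no information.
\<close>

definition quot_module ::
  "('a, 'b, 'm) module_scheme \<Rightarrow> 'b set \<Rightarrow> ('a, 'b set) module" where
  "quot_module M N =
    \<lparr>carrier = a_rcosets\<^bsub>M\<^esub> N, mult = undefined, one = undefined,
     zero = N, add = set_add M,
     smult = (\<lambda>r X. \<Union>x\<in>X. N +>\<^bsub>M\<^esub> (r \<odot>\<^bsub>M\<^esub> x))\<rparr>"

definition direct_sum_module ::
  "'i set \<Rightarrow> ('i \<Rightarrow> ('a, 'b, 'm) module_scheme) \<Rightarrow> ('a, 'i \<Rightarrow> 'b) module" where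
  \<comment> \<open>only used for finite index sets, where the direct sum is the product\<close>
  "direct_sum_module A M =
    \<lparr>carrier = (\<Pi>\<^sub>E a\<in>A. carrier (M a)), mult = undefined, one = undefined,
     zero = (\<lambda>a\<in>A. \<zero>\<^bsub>M a\<^esub>),
     add = (\<lambda>f g. \<lambda>a\<in>A. f a \<oplus>\<^bsub>M a\<^esub> g a),
     smult = (\<lambda>r f. \<lambda>a\<in>A. r \<odot>\<^bsub>M a\<^esub> f a)\<rparr>"

definition zero_module :: "('a, 'b, 'm) module_scheme \<Rightarrow> bool" where
  "zero_module M \<longleftrightarrow> carrier M = {\<zero>\<^bsub>M\<^esub>}"

definition generates_module ::
  "('a, 'k) ring_scheme \<Rightarrow> ('a, 'b, 'm) module_scheme \<Rightarrow> 'b set \<Rightarrow> bool" where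
  "generates_module R M B \<longleftrightarrow> B \<subseteq> carrier M \<and>
    (\<forall>x\<in>carrier M. \<exists>A c. finite A \<and> A \<subseteq> B \<and> c \<in> A \<rightarrow> carrier R \<and>
       x = (\<Oplus>\<^bsub>M\<^esub>b\<in>A. c b \<odot>\<^bsub>M\<^esub> b))"

definition finitely_generated_module ::
  "('a, 'k) ring_scheme \<Rightarrow> ('a, 'b, 'm) module_scheme \<Rightarrow> bool" where
  "finitely_generated_module R M \<longleftrightarrow> (\<exists>B. finite B \<and> generates_module R M B)"

definition independent_in_module ::
  "('a, 'k) ring_scheme \<Rightarrow> ('a, 'b, 'm) module_scheme \<Rightarrow> 'b set \<Rightarrow> bool" where
  "independent_in_module R M B \<longleftrightarrow> B \<subseteq> carrier M \<and>
    (\<forall>A c. finite A \<and> A \<subseteq> B \<and> c \<in> A \<rightarrow> carrier R \<and>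
       (\<Oplus>\<^bsub>M\<^esub>b\<in>A. c b \<odot>\<^bsub>M\<^esub> b) = \<zero>\<^bsub>M\<^esub> \<longrightarrow> (\<forall>b\<in>A. c b = \<zero>\<^bsub>R\<^esub>))"

definition free_module ::
  "('a, 'k) ring_scheme \<Rightarrow> ('a, 'b, 'm) module_scheme \<Rightarrow> bool" where
  "free_module R M \<longleftrightarrow> (\<exists>B. generates_module R M B \<and> independent_in_module R M B)"

definition annihilator ::
  "('a, 'k) ring_scheme \<Rightarrow> ('a, 'b, 'm) module_scheme \<Rightarrow> 'a set" where
  "annihilator R M = {r \<in> carrier R. \<forall>x\<in>carrier M. r \<odot>\<^bsub>M\<^esub> x = \<zero>\<^bsub>M\<^esub>}"

text \<open>
  The Krull dimension of a finitely generated module \<open>M\<close> is that of \<open>R / ann M\<close>, i.e. the supremum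
  of the lengths of chains of primes of \<open>R\<close> above \<open>ann M\<close>.  (It is \<open>0\<close> for the zero module, to
  which it is never applied.)
\<close>

definition module_dim ::
  "('a, 'k) ring_scheme \<Rightarrow> ('a, 'b, 'm) module_scheme \<Rightarrow> enat" where
  "module_dim R M = Sup {enat n | n. \<exists>P :: nat \<Rightarrow> 'a set.
     (\<forall>j\<le>n. primeideal (P j) R \<and> annihilator R M \<subseteq> P j) \<and> (\<forall>j<n. P j \<subset> P (Suc j))}"

definition list_times_module :: "('a, 'b, 'm) module_scheme \<Rightarrow> 'a list \<Rightarrow> 'b set" where
  \<comment> \<open>the submodule \<open>(f\<^sub>1, \<dots>, f\<^sub>n) M\<close>\<close>
  "list_times_module M fs =
    {(\<Oplus>\<^bsub>M\<^esub>k\<in>{..<length fs}. fs ! k \<odot>\<^bsub>M\<^esub> x k) | x. x \<in> {..<length fs} \<rightarrow> carrier M}"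

definition regular_sequence ::
  "('a, 'k) ring_scheme \<Rightarrow> ('a, 'b, 'm) module_scheme \<Rightarrow> 'a list \<Rightarrow> bool" where
  "regular_sequence R M fs \<longleftrightarrow> set fs \<subseteq> carrier R \<and>
    (\<forall>j<length fs. \<forall>x\<in>carrier M.
       fs ! j \<odot>\<^bsub>M\<^esub> x \<in> list_times_module M (take j fs) \<longrightarrow>
       x \<in> list_times_module M (take j fs)) \<and>
    list_times_module M fs \<noteq> carrier M"

definition depth ::
  "('a, 'k) ring_scheme \<Rightarrow> 'a set \<Rightarrow> ('a, 'b, 'm) module_scheme \<Rightarrow> enat" where
  "depth R I M = Sup {enat (length fs) | fs. set fs \<subseteq> I \<and> regular_sequence R M fs}"


section \<open>The polynomial ring\<close>

text \<open>The variables are indexed by the finite type \<open>'n\<close>, so that \<open>d\<close> is \<open>CARD('n)\<close>.\<close>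

type_synonym 'n mpoly = "('n \<Rightarrow>\<^sub>0 nat) \<Rightarrow>\<^sub>0 rat"

definition poly_ring :: "'n mpoly ring" where
  "poly_ring = \<lparr>carrier = UNIV, mult = (*), one = 1, zero = 0, add = (+)\<rparr>"

definition const_poly :: "rat \<Rightarrow> 'n mpoly" where
  "const_poly q = Poly_Mapping.single 0 q"

definition var_poly :: "'n \<Rightarrow> 'n mpoly" where
  "var_poly i = Poly_Mapping.single (Poly_Mapping.single i 1) 1"

definition linear_form :: "rat ^ 'n \<Rightarrow> 'n mpoly" where
  "linear_form u = (\<Sum>i\<in>UNIV. const_poly (u $ i) * var_poly i)"

definition irrelevant_ideal :: "'n mpoly set" where
  "irrelevant_ideal = Idl\<^bsub>poly_ring\<^esub> (range var_poly)"

text \<open>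
  As usual for finitely generated graded modules over the polynomial ring, depth is taken with
  respect to the irrelevant maximal ideal.  All modules to which this is applied are graded.
\<close>

definition cohen_macaulay :: "('n mpoly, 'b, 'm) module_scheme \<Rightarrow> bool" where
  "cohen_macaulay M \<longleftrightarrow> finitely_generated_module poly_ring M \<and> \<not> zero_module M \<and>
    depth poly_ring irrelevant_ideal M = module_dim poly_ring M"

text \<open>Codimension in the polynomial ring, whose Krull dimension is \<open>CARD('n)\<close>.\<close>

definition codimension :: "('n::finite mpoly, 'b, 'm) module_scheme \<Rightarrow> enat" where
  "codimension M = enat CARD('n) - module_dim poly_ring M"


section \<open>Fans\<close>

definition rdot :: "rat ^ 'n::finite \<Rightarrow> rat ^ 'n \<Rightarrow> rat" where
  "rdot u x = (\<Sum>i\<in>UNIV. u $ i * x $ i)"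

definition polyhedral_cone :: "(rat ^ 'n::finite) set \<Rightarrow> bool" where
  "polyhedral_cone \<sigma> \<longleftrightarrow>
    (\<exists>V. finite V \<and> \<sigma> = {(\<Sum>v\<in>V. c v *s v) | c. \<forall>v\<in>V. 0 \<le> c v})"

definition strongly_convex :: "(rat ^ 'n::finite) set \<Rightarrow> bool" where
  "strongly_convex \<sigma> \<longleftrightarrow> \<sigma> \<inter> uminus ` \<sigma> = {0}"

definition cone_face :: "(rat ^ 'n::finite) set \<Rightarrow> (rat ^ 'n) set \<Rightarrow> bool" where
  "cone_face \<tau> \<sigma> \<longleftrightarrow>
    (\<exists>u. (\<forall>x\<in>\<sigma>. 0 \<le> rdot u x) \<and> \<tau> = {x\<in>\<sigma>. rdot u x = 0})"

definition fan :: "(rat ^ 'n::finite) set set \<Rightarrow> bool" where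
  "fan \<Sigma> \<longleftrightarrow> finite \<Sigma> \<and> \<Sigma> \<noteq> {} \<and>
    (\<forall>\<sigma>\<in>\<Sigma>. polyhedral_cone \<sigma> \<and> strongly_convex \<sigma>) \<and>
    (\<forall>\<sigma>\<in>\<Sigma>. \<forall>\<tau>. cone_face \<tau> \<sigma> \<longrightarrow> \<tau> \<in> \<Sigma>) \<and>
    (\<forall>\<sigma>\<in>\<Sigma>. \<forall>\<tau>\<in>\<Sigma>. cone_face (\<sigma> \<inter> \<tau>) \<sigma> \<and> cone_face (\<sigma> \<inter> \<tau>) \<tau>)"

definition cones_of_dim :: "(rat ^ 'n::finite) set set \<Rightarrow> nat \<Rightarrow> (rat ^ 'n) set set" where
  \<comment> \<open>\<open>vec.dim\<close> of a set is the dimension of its linear span\<close>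
  "cones_of_dim \<Sigma> k = {\<sigma>\<in>\<Sigma>. vec.dim \<sigma> = k}"

definition fan_dim :: "(rat ^ 'n::finite) set set \<Rightarrow> nat" where
  "fan_dim \<Sigma> = Max (vec.dim ` \<Sigma>)"

definition star_cones ::
  "(rat ^ 'n::finite) set set \<Rightarrow> (rat ^ 'n) set \<Rightarrow> (rat ^ 'n) set set" where
  "star_cones \<Sigma> \<sigma> = {\<rho>\<in>cones_of_dim \<Sigma> CARD('n). cone_face \<sigma> \<rho>}"

definition star_edges ::
  "(rat ^ 'n::finite) set set \<Rightarrow> (rat ^ 'n) set \<Rightarrow> ((rat ^ 'n) set \<times> (rat ^ 'n) set) set" where
  "star_edges \<Sigma> \<sigma> = {(\<rho>, \<rho>'). \<rho> \<in> star_cones \<Sigma> \<sigma> \<and> \<rho>' \<in> star_cones \<Sigma> \<sigma> \<and> \<rho> \<noteq> \<rho>' \<and>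
    (\<exists>\<tau>\<in>cones_of_dim \<Sigma> (CARD('n) - 1). cone_face \<tau> \<rho> \<and> cone_face \<tau> \<rho>' \<and> cone_face \<sigma> \<tau>)}"

text \<open>
  Every cone contains the origin, so the quantification over nonempty faces ranges over all of
  \<open>\<Sigma>\<close>, the cone \<open>{0}\<close> included.  A connected graph has at least one vertex; hence every cone of a
  hereditary fan lies in a full-dimensional one.
\<close>

definition hereditary :: "(rat ^ 'n::finite) set set \<Rightarrow> bool" where
  "hereditary \<Sigma> \<longleftrightarrow> (\<forall>\<sigma>\<in>\<Sigma>. star_cones \<Sigma> \<sigma> \<noteq> {} \<and>
    (\<forall>\<rho>\<in>star_cones \<Sigma> \<sigma>. \<forall>\<rho>'\<in>star_cones \<Sigma> \<sigma>. (\<rho>, \<rho>') \<in> (star_edges \<Sigma> \<sigma>)\<^sup>*))"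

definition boundary_set :: "(rat ^ 'n::finite) set \<Rightarrow> (rat ^ 'n) set" where
  \<comment> \<open>topological boundary in \<open>\<rat>\<^sup>d\<close> for the topology of the maximum norm;
      the library has no topology on \<^typ>\<open>rat\<close>\<close>
  "boundary_set A = {x. \<forall>e>0.
    (\<exists>y\<in>A. \<forall>i. \<bar>y $ i - x $ i\<bar> < e) \<and> (\<exists>y\<in>- A. \<forall>i. \<bar>y $ i - x $ i\<bar> < e)}"

definition interior_cones :: "(rat ^ 'n::finite) set set \<Rightarrow> nat \<Rightarrow> (rat ^ 'n) set set" where
  "interior_cones \<Sigma> k = {\<xi>\<in>cones_of_dim \<Sigma> k. \<not> \<xi> \<subseteq> boundary_set (\<Union>\<Sigma>)}"


section \<open>Orientations\<close>

text \<open>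
  An orientation of a cone is an orientation of its linear span, represented by an ordered basis of
  the span.  The sign of the determinant of the coordinates of one ordered basis with respect to
  another tells whether they define the same orientation.
\<close>

definition orients :: "(rat ^ 'n::finite) list \<Rightarrow> (rat ^ 'n) set \<Rightarrow> bool" where
  "orients bs \<xi> \<longleftrightarrow> distinct bs \<and> vec.independent (set bs) \<and> vec.span (set bs) = vec.span \<xi>"

definition coord_det :: "(rat ^ 'n::finite) list \<Rightarrow> (rat ^ 'n) list \<Rightarrow> rat" where
  "coord_det as bs = (\<Sum>p | p permutes {..<length as}.
     of_int (sign p) * (\<Prod>j<length as. vec.representation (set as) (bs ! j) (as ! p j)))"

text \<open>
  Incidence sign of a cone \<open>\<alpha>\<close> and a facet \<open>\<beta>\<close>, by the rule ``outward normal first''.  For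
  \<open>w \<in> \<alpha>\<close> outside the span of \<open>\<beta>\<close>, the vector \<open>- w\<close> points out of \<open>\<alpha>\<close> across \<open>\<beta>\<close>; the sign does
  not depend on the choice of \<open>w\<close>, since \<open>\<alpha>\<close> lies on one side of \<open>\<beta>\<close> in its span.
\<close>

definition incidence ::
  "((rat ^ 'n::finite) set \<Rightarrow> (rat ^ 'n) list) \<Rightarrow> (rat ^ 'n) set \<Rightarrow> (rat ^ 'n) set \<Rightarrow> rat" where
  "incidence ori \<alpha> \<beta> =
    (let w = (SOME w. w \<in> \<alpha> \<and> w \<notin> vec.span \<beta>) in sgn (coord_det (ori \<alpha>) (- w # ori \<beta>)))"


section \<open>The cellular complex and its homology\<close>

definition cone_ideal :: "(rat ^ 'n::finite) set \<Rightarrow> 'n mpoly set" where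
  "cone_ideal \<xi> =
    Idl\<^bsub>poly_ring\<^esub> {linear_form u | u. \<forall>x\<in>vec.span \<xi>. rdot u x = 0}"

definition cone_module :: "(rat ^ 'n::finite) set \<Rightarrow> ('n mpoly, 'n mpoly set) module" where
  "cone_module \<xi> = quot_module (ring_as_module poly_ring) (cone_ideal \<xi>)"

definition chain_cones :: "(rat ^ 'n::finite) set set \<Rightarrow> nat \<Rightarrow> (rat ^ 'n) set set" where
  \<comment> \<open>the complex is zero in degree \<open>0\<close>, and in degrees above \<open>d\<close> since there are no such cones\<close>
  "chain_cones \<Sigma> k = (if k = 0 then {} else interior_cones \<Sigma> k)"

definition chain_module ::
  "(rat ^ 'n::finite) set set \<Rightarrow> nat \<Rightarrow> ('n mpoly, (rat ^ 'n) set \<Rightarrow> 'n mpoly set) module" where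
  "chain_module \<Sigma> k = direct_sum_module (chain_cones \<Sigma> k) cone_module"

text \<open>
  For a facet \<open>\<beta>\<close> of \<open>\<alpha>\<close> one has \<open>I\<^sub>\<alpha> \<subseteq> I\<^sub>\<beta>\<close>, and the projection from \<open>S / I\<^sub>\<alpha>\<close> to \<open>S / I\<^sub>\<beta>\<close> sends
  a coset \<open>X\<close> to \<open>I\<^sub>\<beta> + X\<close>.  For \<open>k = 0\<close> both source and target (degree \<open>0 - 1 = 0\<close>) are zero.
\<close>

definition chain_boundary ::
  "(rat ^ 'n::finite) set set \<Rightarrow> ((rat ^ 'n) set \<Rightarrow> (rat ^ 'n) list) \<Rightarrow> nat \<Rightarrow>
   ((rat ^ 'n) set \<Rightarrow> 'n mpoly set) \<Rightarrow> (rat ^ 'n) set \<Rightarrow> 'n mpoly set" where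
  "chain_boundary \<Sigma> ori k c = (\<lambda>\<beta>\<in>chain_cones \<Sigma> (k - 1).
     \<Oplus>\<^bsub>cone_module \<beta>\<^esub>\<alpha>\<in>{\<alpha>\<in>chain_cones \<Sigma> k. cone_face \<beta> \<alpha>}.
       const_poly (incidence ori \<alpha> \<beta>) \<odot>\<^bsub>cone_module \<beta>\<^esub>
         (cone_ideal \<beta> <+>\<^bsub>poly_ring\<^esub> c \<alpha>))"

definition cycles ::
  "(rat ^ 'n::finite) set set \<Rightarrow> ((rat ^ 'n) set \<Rightarrow> (rat ^ 'n) list) \<Rightarrow> nat \<Rightarrow>
   ((rat ^ 'n) set \<Rightarrow> 'n mpoly set) set" where
  "cycles \<Sigma> ori k = {c\<in>carrier (chain_module \<Sigma> k).
     chain_boundary \<Sigma> ori k c = \<zero>\<^bsub>chain_module \<Sigma> (k - 1)\<^esub>}"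

definition boundaries ::
  "(rat ^ 'n::finite) set set \<Rightarrow> ((rat ^ 'n) set \<Rightarrow> (rat ^ 'n) list) \<Rightarrow> nat \<Rightarrow>
   ((rat ^ 'n) set \<Rightarrow> 'n mpoly set) set" where
  "boundaries \<Sigma> ori k = chain_boundary \<Sigma> ori (Suc k) ` carrier (chain_module \<Sigma> (Suc k))"

definition homology ::
  "(rat ^ 'n::finite) set set \<Rightarrow> ((rat ^ 'n) set \<Rightarrow> (rat ^ 'n) list) \<Rightarrow> nat \<Rightarrow>
   ('n mpoly, ((rat ^ 'n) set \<Rightarrow> 'n mpoly set) set) module" where
  "homology \<Sigma> ori k =
    quot_module (chain_module \<Sigma> k\<lparr>carrier := cycles \<Sigma> ori k\<rparr>) (boundaries \<Sigma> ori k)"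


section \<open>Piecewise polynomial functions\<close>

definition piecewise_polys ::
  "(rat ^ 'n::finite) set set \<Rightarrow> ('n mpoly, (rat ^ 'n) set \<Rightarrow> 'n mpoly) module" where
  "piecewise_polys \<Sigma> =
    direct_sum_module (cones_of_dim \<Sigma> CARD('n)) (\<lambda>_. ring_as_module poly_ring)
      \<lparr>carrier := {f \<in> cones_of_dim \<Sigma> CARD('n) \<rightarrow>\<^sub>E UNIV.
        \<forall>\<sigma>\<in>cones_of_dim \<Sigma> CARD('n). \<forall>\<sigma>'\<in>cones_of_dim \<Sigma> CARD('n).
        \<forall>\<tau>\<in>cones_of_dim \<Sigma> (CARD('n) - 1).
          cone_face \<tau> \<sigma> \<and> cone_face \<tau> \<sigma>' \<longrightarrow> f \<sigma> - f \<sigma>' \<in> cone_ideal \<tau>}\<rparr>"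

end

theory Submission
  imports Defs "HOL-Library.Function_Algebras" "Jordan_Normal_Form.Determinant"
begin

text \<open>
  Write \<open>d\<close> for the number of variables, \<open>\<mm>\<close> for the irrelevant ideal, and \<open>Tor\<^sub>j(M)\<close> for the Koszul
  homology of \<open>M\<close> on the variables, which is \<open>Tor\<^sub>j(M, \<rat>)\<close>.  The argument is a count of the degrees in
  which these groups can be nonzero.  Two facts start it.  An element \<open>f\<close> of \<open>\<mm>\<close> acts as zero on Koszul
  homology, so if \<open>f\<close> is a nonzerodivisor on \<open>M\<close>, then \<open>Tor\<^sub>j(M)\<close> embeds into \<open>Tor\<^sub>j\<^sub>+\<^sub>1(M / f M)\<close>; hence a
  regular sequence of length \<open>r\<close> in \<open>\<mm>\<close> makes \<open>Tor\<^sub>j(M)\<close> vanish for \<open>j > d - r\<close>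
  (\<open>koszul_exact_regular_sequence\<close>).  Moreover \<open>S / I\<^sub>\<xi>\<close> is a polynomial ring in \<open>dim \<xi>\<close> of the
  variables, so that these variables form a regular sequence on it (\<open>cone_quotient_koszul_exact\<close>).

  Let \<open>Z\<^sub>i\<close> and \<open>B\<^sub>i\<close> be the cycles and boundaries in degree \<open>i\<close> of the complex.  In
  \<open>0 \<rightarrow> Z\<^sub>i \<rightarrow> C\<^sub>i \<rightarrow> B\<^sub>i\<^sub>-\<^sub>1 \<rightarrow> 0\<close> the module \<open>C\<^sub>i\<close> has no \<open>Tor\<^sub>j\<close> for \<open>j > d - i\<close>, and in
  \<open>0 \<rightarrow> B\<^sub>i \<rightarrow> Z\<^sub>i \<rightarrow> H\<^sub>i \<rightarrow> 0\<close> the module \<open>H\<^sub>i\<close> has none for \<open>j > d - i + 1\<close>, because it is zero or has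
  depth \<open>i - 1\<close>.  By induction on \<open>i\<close>, neither \<open>Z\<^sub>i\<close> nor \<open>B\<^sub>i\<close> has \<open>Tor\<^sub>j\<close> for \<open>j > d - i\<close>
  (\<open>koszul_exact_cycles_boundaries\<close>).  In particular \<open>Tor\<^sub>1(Z\<^sub>d) = 0\<close>.

  Changing the sign of \<open>f\<^sub>\<sigma>\<close> according to the orientation of \<open>\<sigma>\<close> carries \<open>C\<^sup>0(\<Sigma>)\<close> to \<open>Z\<^sub>d\<close> when \<open>d > 1\<close>
  (\<open>koszul_exact_pp_chains\<close>), so \<open>Tor\<^sub>1(C\<^sup>0(\<Sigma>)) = 0\<close>.  The case \<open>d = 1\<close> is apart, as the complex is cut
  off at degree \<open>0\<close> and forgets the condition at the origin; but then the only variable is a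
  nonzerodivisor on \<open>C\<^sup>0(\<Sigma>)\<close>, which again gives \<open>Tor\<^sub>1 = 0\<close>.  Finally, \<open>C\<^sup>0(\<Sigma>)\<close> is graded, and a graded
  submodule \<open>Z\<close> of a free module with \<open>Tor\<^sub>1(Z) = 0\<close> is free (\<open>graded_koszul_exact_free\<close>): homogeneous
  lifts of a \<open>\<rat>\<close>-basis of \<open>Z / \<mm> Z\<close> generate \<open>Z\<close> by induction on the degree, and their module \<open>K\<close> of
  relations satisfies \<open>K = \<mm> K\<close>, so it is zero.

  The geometry enters twice.  That boundaries are cycles, i.e. \<open>\<partial> \<partial> = 0\<close>, rests on the diamond
  property: between a cone and a face of codimension two there are exactly two cones, and the incidence
  signs along the two paths are opposite (\<open>cone_diamond\<close>, \<open>incidence_diamond\<close>).  The comparison of \<open>Z\<^sub>d\<close>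
  with \<open>C\<^sup>0(\<Sigma>)\<close> needs that the cones of codimension one inside the support are those that lie in exactly
  two full-dimensional cones, one on each side (\<open>facet_star\<close>, \<open>interior_facet_two_cones\<close>).

  All modules are treated as subquotients \<open>N / L\<close> of one ambient module, where \<open>koszul_exact N L j\<close> says
  that \<open>Tor\<^sub>j\<^sub>+\<^sub>1(N / L) = 0\<close> in terms of elements.  The locale \<open>presentation\<close> links such a pair \<open>(N, L)\<close>
  to a module given as a record.
\<close>

(* The infix for entries of matrix-library vectors would clash with the one for rat ^ 'n. *)
no_notation Matrix.vec_index (infixl \<open>$\<close> 100)

section \<open>Koszul homology\<close>

text \<open>
  The generators of the Koszul complex are indexed by sets of variables.  A sign convention needs an
  order on the variables, which is borrowed from the natural numbers through \<open>to_nat\<close>.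
\<close>

definition ksign :: "'n::finite \<Rightarrow> 'n set \<Rightarrow> 'r::comm_ring_1" where
  "ksign i A = (- 1) ^ card {a\<in>A. to_nat a < to_nat i}"

lemma ksign_empty [simp]: "ksign i {} = 1"
  by (simp add: ksign_def)

lemma ksign_square [simp]: "ksign i A * ksign i A = 1"
  by (simp add: ksign_def flip: power_mult_distrib)

lemma ksign_insert:
  assumes "i \<notin> A"
  shows "ksign k (insert i A) = (if to_nat i < to_nat k then - ksign k A else ksign k A)"
proof -
  have "{a\<in>insert i A. to_nat a < to_nat k} =
      (if to_nat i < to_nat k then insert i {a\<in>A. to_nat a < to_nat k} else {a\<in>A. to_nat a < to_nat k})"
    by auto
  then show ?thesis
    using assms by (simp add: ksign_def)
qed

lemma ksign_exchange:
  assumes "i \<notin> A" "k \<notin> A" "i \<noteq> k"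
  shows "ksign k A * ksign i (insert k A) = - (ksign i A * ksign k (insert i A))"
proof -
  have "to_nat i < to_nat k \<longleftrightarrow> \<not> to_nat k < to_nat i"
    using assms(3) by (metis linorder_cases not_less_iff_gr_or_eq to_nat_split)
  then show ?thesis
    using assms by (simp add: ksign_insert algebra_simps)
qed

lemma ksign_exchange':
  assumes "i \<notin> A" "k \<notin> A" "i \<noteq> k"
  shows "ksign k (insert i A) * ksign i (insert k A) = - (ksign i A * ksign k A)"
proof -
  have "to_nat i < to_nat k \<longleftrightarrow> \<not> to_nat k < to_nat i"
    using assms(3) by (metis linorder_cases not_less_iff_gr_or_eq to_nat_split)
  then show ?thesis
    using assms by (simp add: ksign_insert algebra_simps)
qed

locale koszul = Modules.module scale
  for scale :: "'r::comm_ring_1 \<Rightarrow> 'm::ab_group_add \<Rightarrow> 'm" (infixr \<open>\<cdot>\<close> 75) +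
  fixes x :: "'n::finite \<Rightarrow> 'r"
begin

text \<open>
  A chain assigns a coefficient to every set of variables, in all degrees at once; the part of degree
  \<open>j\<close> is given by the values on the sets with \<open>j\<close> elements.
\<close>

definition kdiff :: "('n set \<Rightarrow> 'm) \<Rightarrow> 'n set \<Rightarrow> 'm" where
  "kdiff c A = (\<Sum>k\<in>- A. (ksign k A * x k) \<cdot> c (insert k A))"

text \<open>
  \<open>Tor\<^sub>j\<^sub>+\<^sub>1(N / L) = 0\<close>, written with representatives: a chain of degree \<open>j + 1\<close> with values in \<open>N\<close> that is
  a cycle modulo \<open>L\<close> is a boundary modulo \<open>L\<close>.  The index is shifted since \<open>Tor\<^sub>0\<close> is never meant.
\<close>

definition koszul_exact :: "'m set \<Rightarrow> 'm set \<Rightarrow> nat \<Rightarrow> bool" where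
  "koszul_exact N L j \<longleftrightarrow>
    (\<forall>c. (\<forall>A. card A = Suc j \<longrightarrow> c A \<in> N) \<longrightarrow> (\<forall>A. card A = j \<longrightarrow> kdiff c A \<in> L) \<longrightarrow>
      (\<exists>b. (\<forall>A. card A = Suc (Suc j) \<longrightarrow> b A \<in> N) \<and>
           (\<forall>A. card A = Suc j \<longrightarrow> c A - kdiff b A \<in> L)))"

lemma koszul_exactE:
  assumes "koszul_exact N L j" "\<And>A. card A = Suc j \<Longrightarrow> c A \<in> N" "\<And>A. card A = j \<Longrightarrow> kdiff c A \<in> L"
  obtains b where "\<And>A. card A = Suc (Suc j) \<Longrightarrow> b A \<in> N"
    "\<And>A. card A = Suc j \<Longrightarrow> c A - kdiff b A \<in> L"
  using assms unfolding koszul_exact_def by blast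

lemma kdiff_diff: "kdiff (\<lambda>A. b A - c A) A = kdiff b A - kdiff c A"
  by (simp add: kdiff_def scale_right_diff_distrib sum_subtractf)

lemma kdiff_add: "kdiff (\<lambda>A. b A + c A) A = kdiff b A + kdiff c A"
  by (simp add: kdiff_def scale_right_distrib sum.distrib)

lemma kdiff_scale: "kdiff (\<lambda>A. r \<cdot> c A) A = r \<cdot> kdiff c A"
  by (simp add: kdiff_def scale_sum_right mult.commute)

lemma kdiff_sum: "kdiff (\<lambda>A. \<Sum>i\<in>I. f i A) A = (\<Sum>i\<in>I. kdiff (f i) A)"
  by (simp add: kdiff_def scale_sum_right sum.swap[of _ I])

lemma kdiff_cong:
  assumes "\<And>B. card B = Suc j \<Longrightarrow> b B = c B" "card A = j"
  shows "kdiff b A = kdiff c A"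
  unfolding kdiff_def using assms by (intro sum.cong) auto

lemma kdiff_mem:
  assumes "subspace N" "\<And>A. card A = Suc j \<Longrightarrow> c A \<in> N" "card A = j"
  shows "kdiff c A \<in> N"
  unfolding kdiff_def using assms by (intro subspace_sum subspace_scale) auto

text \<open>
  The double sum runs over ordered pairs of distinct indices outside \<open>A\<close>, and exchanging the two
  indices changes the sign of the summand.
\<close>

lemma kdiff_kdiff: "kdiff (kdiff c) A = 0"
proof -
  define t where "t i k = (ksign i A * x i * (ksign k (insert i A) * x k)) \<cdot> c (insert k (insert i A))" for i k
  have anti: "t k i = - t i k" if "i \<notin> A" "k \<notin> A" "i \<noteq> k" for i k
  proof -
    have "ksign k A * x k * (ksign i (insert k A) * x i) = (ksign k A * ksign i (insert k A)) * (x k * x i)"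
      by (simp add: mult_ac)
    also have "\<dots> = - (ksign i A * x i * (ksign k (insert i A) * x k))"
      using arg_cong[OF ksign_exchange[OF that], of "\<lambda>t::'r. t * (x k * x i)"] by (simp add: mult_ac)
    finally show ?thesis by (simp add: t_def insert_commute)
  qed
  define P where "P = {(i,k). i \<in> - A \<and> k \<in> - A \<and> i \<noteq> k}"
  have "kdiff (kdiff c) A = (\<Sum>i\<in>- A. \<Sum>k\<in>- insert i A. t i k)"
    by (simp add: kdiff_def t_def scale_sum_right)
  also have "\<dots> = (\<Sum>(i,k)\<in>Sigma (- A) (\<lambda>i. - insert i A). t i k)"
    by (simp add: sum.Sigma)
  also have "Sigma (- A) (\<lambda>i. - insert i A) =
      {p\<in>P. to_nat (fst p) < to_nat (snd p)} \<union> {p\<in>P. to_nat (snd p) < to_nat (fst p)}"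
    using inj_to_nat[where 'a='n] by (auto simp: P_def inj_eq) (metis linorder_cases to_nat_split)
  also have "(\<Sum>(i,k)\<in>\<dots>. t i k) = (\<Sum>(i,k)\<in>{p\<in>P. to_nat (fst p) < to_nat (snd p)}. t i k) +
      (\<Sum>(i,k)\<in>{p\<in>P. to_nat (snd p) < to_nat (fst p)}. t i k)"
    by (rule sum.union_disjoint) auto
  also have "(\<Sum>(i,k)\<in>{p\<in>P. to_nat (snd p) < to_nat (fst p)}. t i k) =
      (\<Sum>(i,k)\<in>{p\<in>P. to_nat (fst p) < to_nat (snd p)}. t k i)"
    by (rule sum.reindex_bij_witness[of _ prod.swap prod.swap]) (auto simp: P_def)
  also have "\<dots> = - (\<Sum>(i,k)\<in>{p\<in>P. to_nat (fst p) < to_nat (snd p)}. t i k)"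
    unfolding sum_negf[symmetric] by (rule sum.cong) (auto simp: P_def intro: anti)
  finally show ?thesis by simp
qed

text \<open>
  The part of the long exact sequence of \<open>0 \<rightarrow> M / L \<rightarrow> N / L \<rightarrow> N / M \<rightarrow> 0\<close> in which \<open>Tor\<^sub>j\<^sub>+\<^sub>1(M / L)\<close> lies
  between \<open>Tor\<^sub>j\<^sub>+\<^sub>2(N / M)\<close> and \<open>Tor\<^sub>j\<^sub>+\<^sub>1(N / L)\<close>.
\<close>

lemma koszul_exact_sub:
  assumes N: "subspace N" and M: "subspace M" and L: "subspace L" and "L \<subseteq> M" "M \<subseteq> N"
    and ex: "koszul_exact N L j" "koszul_exact N M (Suc j)"
  shows "koszul_exact M L j"
  unfolding koszul_exact_def
proof (intro allI impI)
  fix c assume c: "\<forall>A. card A = Suc j \<longrightarrow> c A \<in> M" "\<forall>A. card A = j \<longrightarrow> kdiff c A \<in> L"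
  obtain b where b: "\<And>A. card A = Suc (Suc j) \<Longrightarrow> b A \<in> N"
      "\<And>A. card A = Suc j \<Longrightarrow> c A - kdiff b A \<in> L"
    using koszul_exactE[OF ex(1), of c] c \<open>M \<subseteq> N\<close> by blast
  have "kdiff b A \<in> M" if "card A = Suc j" for A
    using subspace_diff[OF M, of "c A" "c A - kdiff b A"] b(2)[OF that] c(1) that \<open>L \<subseteq> M\<close> by auto
  then obtain e where e: "\<And>A. card A = Suc (Suc (Suc j)) \<Longrightarrow> e A \<in> N"
      "\<And>A. card A = Suc (Suc j) \<Longrightarrow> b A - kdiff e A \<in> M"
    using koszul_exactE[OF ex(2), of b] b(1) by blast
  have "kdiff (\<lambda>A. b A - kdiff e A) A = kdiff b A" for A
    by (simp add: kdiff_diff kdiff_kdiff)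
  then show "\<exists>b. (\<forall>A. card A = Suc (Suc j) \<longrightarrow> b A \<in> M) \<and> (\<forall>A. card A = Suc j \<longrightarrow> c A - kdiff b A \<in> L)"
    using e(2) b(2) by (intro exI[of _ "\<lambda>A. b A - kdiff e A"]) simp
qed

text \<open>
  The contracting homotopy for multiplication by the variable \<open>x i\<close>.
\<close>

definition kcontract :: "'n \<Rightarrow> ('n set \<Rightarrow> 'm) \<Rightarrow> 'n set \<Rightarrow> 'm" where
  "kcontract i c A = (if i \<in> A then ksign i (A - {i}) \<cdot> c (A - {i}) else 0)"

lemma kdiff_kcontract: "kdiff (kcontract i c) A + kcontract i (kdiff c) A = x i \<cdot> c A"
proof (cases "i \<in> A")
  case False
  have "kdiff (kcontract i c) A = (\<Sum>k\<in>- A. if k = i then x i \<cdot> c A else 0)"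
    unfolding kdiff_def
  proof (rule sum.cong, rule refl)
    fix k assume k: "k \<in> - A"
    have "ksign i A * x i * ksign i A = x i * (ksign i A * ksign i A)"
      by (simp only: mult_ac)
    then have "ksign i A * x i * ksign i A = x i" by simp
    then show "(ksign k A * x k) \<cdot> kcontract i c (insert k A) = (if k = i then x i \<cdot> c A else 0)"
      using False by (simp add: kcontract_def)
  qed
  also have "\<dots> = x i \<cdot> c A"
    using False by (subst sum.delta) auto
  finally show ?thesis using False by (simp add: kcontract_def)
next
  case True
  define B where "B = A - {i}"
  have A: "A = insert i B" "i \<notin> B" using True by (auto simp: B_def)
  have compl: "- B = insert i (- A)" "i \<notin> - A" using A by auto
  have s: "ksign i B * (ksign i B * x i) = x i"
    by (simp flip: mult.assoc)
  have "kcontract i (kdiff c) A = ksign i B \<cdot> (\<Sum>k\<in>- B. (ksign k B * x k) \<cdot> c (insert k B))"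
    unfolding kdiff_def[symmetric] by (simp add: kcontract_def True B_def)
  also have "\<dots> = x i \<cdot> c A + (\<Sum>k\<in>- A. (ksign i B * (ksign k B * x k)) \<cdot> c (insert k B))"
    unfolding compl(1) sum.insert[OF finite compl(2)] by (simp add: s A(1) scale_right_distrib scale_sum_right)
  finally have 1: "kcontract i (kdiff c) A =
    x i \<cdot> c A + (\<Sum>k\<in>- A. (ksign i B * (ksign k B * x k)) \<cdot> c (insert k B))" .
  have "kdiff (kcontract i c) A = (\<Sum>k\<in>- A. - ((ksign i B * (ksign k B * x k)) \<cdot> c (insert k B)))"
    unfolding kdiff_def
  proof (rule sum.cong, rule refl)
    fix k assume "k \<in> - A"
    then have k: "k \<notin> B" "k \<noteq> i" "i \<notin> B" using A by auto
    then have "insert k A - {i} = insert k B" using A by auto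
    moreover have "ksign k A * x k * ksign i (insert k B) = - (ksign i B * (ksign k B * x k))"
    proof -
      have "ksign k A * x k * ksign i (insert k B) = x k * (ksign k (insert i B) * ksign i (insert k B))"
        by (simp add: A(1) mult_ac)
      also have "\<dots> = - (ksign i B * (ksign k B * x k))"
        using arg_cong[OF ksign_exchange'[of i B k], of "\<lambda>t::'r. t * x k"] k by (simp add: mult_ac)
      finally show ?thesis .
    qed
    ultimately show "(ksign k A * x k) \<cdot> kcontract i c (insert k A) =
        - ((ksign i B * (ksign k B * x k)) \<cdot> c (insert k B))"
      using A by (simp add: kcontract_def)
  qed
  then show ?thesis using 1 by (simp add: sum_negf)
qed

text \<open>
  Since \<open>f = \<Sum> g\<^sub>i x\<^sub>i\<close> is homotopic to zero, multiplication by \<open>f\<close> on \<open>M = N / L\<close> induces zero on \<open>Tor\<close>.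
  Hence the long exact sequence of \<open>0 \<rightarrow> M \<rightarrow> M \<rightarrow> M / f M \<rightarrow> 0\<close> embeds \<open>Tor\<^sub>j\<^sub>+\<^sub>1(M)\<close> into
  \<open>Tor\<^sub>j\<^sub>+\<^sub>2(M / f M)\<close>.
\<close>

lemma koszul_exact_of_regular:
  assumes N: "subspace N" and L: "subspace L"
    and f: "f = (\<Sum>i\<in>UNIV. g i * x i)"
    and reg: "\<And>y. y \<in> N \<Longrightarrow> f \<cdot> y \<in> L \<Longrightarrow> y \<in> L"
    and ex: "koszul_exact N {l + f \<cdot> y | l y. l \<in> L \<and> y \<in> N} (Suc j)"
  shows "koszul_exact N L j"
  unfolding koszul_exact_def
proof (intro allI impI)
  fix c assume c: "\<forall>A. card A = Suc j \<longrightarrow> c A \<in> N" "\<forall>A. card A = j \<longrightarrow> kdiff c A \<in> L"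
  define b where "b A = (\<Sum>i\<in>UNIV. g i \<cdot> kcontract i c A)" for A
  define l where "l A = (\<Sum>i\<in>UNIV. g i \<cdot> kcontract i (kdiff c) A)" for A
  have fc: "f \<cdot> c A = kdiff b A + l A" for A
  proof -
    have "f \<cdot> c A = (\<Sum>i\<in>UNIV. g i \<cdot> (kdiff (kcontract i c) A + kcontract i (kdiff c) A))"
      by (simp add: f scale_sum_left kdiff_kcontract)
    also have "\<dots> = kdiff b A + l A"
      by (simp add: b_def[abs_def] l_def kdiff_sum kdiff_scale scale_right_distrib sum.distrib)
    finally show ?thesis .
  qed
  have bN: "b A \<in> N" if "card A = Suc (Suc j)" for A
    unfolding b_def using that c(1)
    by (intro subspace_sum[OF N] subspace_scale[OF N])
       (auto simp: kcontract_def intro: subspace_scale[OF N] subspace_0[OF N])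
  have lL: "l A \<in> L" if "card A = Suc j" for A
    unfolding l_def using that c(2)
    by (intro subspace_sum[OF L] subspace_scale[OF L])
       (auto simp: kcontract_def intro: subspace_scale[OF L] subspace_0[OF L])
  have "kdiff b A \<in> {l + f \<cdot> y | l y. l \<in> L \<and> y \<in> N}" if "card A = Suc j" for A
  proof -
    have "kdiff b A = - l A + f \<cdot> c A" by (simp add: fc)
    then show ?thesis using subspace_neg[OF L lL[OF that]] c(1) that by blast
  qed
  \<comment> \<open>the chain \<open>b\<close> that bounds \<open>f c\<close> is a cycle modulo \<open>L + f N\<close>\<close>
  then obtain e where e: "\<And>A. card A = Suc (Suc (Suc j)) \<Longrightarrow> e A \<in> N"
      "\<And>A. card A = Suc (Suc j) \<Longrightarrow> b A - kdiff e A \<in> {l + f \<cdot> y | l y. l \<in> L \<and> y \<in> N}"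
    using koszul_exactE[OF ex, of b] bN by blast
  have "\<forall>A. \<exists>p. card A = Suc (Suc j) \<longrightarrow> b A - kdiff e A = fst p + f \<cdot> snd p \<and> fst p \<in> L \<and> snd p \<in> N"
    using e(2) by fastforce
  from choice[OF this] obtain p where
    p: "\<And>A. card A = Suc (Suc j) \<Longrightarrow> b A - kdiff e A = fst (p A) + f \<cdot> snd (p A) \<and> fst (p A) \<in> L \<and> snd (p A) \<in> N"
    by blast
  define m y where "m A = fst (p A)" and "y A = snd (p A)" for A
  have my: "\<And>A. card A = Suc (Suc j) \<Longrightarrow> b A - kdiff e A = m A + f \<cdot> y A"
      "\<And>A. card A = Suc (Suc j) \<Longrightarrow> m A \<in> L" "\<And>A. card A = Suc (Suc j) \<Longrightarrow> y A \<in> N"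
    using p by (simp_all add: m_def y_def)
  \<comment> \<open>the chain \<open>f (c - kdiff y)\<close> has values in \<open>L\<close>, and \<open>f\<close> can be cancelled\<close>
  have "c A - kdiff y A \<in> L" if A: "card A = Suc j" for A
  proof (rule reg)
    show "c A - kdiff y A \<in> N"
      using subspace_diff[OF N _ kdiff_mem[OF N my(3) A]] c(1) A by simp
    have "kdiff b A = kdiff (\<lambda>A. b A - kdiff e A) A"
      by (simp add: kdiff_diff kdiff_kdiff)
    also have "\<dots> = kdiff (\<lambda>A. m A + f \<cdot> y A) A"
      using my(1) A by (rule kdiff_cong)
    finally have "kdiff b A = kdiff m A + f \<cdot> kdiff y A"
      by (simp add: kdiff_add kdiff_scale)
    then have "f \<cdot> (c A - kdiff y A) = kdiff m A + l A"
      by (simp add: scale_right_diff_distrib fc)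
    then show "f \<cdot> (c A - kdiff y A) \<in> L"
      using kdiff_mem[OF L my(2) A] lL[OF A] subspace_add[OF L] by simp
  qed
  then show "\<exists>b. (\<forall>A. card A = Suc (Suc j) \<longrightarrow> b A \<in> N) \<and> (\<forall>A. card A = Suc j \<longrightarrow> c A - kdiff b A \<in> L)"
    using my(3) by blast
qed

text \<open>
  Regularity of a sequence on \<open>N / L\<close>; dividing by its first element means enlarging \<open>L\<close> to \<open>L + f N\<close>.
\<close>

fun regular_on :: "'m set \<Rightarrow> 'm set \<Rightarrow> 'r list \<Rightarrow> bool" where
  "regular_on N L [] \<longleftrightarrow> True"
| "regular_on N L (f # fs) \<longleftrightarrow> (\<forall>y\<in>N. f \<cdot> y \<in> L \<longrightarrow> y \<in> L) \<and>
     regular_on N {l + f \<cdot> y | l y. l \<in> L \<and> y \<in> N} fs"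

lemma subspace_add_image:
  assumes "subspace N" "subspace L"
  shows "subspace {l + f \<cdot> y | l y. l \<in> L \<and> y \<in> N}"
proof (rule subspaceI)
  show "0 \<in> {l + f \<cdot> y | l y. l \<in> L \<and> y \<in> N}"
    using subspace_0[OF assms(1)] subspace_0[OF assms(2)] by force
next
  fix u v assume "u \<in> {l + f \<cdot> y | l y. l \<in> L \<and> y \<in> N}" "v \<in> {l + f \<cdot> y | l y. l \<in> L \<and> y \<in> N}"
  then obtain l y l' y' where uv: "u = l + f \<cdot> y" "v = l' + f \<cdot> y'" "l \<in> L" "l' \<in> L" "y \<in> N" "y' \<in> N"
    by blast
  then have "u + v = (l + l') + f \<cdot> (y + y')" by (simp add: algebra_simps)
  then show "u + v \<in> {l + f \<cdot> y | l y. l \<in> L \<and> y \<in> N}"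
    using uv subspace_add assms by blast
next
  fix r u assume "u \<in> {l + f \<cdot> y | l y. l \<in> L \<and> y \<in> N}"
  then obtain l y where u: "u = l + f \<cdot> y" "l \<in> L" "y \<in> N" by blast
  then have "r \<cdot> u = r \<cdot> l + f \<cdot> (r \<cdot> y)" by (simp add: algebra_simps)
  then show "r \<cdot> u \<in> {l + f \<cdot> y | l y. l \<in> L \<and> y \<in> N}"
    using u subspace_scale assms by blast
qed

text \<open>
  Each element of the sequence trades one degree of \<open>Tor\<close>, and no set of variables has more than
  \<open>CARD('n)\<close> elements.
\<close>

theorem koszul_exact_regular_sequence:
  assumes N: "subspace N" and L: "subspace L"
    and "regular_on N L fs" "\<And>f. f \<in> set fs \<Longrightarrow> \<exists>g. f = (\<Sum>i\<in>UNIV. g i * x i)"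
    and "CARD('n) \<le> j + length fs"
  shows "koszul_exact N L j"
  using assms(2-)
proof (induction fs arbitrary: L j)
  case Nil
  have "card A \<noteq> Suc j" for A :: "'n set"
    using card_mono[of UNIV A] Nil by auto
  then show ?case
    using subspace_0[OF N] unfolding koszul_exact_def by (intro allI impI exI[of _ "\<lambda>_. 0"]) auto
next
  case (Cons f fs)
  obtain g where f: "f = (\<Sum>i\<in>UNIV. g i * x i)" using Cons.prems(3) by force
  have "koszul_exact N {l + f \<cdot> y | l y. l \<in> L \<and> y \<in> N} (Suc j)"
  proof (rule Cons.IH)
    show "subspace {l + f \<cdot> y | l y. l \<in> L \<and> y \<in> N}"
      using N Cons.prems(1) by (rule subspace_add_image)
    show "regular_on N {l + f \<cdot> y | l y. l \<in> L \<and> y \<in> N} fs" using Cons.prems(2) by simp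
    show "\<exists>g. f = (\<Sum>i\<in>UNIV. g i * x i)" if "f \<in> set fs" for f
      using Cons.prems(3) that by simp
    show "CARD('n) \<le> Suc j + length fs" using Cons.prems(4) by simp
  qed
  then show ?case
    using Cons.prems(2) by (intro koszul_exact_of_regular[OF N Cons.prems(1) f]) simp_all
qed

lemma koszul_exact_trivial:
  assumes "subspace N" "N \<subseteq> L"
  shows "koszul_exact N L j"
  using assms subspace_0 unfolding koszul_exact_def
  by (intro allI impI exI[of _ "\<lambda>_. 0"]) (auto simp: kdiff_def)

end

text \<open>
  The assumptions say that \<open>h\<close> induces an isomorphism from \<open>N / L\<close> to \<open>N' / L'\<close>.
\<close>

lemma koszul_exact_pullback:
  assumes "koszul s1" "koszul s2"
    and lin: "\<And>a b. h (a + b) = h a + h b" "\<And>r a. h (s1 r a) = s2 r (h a)"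
    and hN: "h ` N \<subseteq> N'" and N': "N' \<subseteq> {h y + l | y l. y \<in> N \<and> l \<in> L'}"
    and L': "\<And>y. y \<in> N \<Longrightarrow> h y \<in> L' \<longleftrightarrow> y \<in> L"
    and sub: "Modules.module.subspace s2 L'" "Modules.module.subspace s1 N"
    and ex: "koszul.koszul_exact s2 x N' L' j"
  shows "koszul.koszul_exact s1 x N L j"
proof -
  interpret A: koszul s1 x by (rule assms)
  interpret B: koszul s2 x by (rule assms)
  have hsum: "h (sum g I) = (\<Sum>i\<in>I. h (g i))" for g I
  proof -
    have "h 0 = 0" using lin(1)[of 0 0] by simp
    then show ?thesis by (induction I rule: infinite_finite_induct) (auto simp: lin)
  qed
  have hdiff: "h (a - b) = h a - h b" for a b
    using lin(1)[of "a - b" b] by (simp add: algebra_simps)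
  have hk: "h (A.kdiff c A) = B.kdiff (\<lambda>A. h (c A)) A" for c A
    by (simp add: A.kdiff_def B.kdiff_def hsum lin)
  show ?thesis unfolding A.koszul_exact_def
  proof (intro allI impI)
    fix c assume c: "\<forall>A. card A = Suc j \<longrightarrow> c A \<in> N" "\<forall>A. card A = j \<longrightarrow> A.kdiff c A \<in> L"
    have "B.kdiff (\<lambda>A. h (c A)) A \<in> L'" if A: "card A = j" for A
      unfolding hk[symmetric] using c(2) A L' A.kdiff_mem[OF sub(2), of j c A] c(1) by simp
    then obtain b where b: "\<And>A. card A = Suc (Suc j) \<Longrightarrow> b A \<in> N'"
      "\<And>A. card A = Suc j \<Longrightarrow> h (c A) - B.kdiff b A \<in> L'"
      using B.koszul_exactE[OF ex, of "\<lambda>A. h (c A)"] c(1) hN by blast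
    have "\<forall>A. \<exists>p. card A = Suc (Suc j) \<longrightarrow> b A = h (fst p) + snd p \<and> fst p \<in> N \<and> snd p \<in> L'"
      using b(1) N' by fastforce
    from choice[OF this] obtain p where
      p: "\<And>A. card A = Suc (Suc j) \<Longrightarrow> b A = h (fst (p A)) + snd (p A) \<and> fst (p A) \<in> N \<and> snd (p A) \<in> L'"
      by blast
    define y l where "y A = fst (p A)" and "l A = snd (p A)" for A
    have yl: "\<And>A. card A = Suc (Suc j) \<Longrightarrow> b A = h (y A) + l A"
      "\<And>A. card A = Suc (Suc j) \<Longrightarrow> y A \<in> N" "\<And>A. card A = Suc (Suc j) \<Longrightarrow> l A \<in> L'"
      using p by (simp_all add: y_def l_def)
    have "c A - A.kdiff y A \<in> L" if A: "card A = Suc j" for A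
    proof -
      have N: "c A - A.kdiff y A \<in> N"
        using A.subspace_diff[OF sub(2) _ A.kdiff_mem[OF sub(2), of "Suc j" y A]] c(1) yl(2) A by simp
      have "B.kdiff b A = B.kdiff (\<lambda>A. h (y A) + l A) A" using yl(1) A by (rule B.kdiff_cong)
      then have "h (c A - A.kdiff y A) = (h (c A) - B.kdiff b A) + B.kdiff l A"
        by (simp add: B.kdiff_add hk hdiff)
      also have "\<dots> \<in> L'"
        using b(2)[OF A] B.kdiff_mem[OF sub(1), of "Suc j" l A] yl(3) A B.subspace_add[OF sub(1)] by simp
      finally show ?thesis using L' N by simp
    qed
    then show "\<exists>b. (\<forall>A. card A = Suc (Suc j) \<longrightarrow> b A \<in> N) \<and> (\<forall>A. card A = Suc j \<longrightarrow> c A - A.kdiff b A \<in> L)"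
      using yl(2) by blast
  qed
qed

section \<open>Polynomials and monomials\<close>

text \<open>
  Ideals of a ring are its submodules.
\<close>

interpretation ring_mod: Modules.module "(*) :: 'r::comm_ring_1 \<Rightarrow> 'r \<Rightarrow> 'r"
  by unfold_locales (auto simp: algebra_simps)

(* As a rewrite rule this would reverse associativity of the ring multiplication. *)
declare ring_mod.scale_scale [simp del]

lemma poly_mapping_sum_single:
  fixes p :: "'k \<Rightarrow>\<^sub>0 'v::comm_monoid_add"
  shows "p = (\<Sum>m\<in>Poly_Mapping.keys p. Poly_Mapping.single m (Poly_Mapping.lookup p m))"
proof (rule poly_mapping_eqI)
  fix k
  have "Poly_Mapping.lookup (\<Sum>m\<in>Poly_Mapping.keys p. Poly_Mapping.single m (Poly_Mapping.lookup p m)) k =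
      (\<Sum>m\<in>Poly_Mapping.keys p. if m = k then Poly_Mapping.lookup p m else 0)"
    by (simp add: lookup_sum lookup_single when_def)
  then show "Poly_Mapping.lookup p k = Poly_Mapping.lookup (\<Sum>m\<in>Poly_Mapping.keys p. Poly_Mapping.single m (Poly_Mapping.lookup p m)) k"
    by (simp add: in_keys_iff)
qed

lemma poly_mapping_add_induct [case_names zero single add]:
  fixes p :: "'k \<Rightarrow>\<^sub>0 'v::comm_monoid_add"
  assumes "P 0" "\<And>m a. P (Poly_Mapping.single m a)" "\<And>p q. P p \<Longrightarrow> P q \<Longrightarrow> P (p + q)"
  shows "P p"
proof -
  have "P (\<Sum>m\<in>A. Poly_Mapping.single m (Poly_Mapping.lookup p m))" for A
    by (induction A rule: infinite_finite_induct) (use assms in auto)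
  then show ?thesis by (subst poly_mapping_sum_single)
qed

definition mdeg :: "('n::finite \<Rightarrow>\<^sub>0 nat) \<Rightarrow> nat" where
  "mdeg m = (\<Sum>i\<in>UNIV. Poly_Mapping.lookup m i)"

lemma mdeg_add: "mdeg (m + m') = mdeg m + mdeg m'"
  by (simp add: mdeg_def lookup_add sum.distrib)

lemma mdeg_single [simp]: "mdeg (Poly_Mapping.single i k) = k"
  by (simp add: mdeg_def lookup_single when_def)

lemma mdeg_eq_0: "mdeg m = 0 \<longleftrightarrow> m = 0"
  by (auto simp: mdeg_def intro: poly_mapping_eqI)

lemma monomial_split:
  fixes m :: "'n \<Rightarrow>\<^sub>0 nat"
  assumes "Poly_Mapping.lookup m i \<noteq> 0"
  obtains m' where "m = Poly_Mapping.single i 1 + m'"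
proof
  show "m = Poly_Mapping.single i 1 + (m - Poly_Mapping.single i 1)"
    using assms by (intro poly_mapping_eqI) (auto simp: lookup_add lookup_minus lookup_single when_def)
qed

lemma mpoly_ring_induct [case_names const var add mult]:
  fixes p :: "'n::finite mpoly"
  assumes const: "\<And>q. P (const_poly q)" and var: "\<And>i. P (var_poly i)"
    and add: "\<And>p q. P p \<Longrightarrow> P q \<Longrightarrow> P (p + q)" and mult: "\<And>p q. P p \<Longrightarrow> P q \<Longrightarrow> P (p * q)"
  shows "P p"
proof (induction p rule: poly_mapping_add_induct)
  case zero
  then show ?case using const[of 0] by (simp add: const_poly_def)
next
  case (single m a)
  show ?case
  proof (induction "mdeg m" arbitrary: m)
    case 0
    then show ?case using const[of a] by (simp add: const_poly_def mdeg_eq_0)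
  next
    case (Suc k)
    then have "m \<noteq> 0" by (auto simp: mdeg_eq_0[symmetric])
    then obtain i where "Poly_Mapping.lookup m i \<noteq> 0" using poly_mapping_eqI[of m 0] by auto
    then obtain m' where m': "m = Poly_Mapping.single i 1 + m'" by (rule monomial_split)
    then have "P (Poly_Mapping.single m' a)" using Suc by (intro Suc) (simp add: mdeg_add)
    then show ?case using mult[OF var[of i], of "Poly_Mapping.single m' a"] by (simp add: m' var_poly_def mult_single)
  qed
next
  case (add p q)
  then show ?case by (rule assms)
qed

lemma lookup_single_mult:
  fixes p :: "('n \<Rightarrow>\<^sub>0 nat) \<Rightarrow>\<^sub>0 'v::comm_semiring_0"
  shows "Poly_Mapping.lookup (Poly_Mapping.single e c * p) (e + m) = c * Poly_Mapping.lookup p m"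
  by (induction p rule: poly_mapping_add_induct)
     (auto simp: mult_single lookup_single lookup_add distrib_left when_def)

section \<open>Ideals of the polynomial ring\<close>

lemma cring_poly_ring: "cring (poly_ring :: 'n mpoly ring)"
proof (rule cringI)
  show "abelian_group (poly_ring :: 'n mpoly ring)"
  proof (rule abelian_groupI)
    fix x :: "'n mpoly" assume "x \<in> carrier poly_ring"
    show "\<exists>y\<in>carrier poly_ring. y \<oplus>\<^bsub>poly_ring\<^esub> x = \<zero>\<^bsub>poly_ring\<^esub>"
      by (intro bexI[of _ "- x"]) (auto simp: poly_ring_def)
  qed (auto simp: poly_ring_def algebra_simps)
  show "comm_monoid (poly_ring :: 'n mpoly ring)"
  proof (rule comm_monoidI)
    fix x y z :: "'n mpoly"
    show "x \<otimes>\<^bsub>poly_ring\<^esub> y \<in> carrier poly_ring" by (simp add: poly_ring_def)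
    show "\<one>\<^bsub>poly_ring\<^esub> \<in> carrier (poly_ring :: 'n mpoly ring)" by (simp add: poly_ring_def)
    show "x \<otimes>\<^bsub>poly_ring\<^esub> y \<otimes>\<^bsub>poly_ring\<^esub> z = x \<otimes>\<^bsub>poly_ring\<^esub> (y \<otimes>\<^bsub>poly_ring\<^esub> z)"
      unfolding poly_ring_def monoid.simps by (rule mult.assoc)
    show "\<one>\<^bsub>poly_ring\<^esub> \<otimes>\<^bsub>poly_ring\<^esub> x = x" unfolding poly_ring_def monoid.simps by (rule mult_1_left)
    show "x \<otimes>\<^bsub>poly_ring\<^esub> y = y \<otimes>\<^bsub>poly_ring\<^esub> x" unfolding poly_ring_def monoid.simps by (rule mult.commute)
  qed
qed (auto simp: poly_ring_def algebra_simps)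

lemma a_inv_poly_ring: "\<ominus>\<^bsub>poly_ring\<^esub> p = - (p :: 'n mpoly)"
proof -
  interpret cring "poly_ring :: 'n mpoly ring" by (rule cring_poly_ring)
  show ?thesis by (rule minus_equality) (auto simp: poly_ring_def)
qed

lemma genideal_poly_ring: "Idl\<^bsub>poly_ring\<^esub> G = ring_mod.span (G :: 'n mpoly set)"
proof
  interpret cring "poly_ring :: 'n mpoly ring" by (rule cring_poly_ring)
  have "ideal (ring_mod.span G) poly_ring"
  proof (rule idealI)
    show "ring (poly_ring :: 'n mpoly ring)" by (rule ring_axioms)
    show "subgroup (ring_mod.span G) (add_monoid poly_ring)"
    proof (rule subgroup.intro)
      fix x assume "x \<in> ring_mod.span G"
      then show "inv\<^bsub>add_monoid poly_ring\<^esub> x \<in> ring_mod.span G"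
        using a_inv_poly_ring[of x] by (simp add: a_inv_def ring_mod.span_neg)
    qed (auto simp: poly_ring_def ring_mod.span_add ring_mod.span_zero)
    fix a x assume "a \<in> ring_mod.span G" "x \<in> carrier (poly_ring :: 'n mpoly ring)"
    then show "x \<otimes>\<^bsub>poly_ring\<^esub> a \<in> ring_mod.span G" "a \<otimes>\<^bsub>poly_ring\<^esub> x \<in> ring_mod.span G"
      using ring_mod.span_scale[of a G x] by (auto simp: poly_ring_def mult.commute)
  qed
  then show "Idl\<^bsub>poly_ring\<^esub> G \<subseteq> ring_mod.span G"
    by (intro genideal_minimal) (auto simp: ring_mod.span_base)
  have "ideal (Idl\<^bsub>poly_ring\<^esub> G) poly_ring" by (rule genideal_ideal) (simp add: poly_ring_def)
  then interpret I: ideal "Idl\<^bsub>poly_ring\<^esub> G" "poly_ring :: 'n mpoly ring" .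
  have "ring_mod.subspace (Idl\<^bsub>poly_ring\<^esub> G)"
    using I.zero_closed I.a_closed I.I_l_closed
    by (intro ring_mod.subspaceI) (auto simp: poly_ring_def)
  then show "ring_mod.span G \<subseteq> Idl\<^bsub>poly_ring\<^esub> G"
    by (intro ring_mod.span_minimal genideal_self) (auto simp: poly_ring_def)
qed

text \<open>
  The ideal generated by a set of variables is a monomial ideal, so membership can be read off from the
  monomials that occur.
\<close>

lemma var_ideal_iff:
  fixes p :: "'n::finite mpoly"
  shows "(\<exists>q. p = (\<Sum>i\<in>A. q i * var_poly i)) \<longleftrightarrow>
    (\<forall>m\<in>Poly_Mapping.keys p. \<exists>i\<in>A. Poly_Mapping.lookup m i \<noteq> 0)"
proof
  assume "\<exists>q. p = (\<Sum>i\<in>A. q i * var_poly i)"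
  then obtain q where p: "p = (\<Sum>i\<in>A. q i * var_poly i)" by blast
  show "\<forall>m\<in>Poly_Mapping.keys p. \<exists>i\<in>A. Poly_Mapping.lookup m i \<noteq> 0"
  proof
    fix m assume "m \<in> Poly_Mapping.keys p"
    then have "Poly_Mapping.lookup p m \<noteq> 0" by (simp add: in_keys_iff)
    then obtain i where i: "i \<in> A" "Poly_Mapping.lookup (q i * var_poly i) m \<noteq> 0"
      unfolding p lookup_sum by (meson sum.neutral)
    then have "m \<in> Poly_Mapping.keys (q i * var_poly i)" by (simp add: in_keys_iff)
    then obtain m' where "m = m' + Poly_Mapping.single i 1"
      using keys_mult[of "q i" "var_poly i"] by (auto simp: var_poly_def)
    then show "\<exists>i\<in>A. Poly_Mapping.lookup m i \<noteq> 0"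
      using i(1) by (intro bexI[of _ i]) (auto simp: lookup_add)
  qed
next
  assume *: "\<forall>m\<in>Poly_Mapping.keys p. \<exists>i\<in>A. Poly_Mapping.lookup m i \<noteq> 0"
  define V where "V = {p :: 'n mpoly. \<exists>q. p = (\<Sum>i\<in>A. q i * var_poly i)}"
  have add: "a + b \<in> V" if ab: "a \<in> V" "b \<in> V" for a b
  proof -
    obtain q r where "a = (\<Sum>i\<in>A. q i * var_poly i)" "b = (\<Sum>i\<in>A. r i * var_poly i)"
      using ab by (auto simp: V_def)
    then have "a + b = (\<Sum>i\<in>A. (q i + r i) * var_poly i)" by (simp add: sum.distrib distrib_right)
    then show ?thesis unfolding V_def by (intro CollectI exI[of _ "\<lambda>i. q i + r i"])
  qed
  have zero: "0 \<in> V" unfolding V_def by (intro CollectI exI[of _ "\<lambda>_. 0"]) simp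
  have single: "Poly_Mapping.single m a \<in> V" if m: "m \<in> Poly_Mapping.keys p" for m a
  proof -
    obtain i where i: "i \<in> A" "Poly_Mapping.lookup m i \<noteq> 0" using * m by blast
    then obtain m' where m': "m = Poly_Mapping.single i 1 + m'" by (meson monomial_split)
    have "(\<Sum>k\<in>A. (if k = i then Poly_Mapping.single m' a else 0) * var_poly k) = Poly_Mapping.single m' a * var_poly i"
      using i(1) finite[of A] by (simp add: if_distrib[of "\<lambda>t. t * _"] cong: if_cong)
    then have "Poly_Mapping.single m a = (\<Sum>k\<in>A. (if k = i then Poly_Mapping.single m' a else 0) * var_poly k)"
      by (simp add: var_poly_def mult_single m' add.commute)
    then show ?thesis unfolding V_def by (intro CollectI exI)
  qed
  have "(\<Sum>m\<in>B. Poly_Mapping.single m (Poly_Mapping.lookup p m)) \<in> V" if "B \<subseteq> Poly_Mapping.keys p" for B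
    using finite_subset[OF that finite_keys] that
    by (induction B rule: finite_induct) (auto intro: add single simp: zero)
  then have "p \<in> V" using poly_mapping_sum_single[of p] by (metis order_refl)
  then show "\<exists>q. p = (\<Sum>i\<in>A. q i * var_poly i)" by (simp add: V_def)
qed

lemma irrelevant_ideal_vars:
  fixes p :: "'n::finite mpoly"
  assumes "p \<in> irrelevant_ideal"
  shows "\<exists>g. p = (\<Sum>i\<in>UNIV. g i * var_poly i)"
proof -
  have "ring_mod.span (range var_poly) \<subseteq> {p :: 'n mpoly. \<exists>q. p = (\<Sum>i\<in>UNIV. q i * var_poly i)}"
  proof (rule ring_mod.span_minimal)
    show "range var_poly \<subseteq> {p :: 'n mpoly. \<exists>q. p = (\<Sum>i\<in>UNIV. q i * var_poly i)}"
      unfolding var_ideal_iff by (auto simp: var_poly_def) (metis lookup_single_eq zero_less_Suc)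
    show "ring_mod.subspace {p :: 'n mpoly. \<exists>q. p = (\<Sum>i\<in>UNIV. q i * var_poly i)}"
    proof (rule ring_mod.subspaceI)
      show "0 \<in> {p :: 'n mpoly. \<exists>q. p = (\<Sum>i\<in>UNIV. q i * var_poly i)}"
        unfolding var_ideal_iff by simp
      show "a + b \<in> {p :: 'n mpoly. \<exists>q. p = (\<Sum>i\<in>UNIV. q i * var_poly i)}"
        if "a \<in> {p :: 'n mpoly. \<exists>q. p = (\<Sum>i\<in>UNIV. q i * var_poly i)}"
          "b \<in> {p :: 'n mpoly. \<exists>q. p = (\<Sum>i\<in>UNIV. q i * var_poly i)}" for a b
        using that keys_add[of a b] unfolding var_ideal_iff by blast
      show "c * a \<in> {p :: 'n mpoly. \<exists>q. p = (\<Sum>i\<in>UNIV. q i * var_poly i)}"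
        if a: "a \<in> {p :: 'n mpoly. \<exists>q. p = (\<Sum>i\<in>UNIV. q i * var_poly i)}" for c a
      proof -
        obtain q where "a = (\<Sum>i\<in>UNIV. q i * var_poly i)" using a by blast
        then have "c * a = (\<Sum>i\<in>UNIV. (c * q i) * var_poly i)" by (simp add: sum_distrib_left mult.assoc)
        then show ?thesis by (intro CollectI exI[of _ "\<lambda>i. c * q i"])
      qed
    qed
  qed
  then show ?thesis using assms unfolding irrelevant_ideal_def genideal_poly_ring by blast
qed

section \<open>Substitution\<close>

definition subst_poly :: "('n::finite \<Rightarrow> 'n mpoly) \<Rightarrow> 'n mpoly \<Rightarrow> 'n mpoly" where
  "subst_poly f p = (\<Sum>m\<in>Poly_Mapping.keys p.
     const_poly (Poly_Mapping.lookup p m) * (\<Prod>i\<in>UNIV. f i ^ Poly_Mapping.lookup m i))"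

lemma const_poly_add: "const_poly (a + b) = const_poly a + const_poly b"
  by (simp add: const_poly_def single_add)

lemma const_poly_mult: "const_poly (a * b) = const_poly a * const_poly b"
  by (simp add: const_poly_def mult_single)

lemma const_poly_0 [simp]: "const_poly 0 = 0"
  by (simp add: const_poly_def)

lemma const_poly_1 [simp]: "const_poly 1 = 1"
  by (simp add: const_poly_def)

lemma const_poly_minus: "const_poly (- a) = - const_poly a"
  by (simp add: const_poly_def single_uminus)

lemma const_poly_sum: "const_poly (\<Sum>i\<in>I. h i) = (\<Sum>i\<in>I. const_poly (h i))"
  by (induction I rule: infinite_finite_induct) (auto simp: const_poly_add)

lemma subst_poly_superset:
  assumes "finite K" "Poly_Mapping.keys p \<subseteq> K"
  shows "subst_poly f p = (\<Sum>m\<in>K.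
     const_poly (Poly_Mapping.lookup p m) * (\<Prod>i\<in>UNIV. f i ^ Poly_Mapping.lookup m i))"
  unfolding subst_poly_def using assms
  by (intro sum.mono_neutral_left) (auto simp: in_keys_iff)

lemma subst_poly_0 [simp]: "subst_poly f 0 = 0"
  by (simp add: subst_poly_def)

lemma subst_poly_add: "subst_poly f (p + q) = subst_poly f p + subst_poly f q"
proof -
  let ?K = "Poly_Mapping.keys p \<union> Poly_Mapping.keys q"
  show ?thesis
    using keys_add[of p q]
    by (simp add: subst_poly_superset[of ?K] lookup_add const_poly_add distrib_right sum.distrib)
qed

lemma subst_poly_single:
  "subst_poly f (Poly_Mapping.single m a) = const_poly a * (\<Prod>i\<in>UNIV. f i ^ Poly_Mapping.lookup m i)"
  by (simp add: subst_poly_superset[of "{m}"])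

lemma subst_poly_mult: "subst_poly f (p * q) = subst_poly f p * subst_poly f q"
proof (induction p rule: poly_mapping_add_induct)
  case (single m a)
  show ?case
  proof (induction q rule: poly_mapping_add_induct)
    case (single m' a')
    show ?case
      by (simp add: mult_single subst_poly_single lookup_add power_add prod.distrib const_poly_mult mult_ac)
  qed (simp_all add: distrib_left subst_poly_add)
qed (simp_all add: distrib_right subst_poly_add)

lemma subst_poly_const [simp]: "subst_poly f (const_poly a) = const_poly a"
  by (simp add: const_poly_def[of a] subst_poly_single)

lemma subst_poly_var [simp]: "subst_poly f (var_poly i) = f i"
proof -
  have "(\<Prod>k\<in>UNIV. f k ^ Poly_Mapping.lookup (Poly_Mapping.single i (1::nat)) k) = (\<Prod>k\<in>UNIV. if k = i then f k else 1)"
    by (rule prod.cong) (auto simp: lookup_single when_def)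
  then show ?thesis by (simp add: var_poly_def subst_poly_single)
qed

lemma subst_poly_sum: "subst_poly f (\<Sum>i\<in>I. g i) = (\<Sum>i\<in>I. subst_poly f (g i))"
  by (induction I rule: infinite_finite_induct) (auto simp: subst_poly_add)

lemma subst_poly_diff: "subst_poly f (p - q) = subst_poly f p - subst_poly f q"
  using subst_poly_add[of f "p - q" q] by (simp add: algebra_simps)

lemma linear_form_add: "linear_form (u + v) = linear_form u + linear_form v"
  by (simp add: linear_form_def const_poly_add distrib_right sum.distrib)

lemma linear_form_scale: "linear_form (a *s u) = const_poly a * linear_form u"
  by (simp add: linear_form_def const_poly_mult sum_distrib_left mult.assoc)

lemma linear_form_0 [simp]: "linear_form 0 = 0"
  by (simp add: linear_form_def)

lemma linear_form_diff: "linear_form (u - v) = linear_form u - linear_form v"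
  using linear_form_add[of "u - v" v] by simp

lemma linear_form_axis: "linear_form (axis i 1) = var_poly i"
proof -
  have "linear_form (axis i 1) = (\<Sum>k\<in>UNIV. if k = i then var_poly k else 0)"
    unfolding linear_form_def by (rule sum.cong) (auto simp: axis_def)
  then show ?thesis by simp
qed

lemma linear_form_sum: "linear_form (\<Sum>i\<in>I. g i) = (\<Sum>i\<in>I. linear_form (g i))"
  by (induction I rule: infinite_finite_induct) (auto simp: linear_form_add)

section \<open>The ideal of a cone\<close>

definition vanishing_vectors :: "(rat ^ 'n::finite) set \<Rightarrow> (rat ^ 'n) set" where
  "vanishing_vectors X = {u. \<forall>x\<in>vec.span X. rdot u x = 0}"

lemma cone_ideal_span: "cone_ideal X = ring_mod.span (linear_form ` vanishing_vectors X)"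
proof -
  have "{linear_form u | u. \<forall>x\<in>vec.span X. rdot u x = 0} = linear_form ` vanishing_vectors X"
    by (auto simp: vanishing_vectors_def)
  then show ?thesis by (simp add: cone_ideal_def genideal_poly_ring)
qed

lemma subspace_cone_ideal: "ring_mod.subspace (cone_ideal X)"
  by (simp add: cone_ideal_span)

lemma cone_ideal_mono: "vec.span Y \<subseteq> vec.span X \<Longrightarrow> cone_ideal X \<subseteq> cone_ideal Y"
  unfolding cone_ideal_span by (intro ring_mod.span_mono) (auto simp: vanishing_vectors_def)

lemma rdot_axis: "rdot u (axis i 1) = u $ i"
proof -
  have "rdot u (axis i 1) = (\<Sum>k\<in>UNIV. if k = i then u $ k else 0)"
    unfolding rdot_def by (rule sum.cong) (auto simp: axis_def)
  then show ?thesis by simp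
qed

lemma rdot_commute: "rdot u v = rdot v u"
  by (simp add: rdot_def mult.commute)

lemma rdot_simps [simp]:
  "rdot u 0 = 0" "rdot 0 u = 0" "rdot u (v + w) = rdot u v + rdot u w" "rdot (v + w) u = rdot v u + rdot w u"
  "rdot u (a *s v) = a * rdot u v" "rdot (a *s v) u = a * rdot v u"
  "rdot u (v - w) = rdot u v - rdot u w" "rdot (v - w) u = rdot v u - rdot w u"
  "rdot u (- v) = - rdot u v" "rdot (- v) u = - rdot v u"
  by (simp_all add: rdot_def algebra_simps sum.distrib sum_distrib_left sum_subtractf sum_negf)

lemma rdot_sum: "rdot u (\<Sum>i\<in>I. f i) = (\<Sum>i\<in>I. rdot u (f i))"
  by (induction I rule: infinite_finite_induct) auto

lemma rdot_sum_left: "rdot (\<Sum>i\<in>I. f i) u = (\<Sum>i\<in>I. rdot (f i) u)"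
  by (induction I rule: infinite_finite_induct) auto

lemma cone_ideal_full:
  assumes "vec.span X = UNIV"
  shows "cone_ideal X = {0}"
proof -
  have "vanishing_vectors X = {0}"
  proof -
    have "u = 0" if "\<forall>x. rdot u x = 0" for u :: "rat ^ 'n"
      using that rdot_axis[of u] by (auto simp: Finite_Cartesian_Product.vec_eq_iff)
    then show ?thesis using assms by (auto simp: vanishing_vectors_def)
  qed
  then show ?thesis unfolding cone_ideal_span using ring_mod.span_singleton[of "0 :: 'n mpoly"] by auto
qed

lemma subspace_vanishing_vectors: "vec.subspace (vanishing_vectors X)"
  by (rule vec.subspaceI) (auto simp: vanishing_vectors_def)

lemma sum_axis: "u = (\<Sum>i\<in>UNIV. u $ i *s axis i (1::rat))"
  by (auto simp: Finite_Cartesian_Product.vec_eq_iff axis_def if_distrib cong: if_cong)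

text \<open>
  For a subspace \<open>W = span X\<close> there is a set \<open>J\<close> of at least \<open>dim W\<close> coordinates that restrict to linearly
  independent functions on \<open>W\<close> and in terms of which every coordinate is expressed on \<open>W\<close>: extend a basis
  of the annihilator of \<open>W\<close> to a basis of the whole space by standard basis vectors.  The coefficients
  \<open>a\<close> describe the projection to the span of these vectors along the annihilator.
\<close>

lemma coordinates_mod_vanishing:
  fixes X :: "(rat ^ 'n::finite) set"
  obtains J a where "vec.dim X \<le> card J"
    "\<And>i. axis i 1 - (\<Sum>j\<in>J. a i j *s axis j 1) \<in> vanishing_vectors X"
    "\<And>u. u \<in> vanishing_vectors X \<Longrightarrow> (\<Sum>i\<in>UNIV. u $ i *s (\<Sum>j\<in>J. a i j *s axis j 1)) = 0"
    "\<And>i. i \<in> J \<Longrightarrow> (\<Sum>j\<in>J. a i j *s axis j 1) = axis i 1"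
proof -
  let ?U = "vanishing_vectors X"
  obtain A where A: "A \<subseteq> ?U" "vec.independent A" "?U \<subseteq> vec.span A"
    using vec.basis_exists[of ?U] by metis
  obtain B where B: "A \<subseteq> B" "B \<subseteq> A \<union> range (\<lambda>i. axis i 1)" "vec.independent B"
      "A \<union> range (\<lambda>i. axis i 1) \<subseteq> vec.span B"
    using vec.maximal_independent_subset_extend[of A "A \<union> range (\<lambda>i. axis i 1)"] A(2) by auto
  define J where "J = {i. axis i 1 \<in> B - A}"
  define E where "E = (\<lambda>i. axis i (1::rat) :: rat ^ 'n) ` J"
  have BE: "B = A \<union> E" using B(1,2) by (auto simp: E_def J_def)
  have disj: "A \<inter> E = {}" by (auto simp: E_def J_def)
  have inj: "inj_on (\<lambda>i. axis i (1::rat) :: rat ^ 'n) J" by (auto simp: inj_on_def axis_eq_axis)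
  have spanA: "vec.span A = ?U"
    using A by (simp add: subset_antisym vec.span_minimal subspace_vanishing_vectors)
  have inter: "v = 0" if v: "v \<in> vec.span A" "v \<in> vec.span E" for v
  proof -
    have indA: "vec.representation B v = vec.representation A v"
      using vec.representation_extend[OF B(3) v(1)] BE by auto
    have indE: "vec.representation B v = vec.representation E v"
      using vec.representation_extend[OF B(3) v(2)] BE by auto
    have "vec.representation B v b = 0" for b
      using vec.representation_ne_zero[of A v b] vec.representation_ne_zero[of E v b] indA indE disj by force
    then show ?thesis
      using vec.sum_nonzero_representation_eq[OF B(3), of v] v(1) vec.span_mono[of A B] BE by auto
  qed
  have spanE: "\<exists>c. v = (\<Sum>j\<in>J. c j *s axis j 1)" if v: "v \<in> vec.span E" for v
  proof -
    obtain u where "v = (\<Sum>e\<in>E. u e *s e)"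
      using v vec.span_finite[of E] by (auto simp: E_def)
    then have "v = (\<Sum>j\<in>J. u (axis j 1) *s axis j 1)"
      unfolding E_def by (simp add: sum.reindex[OF inj])
    then show ?thesis by (rule exI[of _ "\<lambda>j. u (axis j 1)"])
  qed
  have "\<exists>c. axis i 1 - (\<Sum>j\<in>J. c j *s axis j 1) \<in> ?U" for i
  proof -
    have "axis i 1 \<in> vec.span (A \<union> E)" using B(4) BE by auto
    then obtain p q where pq: "axis i 1 = p + q" "p \<in> vec.span A" "q \<in> vec.span E"
      unfolding vec.span_Un by blast
    then obtain c where "q = (\<Sum>j\<in>J. c j *s axis j 1)" using spanE by blast
    then show ?thesis using pq spanA by (intro exI[of _ c]) auto
  qed
  then obtain a where a: "\<And>i. axis i 1 - (\<Sum>j\<in>J. a i j *s axis j 1) \<in> ?U" by metis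
  have inE: "(\<Sum>j\<in>J. c j *s axis j 1) \<in> vec.span E" for c
    by (intro vec.span_sum vec.span_scale vec.span_base) (auto simp: E_def)
  show ?thesis
  proof (rule that[of J a])
    show "axis i 1 - (\<Sum>j\<in>J. a i j *s axis j 1) \<in> ?U" for i by (rule a)
    show "(\<Sum>i\<in>UNIV. u $ i *s (\<Sum>j\<in>J. a i j *s axis j 1)) = 0" if u: "u \<in> ?U" for u
    proof (rule inter)
      show "(\<Sum>i\<in>UNIV. u $ i *s (\<Sum>j\<in>J. a i j *s axis j 1)) \<in> vec.span E"
        by (intro vec.span_sum vec.span_scale inE)
      have "u - (\<Sum>i\<in>UNIV. u $ i *s (axis i 1 - (\<Sum>j\<in>J. a i j *s axis j 1))) \<in> ?U"
        by (intro vec.subspace_diff vec.subspace_sum vec.subspace_scale subspace_vanishing_vectors u a)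
      moreover have "u - (\<Sum>i\<in>UNIV. u $ i *s (axis i 1 - (\<Sum>j\<in>J. a i j *s axis j 1))) =
          (\<Sum>i\<in>UNIV. u $ i *s (\<Sum>j\<in>J. a i j *s axis j 1))"
        by (subst (1) sum_axis) (simp add: vec.scale_right_diff_distrib sum_subtractf)
      ultimately show "(\<Sum>i\<in>UNIV. u $ i *s (\<Sum>j\<in>J. a i j *s axis j 1)) \<in> vec.span A"
        using spanA by simp
    qed
    show "(\<Sum>j\<in>J. a i j *s axis j 1) = axis i 1" if i: "i \<in> J" for i
    proof -
      have "axis i 1 \<in> vec.span E" using i by (auto simp: E_def intro: vec.span_base)
      then have "axis i 1 - (\<Sum>j\<in>J. a i j *s axis j 1) \<in> vec.span E"
        by (intro vec.span_diff inE)
      then show ?thesis using inter a spanA by (metis eq_iff_diff_eq_0)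
    qed
    have eq0: "x = 0" if x: "x \<in> vec.span X" "\<And>j. j \<in> J \<Longrightarrow> x $ j = 0" for x
    proof -
      have "x $ i = 0" for i
      proof -
        have "rdot (axis i 1 - (\<Sum>j\<in>J. a i j *s axis j 1)) x = 0"
          using a x(1) by (auto simp: vanishing_vectors_def)
        moreover have "rdot (axis k 1) x = x $ k" for k
          by (subst rdot_commute) (rule rdot_axis)
        ultimately show ?thesis by (simp add: rdot_sum_left x(2))
      qed
      then show ?thesis by (simp add: Finite_Cartesian_Product.vec_eq_iff)
    qed
    \<comment> \<open>the coordinates in \<open>J\<close> embed the span of \<open>X\<close> into a space of dimension \<open>card J\<close>\<close>
    define P where "P x = (\<chi> i. if i \<in> J then x $ i else 0)" for x :: "rat ^ 'n"
    have P: "Vector_Spaces.linear (*s) (*s) P"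
      by unfold_locales (auto simp: P_def Finite_Cartesian_Product.vec_eq_iff)
    have "inj_on P (vec.span X)"
    proof (rule inj_onI)
      fix x y assume xy: "x \<in> vec.span X" "y \<in> vec.span X" "P x = P y"
      have "x - y = 0"
        using xy by (intro eq0 vec.span_diff) (auto simp: P_def Finite_Cartesian_Product.vec_eq_iff split: if_splits)
      then show "x = y" by simp
    qed
    then have "vec.dim X = vec.dim (P ` X)"
      using vec.dim_image_eq[OF P] by simp
    also have "P ` X \<subseteq> vec.span E"
    proof
      fix y assume "y \<in> P ` X"
      then obtain x where "y = P x" by blast
      then have "y = (\<Sum>i\<in>J. x $ i *s axis i 1)"
        by (auto simp: P_def Finite_Cartesian_Product.vec_eq_iff axis_def if_distrib cong: if_cong)
      then show "y \<in> vec.span E" using inE[of "\<lambda>i. x $ i"] by simp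
    qed
    then have "vec.dim (P ` X) \<le> card E"
      by (intro vec.dim_le_card) (auto simp: E_def)
    finally show "vec.dim X \<le> card J" by (simp add: E_def card_image[OF inj])
  qed
qed

interpretation ring_koszul: koszul "(*) :: 'n::finite mpoly \<Rightarrow> 'n mpoly \<Rightarrow> 'n mpoly" var_poly
  by unfold_locales

text \<open>
  Rewriting each variable modulo \<open>I\<close> by those in \<open>J\<close> is a ring endomorphism \<open>\<phi>\<close> with kernel \<open>I\<close>, and its
  image is the polynomial ring in the variables of \<open>J\<close>.  Hence the variables of \<open>J\<close> form a regular
  sequence on \<open>S / I\<close>.  This is checked through \<open>\<phi>\<close>: adding variables to \<open>I\<close> gives the preimage \<open>L A\<close> of a
  monomial ideal, and modulo the ideal of the variables in \<open>A\<close> every other variable can be cancelled.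
\<close>

theorem cone_quotient_koszul_exact:
  fixes X :: "(rat ^ 'n::finite) set"
  assumes "CARD('n) \<le> j + vec.dim X"
  shows "ring_koszul.koszul_exact UNIV (cone_ideal X) j"
proof -
  obtain J a where J: "vec.dim X \<le> card J"
    and a: "\<And>i. axis i 1 - (\<Sum>j\<in>J. a i j *s axis j 1) \<in> vanishing_vectors X"
      "\<And>u. u \<in> vanishing_vectors X \<Longrightarrow> (\<Sum>i\<in>UNIV. u $ i *s (\<Sum>j\<in>J. a i j *s axis j 1)) = 0"
      "\<And>i. i \<in> J \<Longrightarrow> (\<Sum>j\<in>J. a i j *s axis j 1) = axis i 1"
    by (rule coordinates_mod_vanishing[of X]) (rule that)
  define f where "f i = linear_form (\<Sum>j\<in>J. a i j *s axis j 1)" for i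
  define \<phi> where "\<phi> = subst_poly f"
  have \<phi>_simps: "\<phi> (p + q) = \<phi> p + \<phi> q" "\<phi> (p - q) = \<phi> p - \<phi> q" "\<phi> (p * q) = \<phi> p * \<phi> q"
    "\<phi> (const_poly r) = const_poly r" "\<phi> (var_poly i) = f i" "\<phi> 0 = 0"
    "\<phi> (\<Sum>i\<in>I. g i) = (\<Sum>i\<in>I. \<phi> (g i))" for p q r i and g :: "'n \<Rightarrow> _" and I
    by (simp_all add: \<phi>_def subst_poly_add subst_poly_diff subst_poly_mult subst_poly_sum)
  have fJ: "f i = var_poly i" if "i \<in> J" for i
    using a(3)[OF that] by (simp add: f_def linear_form_axis)
  have diff: "p - \<phi> p \<in> cone_ideal X" for p
  proof (induction p rule: mpoly_ring_induct)
    case (const q)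
    then show ?case using ring_mod.subspace_0[OF subspace_cone_ideal] by (simp add: \<phi>_simps)
  next
    case (var i)
    have "var_poly i - \<phi> (var_poly i) = linear_form (axis i 1 - (\<Sum>j\<in>J. a i j *s axis j 1))"
      by (simp add: \<phi>_simps f_def linear_form_diff linear_form_axis)
    then show ?case using a(1)[of i] unfolding cone_ideal_span by (auto intro: ring_mod.span_base)
  next
    case (add p q)
    have "p + q - \<phi> (p + q) = (p - \<phi> p) + (q - \<phi> q)" by (simp add: \<phi>_simps)
    then show ?case using ring_mod.subspace_add[OF subspace_cone_ideal add] by (simp only:)
  next
    case (mult p q)
    have "p * q - \<phi> (p * q) = \<phi> p * (q - \<phi> q) + q * (p - \<phi> p)" by (simp add: \<phi>_simps algebra_simps)
    then show ?case
      by (simp only: mult ring_mod.subspace_add[OF subspace_cone_ideal] ring_mod.subspace_scale[OF subspace_cone_ideal])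
  qed
  have ker: "\<phi> p = 0 \<longleftrightarrow> p \<in> cone_ideal X" for p
  proof
    assume "p \<in> cone_ideal X"
    then have "p \<in> ring_mod.span (linear_form ` vanishing_vectors X)" by (simp add: cone_ideal_span)
    then show "\<phi> p = 0"
    proof (induction p rule: ring_mod.span_induct_alt)
      case (step c l y)
      then obtain u where u: "l = linear_form u" "u \<in> vanishing_vectors X" by blast
      have "\<phi> l = linear_form (\<Sum>i\<in>UNIV. u $ i *s (\<Sum>j\<in>J. a i j *s axis j 1))"
        by (simp add: u linear_form_def[of u] \<phi>_simps f_def linear_form_sum[of _ UNIV] linear_form_scale)
      then have "\<phi> l = 0" using a(2)[OF u(2)] by simp
      then show ?case using step by (simp add: \<phi>_simps)
    qed (simp add: \<phi>_simps)
  next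
    assume "\<phi> p = 0"
    then show "p \<in> cone_ideal X" using diff[of p] by simp
  qed
  have idem: "\<phi> (\<phi> p) = \<phi> p" for p
    using ker[of "p - \<phi> p"] diff[of p] by (simp add: \<phi>_simps)
  define V where "V A = {p :: 'n mpoly. \<exists>q. p = (\<Sum>i\<in>A. q i * var_poly i)}" for A :: "'n set"
  define L where "L A = {p. \<phi> p \<in> V A}" for A
  have VI: "(\<Sum>i\<in>A. q i * var_poly i) \<in> V A" for q A
    unfolding V_def by (rule CollectI, rule exI[of _ q], rule refl)
  have LV: "\<phi> p \<in> V A" if pA: "p \<in> V A" "A \<subseteq> J" for p A
  proof -
    obtain q where "p = (\<Sum>i\<in>A. q i * var_poly i)" using pA(1) unfolding V_def by blast
    then have "\<phi> p = (\<Sum>i\<in>A. \<phi> (q i) * var_poly i)"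
      using pA(2) by (auto simp: \<phi>_simps fJ intro!: sum.cong)
    then show ?thesis by (simp only: VI)
  qed
  have V_add: "p + q \<in> V A" if "p \<in> V A" "q \<in> V A" for p q A
    using that keys_add[of p q] unfolding V_def var_ideal_iff by blast
  have V_mono: "V A \<subseteq> V B" if "A \<subseteq> B" for A B
    using that unfolding V_def var_ideal_iff by blast
  have step: "{l + var_poly k * y | l y. l \<in> L A \<and> y \<in> UNIV} = L (insert k A)"
    if k: "k \<in> J" "k \<notin> A" "A \<subseteq> J" for k A
  proof (intro subset_antisym subsetI)
    fix p assume "p \<in> {l + var_poly k * y | l y. l \<in> L A \<and> y \<in> UNIV}"
    then obtain l y where p: "p = l + var_poly k * y" "l \<in> L A" by blast
    have "\<phi> y * var_poly k \<in> V (insert k A)"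
      unfolding V_def var_ideal_iff using keys_mult[of "\<phi> y" "var_poly k"]
      by (force simp: var_poly_def lookup_add)
    moreover have "\<phi> l \<in> V (insert k A)" using p(2) V_mono[of A "insert k A"] by (auto simp: L_def)
    ultimately show "p \<in> L (insert k A)"
      using V_add by (simp add: L_def p(1) \<phi>_simps fJ k mult.commute)
  next
    fix p assume "p \<in> L (insert k A)"
    then obtain q where q: "\<phi> p = (\<Sum>i\<in>insert k A. q i * var_poly i)" unfolding L_def V_def by blast
    define s where "s = (\<Sum>i\<in>A. q i * var_poly i)"
    have \<phi>p: "\<phi> p = q k * var_poly k + s" using q k(2) by (simp add: s_def)
    have "\<phi> p = \<phi> (q k) * var_poly k + \<phi> s"
      using arg_cong[OF \<phi>p, of \<phi>] by (simp add: \<phi>_simps idem fJ k)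
    moreover have "s \<in> V A" unfolding s_def by (rule VI)
    ultimately have "p - var_poly k * q k \<in> L A"
      using LV[of s A] k by (simp add: L_def \<phi>_simps fJ mult.commute)
    then show "p \<in> {l + var_poly k * y | l y. l \<in> L A \<and> y \<in> UNIV}"
      by (intro CollectI exI[of _ "p - var_poly k * q k"] exI[of _ "q k"]) simp
  qed
  have cancel: "y \<in> L A" if k: "k \<in> J" "k \<notin> A" and y: "var_poly k * y \<in> L A" for k A y
  proof -
    have y': "var_poly k * \<phi> y \<in> V A" using y k by (simp add: L_def \<phi>_simps fJ)
    have "\<exists>i\<in>A. Poly_Mapping.lookup m i \<noteq> 0" if m: "m \<in> Poly_Mapping.keys (\<phi> y)" for m
    proof -
      have "Poly_Mapping.single k 1 + m \<in> Poly_Mapping.keys (var_poly k * \<phi> y)"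
        using m by (simp add: in_keys_iff var_poly_def lookup_single_mult)
      then obtain i where "i \<in> A" "Poly_Mapping.lookup (Poly_Mapping.single k 1 + m) i \<noteq> 0"
        using y' unfolding V_def var_ideal_iff by blast
      then show ?thesis using k(2) by (intro bexI[of _ i]) (auto simp: lookup_add lookup_single when_def split: if_splits)
    qed
    then show ?thesis unfolding L_def V_def var_ideal_iff by simp
  qed
  have reg: "ring_koszul.regular_on UNIV (L A) (map var_poly ks)"
    if "distinct ks" "set ks \<inter> A = {}" "set ks \<union> A \<subseteq> J" for ks A
    using that
  proof (induction ks arbitrary: A)
    case (Cons k ks)
    have "ring_koszul.regular_on UNIV (L (insert k A)) (map var_poly ks)"
      using Cons.prems by (intro Cons.IH) auto
    moreover have "\<forall>y\<in>UNIV. var_poly k * y \<in> L A \<longrightarrow> y \<in> L A"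
      using cancel Cons.prems by auto
    ultimately show ?case using step[of k A] Cons.prems by simp
  qed simp
  obtain ks where ks: "set ks = J" "distinct ks" using finite_distinct_list[of J] by auto
  have L0: "L {} = cone_ideal X" by (auto simp: L_def V_def ker)
  show ?thesis
  proof (rule ring_koszul.koszul_exact_regular_sequence)
    show "ring_koszul.regular_on UNIV (cone_ideal X) (map var_poly ks)"
      using reg[of ks "{}"] ks by (simp add: L0)
    show "\<exists>g. p = (\<Sum>i\<in>UNIV. g i * var_poly i)" if "p \<in> set (map var_poly ks)" for p :: "'n mpoly"
      unfolding var_ideal_iff using that by (auto simp: var_poly_def) (metis lookup_single_eq zero_less_Suc)
    show "CARD('n) \<le> j + length (map var_poly ks)"
      using assms J ks distinct_card[of ks] by simp
  qed (simp_all add: subspace_cone_ideal)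
qed

section \<open>Homogeneous components\<close>

definition hcomp :: "nat \<Rightarrow> 'n::finite mpoly \<Rightarrow> 'n mpoly" where
  "hcomp t p = Poly_Mapping.mapp (\<lambda>m a. a when mdeg m = t) p"

lemma lookup_hcomp: "Poly_Mapping.lookup (hcomp t p) m = (if mdeg m = t then Poly_Mapping.lookup p m else 0)"
  by (auto simp: hcomp_def lookup_mapp when_def in_keys_iff)

lemma hcomp_add: "hcomp t (p + q) = hcomp t p + hcomp t q"
  by (rule poly_mapping_eqI) (simp add: lookup_hcomp lookup_add)

lemma hcomp_0 [simp]: "hcomp t 0 = 0"
  by (rule poly_mapping_eqI) (simp add: lookup_hcomp)

lemma hcomp_diff: "hcomp t (p - q) = hcomp t p - hcomp t q"
  by (rule poly_mapping_eqI) (simp add: lookup_hcomp lookup_minus)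

lemma hcomp_sum: "hcomp t (\<Sum>i\<in>I. f i) = (\<Sum>i\<in>I. hcomp t (f i))"
  by (induction I rule: infinite_finite_induct) (auto simp: hcomp_add)

lemma hcomp_hcomp: "hcomp t (hcomp s p) = (if s = t then hcomp s p else 0)"
  by (rule poly_mapping_eqI) (simp add: lookup_hcomp)

lemma hcomp_single: "hcomp t (Poly_Mapping.single m a) = (if mdeg m = t then Poly_Mapping.single m a else 0)"
  by (rule poly_mapping_eqI) (auto simp: lookup_hcomp lookup_single when_def)

lemma hcomp_single_mult:
  "hcomp t (Poly_Mapping.single e c * p) =
    (if mdeg e \<le> t then Poly_Mapping.single e c * hcomp (t - mdeg e) p else 0)"
proof (induction p rule: poly_mapping_add_induct)
  case (single m a)
  show ?case by (auto simp: mult_single hcomp_single mdeg_add)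
qed (auto simp: distrib_left hcomp_add)

lemma hcomp_const_mult: "hcomp t (const_poly a * p) = const_poly a * hcomp t p"
  using hcomp_single_mult[of t 0 a p] by (simp add: const_poly_def mdeg_eq_0[THEN iffD2])

lemma hcomp_var_mult:
  "hcomp t (var_poly i * p) = (case t of 0 \<Rightarrow> 0 | Suc s \<Rightarrow> var_poly i * hcomp s p)"
  by (simp add: var_poly_def hcomp_single_mult split: nat.split)

lemma hcomp_linear_form_mult:
  "hcomp t (linear_form u * p) = (case t of 0 \<Rightarrow> 0 | Suc s \<Rightarrow> linear_form u * hcomp s p)"
proof -
  have "linear_form u * p = (\<Sum>i\<in>UNIV. const_poly (u $ i) * (var_poly i * p))" for p
    by (simp add: linear_form_def sum_distrib_right mult.assoc)
  then show ?thesis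
    by (simp add: hcomp_sum hcomp_const_mult hcomp_var_mult split: nat.split)
qed

lemma hcomp_cone_ideal:
  assumes "p \<in> cone_ideal X"
  shows "hcomp t p \<in> cone_ideal X"
  using assms unfolding cone_ideal_span
proof (induction p rule: ring_mod.span_induct_alt)
  case (step c l y)
  then obtain u where u: "l = linear_form u" "u \<in> vanishing_vectors X" by blast
  have "hcomp t (c * l) \<in> ring_mod.span (linear_form ` vanishing_vectors X)"
  proof (cases t)
    case (Suc s)
    have "hcomp t (c * l) = hcomp t (linear_form u * c)" by (simp only: u mult.commute)
    also have "\<dots> = hcomp s c * l" using Suc hcomp_linear_form_mult[of t u c] by (simp add: u(1) mult.commute)
    finally have "hcomp t (c * l) = hcomp s c * l" .
    then show ?thesis using step(1) by (simp add: ring_mod.span_base ring_mod.span_scale)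
  qed (simp add: u mult.commute[of c] hcomp_linear_form_mult ring_mod.span_zero)
  then show ?case using step(2) by (simp add: hcomp_add ring_mod.span_add)
qed (simp add: ring_mod.span_zero)

lemma hcomp_decomposition:
  assumes "\<And>m. m \<in> Poly_Mapping.keys p \<Longrightarrow> mdeg m \<le> N"
  shows "p = (\<Sum>t\<le>N. hcomp t p)"
proof (rule poly_mapping_eqI)
  fix m
  have "Poly_Mapping.lookup (\<Sum>t\<le>N. hcomp t p) m = (if mdeg m \<le> N then Poly_Mapping.lookup p m else 0)"
    by (simp add: lookup_sum lookup_hcomp)
  then show "Poly_Mapping.lookup p m = Poly_Mapping.lookup (\<Sum>t\<le>N. hcomp t p) m"
    using assms[of m] by (auto simp: in_keys_iff)
qed

text \<open>
  Membership in the power \<open>\<mm>\<^sup>n\<close> of the irrelevant ideal.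
\<close>

definition order_ge :: "nat \<Rightarrow> 'n::finite mpoly \<Rightarrow> bool" where
  "order_ge n p \<longleftrightarrow> (\<forall>m\<in>Poly_Mapping.keys p. n \<le> mdeg m)"

lemma order_ge_0 [simp]: "order_ge 0 p"
  by (simp add: order_ge_def)

lemma order_ge_add: "order_ge n p \<Longrightarrow> order_ge n q \<Longrightarrow> order_ge n (p + q)"
  using keys_add[of p q] by (auto simp: order_ge_def)

lemma order_ge_sum: "(\<And>i. i \<in> I \<Longrightarrow> order_ge n (f i)) \<Longrightarrow> order_ge n (\<Sum>i\<in>I. f i)"
  by (induction I rule: infinite_finite_induct) (auto simp: order_ge_add, simp_all add: order_ge_def)

lemma order_ge_mult_var: "order_ge n p \<Longrightarrow> order_ge (Suc n) (p * var_poly i)"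
  using keys_mult[of p "var_poly i"] by (auto simp: order_ge_def var_poly_def mdeg_add)

lemma order_ge_all:
  assumes "\<And>n. order_ge n p"
  shows "p = 0"
proof (rule poly_mapping_eqI)
  fix m show "Poly_Mapping.lookup p m = Poly_Mapping.lookup 0 m"
    using assms[of "Suc (mdeg m)"] by (force simp: order_ge_def in_keys_iff)
qed

section \<open>Graded modules without first Koszul homology are free\<close>

definition fscale :: "'r::comm_ring_1 \<Rightarrow> ('i \<Rightarrow> 'r) \<Rightarrow> 'i \<Rightarrow> 'r" where
  "fscale r f = (\<lambda>i. r * f i)"

lemma fscale_apply [simp]: "fscale r f i = r * f i"
  by (simp add: fscale_def)

lemma sum_apply: "(\<Sum>i\<in>I. f i) x = (\<Sum>i\<in>I. f i x)"
  for f :: "'a \<Rightarrow> 'b \<Rightarrow> 'c::comm_monoid_add"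
  by (induction I rule: infinite_finite_induct) auto

interpretation fun_mod: Modules.module "fscale :: 'r::comm_ring_1 \<Rightarrow> ('i \<Rightarrow> 'r) \<Rightarrow> 'i \<Rightarrow> 'r"
  by unfold_locales (auto simp: fun_eq_iff algebra_simps)

interpretation fun_koszul: koszul "fscale :: 'n::finite mpoly \<Rightarrow> ('i \<Rightarrow> 'n mpoly) \<Rightarrow> 'i \<Rightarrow> 'n mpoly" var_poly
  by unfold_locales

interpretation fun_vec: vector_space "\<lambda>q. fscale (const_poly q :: 'n mpoly) :: ('i \<Rightarrow> 'n mpoly) \<Rightarrow> 'i \<Rightarrow> 'n mpoly"
  by unfold_locales (auto simp: fun_eq_iff const_poly_add const_poly_mult algebra_simps)

definition homcomp :: "nat \<Rightarrow> ('i \<Rightarrow> 'n::finite mpoly) \<Rightarrow> 'i \<Rightarrow> 'n mpoly" where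
  "homcomp t z = (\<lambda>i. hcomp t (z i))"

lemma homcomp_add: "homcomp t (y + z) = homcomp t y + homcomp t z"
  by (simp add: homcomp_def fun_eq_iff hcomp_add)

lemma homcomp_0 [simp]: "homcomp t 0 = 0"
  by (simp add: homcomp_def fun_eq_iff)

lemma homcomp_sum: "homcomp t (\<Sum>i\<in>I. f i) = (\<Sum>i\<in>I. homcomp t (f i))"
proof (induction I rule: infinite_finite_induct)
  case (infinite A)
  then show "homcomp t (\<Sum>i\<in>A. f i) = (\<Sum>i\<in>A. homcomp t (f i))" by simp
next
  case empty
  show "homcomp t (\<Sum>i\<in>{}. f i) = (\<Sum>i\<in>{}. homcomp t (f i))" by simp
next
  case (insert k A)
  then show "homcomp t (\<Sum>i\<in>insert k A. f i) = (\<Sum>i\<in>insert k A. homcomp t (f i))"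
    by (simp add: homcomp_add)
qed

lemma homcomp_homcomp: "homcomp t (homcomp s p) = (if s = t then homcomp s p else 0)"
  by (simp add: homcomp_def fun_eq_iff hcomp_hcomp)

lemma homcomp_const: "homcomp t (fscale (const_poly a) z) = fscale (const_poly a) (homcomp t z)"
  by (simp add: homcomp_def fun_eq_iff hcomp_const_mult)

lemma homcomp_var:
  "homcomp t (fscale (var_poly i) z) = (case t of 0 \<Rightarrow> 0 | Suc s \<Rightarrow> fscale (var_poly i) (homcomp s z))"
  by (simp add: homcomp_def fun_eq_iff hcomp_var_mult split: nat.split)

lemma homcomp_decomposition:
  assumes "finite X" "\<And>i. i \<notin> X \<Longrightarrow> z i = 0"
  shows "\<exists>N. z = (\<Sum>t\<le>N. homcomp t z)"
proof -
  define M where "M = (\<Union>i\<in>X. mdeg ` Poly_Mapping.keys (z i))"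
  have "finite M" using assms(1) by (simp add: M_def)
  then have N: "\<And>i m. i \<in> X \<Longrightarrow> m \<in> Poly_Mapping.keys (z i) \<Longrightarrow> mdeg m \<le> Max M"
    by (intro Max_ge) (auto simp: M_def)
  have "z i = (\<Sum>t\<le>Max M. homcomp t z) i" for i
  proof (cases "i \<in> X")
    case True
    then show ?thesis using hcomp_decomposition[OF N] by (simp add: sum_apply homcomp_def)
  qed (simp add: sum_apply homcomp_def assms(2))
  then show ?thesis by blast
qed

text \<open>
  Let \<open>W = \<mm> Z\<close>.  A \<open>\<rat>\<close>-basis \<open>A\<close> of \<open>W\<close> is extended by homogeneous elements of \<open>Z\<close> to a \<open>\<rat>\<close>-basis \<open>A \<union> B\<close>
  of \<open>Z\<close>.  Then \<open>B\<close> generates \<open>Z\<close>, by the graded form of the lemma of Nakayama.  In a relation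
  \<open>\<Sum> u\<^sub>v v = 0\<close> between elements of \<open>B\<close> all \<open>u\<^sub>v\<close> lie in \<open>\<mm>\<close>, as \<open>B\<close> is independent modulo \<open>W\<close>.  Write
  \<open>u\<^sub>v = \<Sum> q\<^sub>v\<^sub>i x\<^sub>i\<close>.  The elements \<open>c\<^sub>i = \<Sum> q\<^sub>v\<^sub>i v\<close> of \<open>Z\<close> satisfy \<open>\<Sum> x\<^sub>i c\<^sub>i = 0\<close>, so they form a Koszul
  cycle, and hence a Koszul boundary.  Expressing the latter by generators and subtracting it from the
  \<open>q\<^sub>v\<^sub>i\<close> makes these themselves relations, for each \<open>i\<close>, without changing the \<open>u\<^sub>v\<close>.  So the module of
  relations equals \<open>\<mm>\<close> times itself, and the coefficients lie in all powers of \<open>\<mm>\<close>.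
\<close>

theorem graded_koszul_exact_free:
  fixes Z :: "('i \<Rightarrow> 'n::finite mpoly) set"
  assumes Z: "fun_mod.subspace Z" and X: "finite X" "\<And>z i. z \<in> Z \<Longrightarrow> i \<notin> X \<Longrightarrow> z i = 0"
    and graded: "\<And>z t. z \<in> Z \<Longrightarrow> homcomp t z \<in> Z"
    and exact: "fun_koszul.koszul_exact Z {0} 0"
  obtains B where "B \<subseteq> Z" "Z \<subseteq> fun_mod.span B" "fun_mod.independent B"
proof -
  define H where "H = {z\<in>Z. \<exists>t. homcomp t z = z}"
  define W where "W = {\<Sum>i\<in>UNIV. fscale (var_poly i) (z i) | z :: 'n \<Rightarrow> 'i \<Rightarrow> 'n mpoly. \<forall>i. z i \<in> Z}"
  have WI: "(\<Sum>i\<in>UNIV. fscale (var_poly i) (z i)) \<in> W" if "\<And>i. z i \<in> Z" for z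
    unfolding W_def using that by blast
  have W: "fun_vec.subspace W"
  proof (rule fun_vec.subspaceI)
    show "0 \<in> W" using WI[of "\<lambda>_. 0"] fun_mod.subspace_0[OF Z] by simp
  next
    fix a b assume "a \<in> W" "b \<in> W"
    then obtain y z where "a = (\<Sum>i\<in>UNIV. fscale (var_poly i) (y i))" "b = (\<Sum>i\<in>UNIV. fscale (var_poly i) (z i))"
      "\<And>i. y i \<in> Z" "\<And>i. z i \<in> Z" unfolding W_def by blast
    then show "a + b \<in> W"
      using WI[of "\<lambda>i. y i + z i"] fun_mod.subspace_add[OF Z]
      by (simp add: fun_mod.scale_right_distrib sum.distrib)
  next
    fix q a assume "a \<in> W"
    then obtain y where "a = (\<Sum>i\<in>UNIV. fscale (var_poly i) (y i))" "\<And>i. y i \<in> Z"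
      unfolding W_def by blast
    then show "fscale (const_poly q) a \<in> W"
      using WI[of "\<lambda>i. fscale (const_poly q) (y i)"] fun_mod.subspace_scale[OF Z]
      by (simp add: fun_mod.scale_sum_right mult.commute)
  qed
  obtain A where A: "A \<subseteq> W" "fun_vec.independent A" "W \<subseteq> fun_vec.span A"
    using fun_vec.maximal_independent_subset by blast
  obtain C where C: "A \<subseteq> C" "C \<subseteq> A \<union> H" "fun_vec.independent C" "A \<union> H \<subseteq> fun_vec.span C"
    using fun_vec.maximal_independent_subset_extend[of A "A \<union> H"] A(2) by auto
  define B where "B = C - A"
  have BH: "B \<subseteq> H" using C by (auto simp: B_def)
  have BZ: "B \<subseteq> Z" using BH by (auto simp: H_def)
  have spanA: "fun_vec.span A \<subseteq> W" using A W by (intro fun_vec.span_minimal)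
  have comp_span: "homcomp t b \<in> fun_mod.span B" if "b \<in> fun_vec.span B" for b t
    using that
  proof (induction b rule: fun_vec.span_induct_alt)
    case base
    show "homcomp t 0 \<in> fun_mod.span B" by (simp add: fun_mod.span_zero)
  next
    case (step c v y)
    then obtain s where "homcomp s v = v" using BH by (auto simp: H_def)
    then have "homcomp t v = v \<or> homcomp t v = 0" by (metis homcomp_homcomp)
    then have "homcomp t v \<in> fun_mod.span B"
      using step(1) fun_mod.span_base fun_mod.span_zero by metis
    moreover have "homcomp t y \<in> fun_mod.span B" by (rule step(2))
    ultimately show "homcomp t (fscale (const_poly c) v + y) \<in> fun_mod.span B"
      by (simp add: homcomp_add homcomp_const fun_mod.span_add fun_mod.span_scale)
  qed
  have gen: "\<forall>z\<in>Z. homcomp t z \<in> fun_mod.span B" for t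
  proof (induction t rule: less_induct)
    case (less t)
    have IH: "homcomp s z \<in> fun_mod.span B" if "s < t" "z \<in> Z" for s z
      using less that by blast
    show ?case
    proof
      fix z assume z: "z \<in> Z"
      have "homcomp t z \<in> H" using graded[OF z] by (auto simp: H_def homcomp_homcomp)
      then have "homcomp t z \<in> fun_vec.span (A \<union> B)" using C by (auto simp: B_def Un_absorb1)
      then obtain w b where wb: "homcomp t z = w + b" "w \<in> fun_vec.span A" "b \<in> fun_vec.span B"
        unfolding fun_vec.span_Un by blast
      obtain y where y: "w = (\<Sum>i\<in>UNIV. fscale (var_poly i) (y i))" "\<And>i. y i \<in> Z"
        using wb(2) spanA unfolding W_def by blast
      have "homcomp t w \<in> fun_mod.span B"
        unfolding y(1) homcomp_sum
      proof (rule fun_mod.span_sum)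
        fix i
        show "homcomp t (fscale (var_poly i) (y i)) \<in> fun_mod.span B"
          using IH[OF _ y(2)[of i]] by (simp add: homcomp_var fun_mod.span_zero fun_mod.span_scale split: nat.split)
      qed
      moreover have "homcomp t z = homcomp t w + homcomp t b"
        using arg_cong[OF wb(1), of "homcomp t"] by (simp add: homcomp_add homcomp_homcomp)
      ultimately show "homcomp t z \<in> fun_mod.span B"
        using comp_span[OF wb(3)] by (simp add: fun_mod.span_add)
    qed
  qed
  have generates: "Z \<subseteq> fun_mod.span B"
  proof
    fix z assume z: "z \<in> Z"
    obtain N where "z = (\<Sum>t\<le>N. homcomp t z)" using homcomp_decomposition[OF X(1)] X(2)[OF z] by metis
    then show "z \<in> fun_mod.span B" using gen z by (metis fun_mod.span_sum)
  qed
  have const0: "c v = 0"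
    if S: "finite S" "S \<subseteq> B" "(\<Sum>v\<in>S. fscale (const_poly (c v)) v) \<in> W" "v \<in> S" for S c v
  proof (rule ccontr)
    assume cv: "c v \<noteq> 0"
    have 1: "(\<Sum>v\<in>S. fscale (const_poly (c v)) v) \<in> fun_vec.span (C - {v})"
    proof -
      have "A \<subseteq> C - {v}" using C(1) S by (auto simp: B_def)
      then show ?thesis using S(3) A(3) fun_vec.span_mono by blast
    qed
    have 2: "(\<Sum>v\<in>S - {v}. fscale (const_poly (c v)) v) \<in> fun_vec.span (C - {v})"
      using S by (intro fun_vec.span_sum fun_vec.span_scale fun_vec.span_base) (auto simp: B_def)
    have "fscale (const_poly (c v)) v = (\<Sum>v\<in>S. fscale (const_poly (c v)) v) - (\<Sum>v\<in>S - {v}. fscale (const_poly (c v)) v)"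
      using S by (simp add: sum.remove)
    then have "fscale (const_poly (c v)) v \<in> fun_vec.span (C - {v})"
      using fun_vec.span_diff[OF 1 2] by simp
    moreover have "fscale (const_poly (1 / c v)) (fscale (const_poly (c v)) v) = v"
      using cv by (simp flip: const_poly_mult)
    ultimately have "v \<in> fun_vec.span (C - {v})"
      using fun_vec.span_scale[of "fscale (const_poly (c v)) v" "C - {v}" "1 / c v"] by (simp only:)
    then show False using C(3) S by (auto simp: fun_vec.dependent_def B_def)
  qed
  have order: "\<forall>v\<in>S. order_ge n (u v)"
    if "finite S" "S \<subseteq> B" "(\<Sum>v\<in>S. fscale (u v) v) = 0" for n S u
    using that
  proof (induction n arbitrary: S u)
    case (Suc n)
    note S = Suc.prems
    have S3: "(\<Sum>v\<in>S. fscale (u v) v) = 0" by (rule S(3))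
    define c where "c v = Poly_Mapping.lookup (u v) 0" for v
    have "\<exists>q. u v - const_poly (c v) = (\<Sum>i\<in>UNIV. q i * var_poly i)" for v
      unfolding var_ideal_iff
    proof
      fix m assume "m \<in> Poly_Mapping.keys (u v - const_poly (c v))"
      then have "m \<noteq> 0" by (auto simp: in_keys_iff lookup_minus c_def const_poly_def)
      then show "\<exists>i\<in>UNIV. Poly_Mapping.lookup m i \<noteq> 0" by (metis UNIV_I lookup_zero poly_mapping_eqI)
    qed
    then obtain q where q: "\<And>v. u v - const_poly (c v) = (\<Sum>i\<in>UNIV. q v i * var_poly i)" by metis
    define y where "y i = - (\<Sum>v\<in>S. fscale (q v i) v)" for i
    have c0: "c v = 0" if "v \<in> S" for v
    proof (rule const0[OF S(1,2) _ that])
      have y: "y i \<in> Z" for i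
        unfolding y_def using S(2) BZ
        by (intro fun_mod.subspace_neg[OF Z] fun_mod.subspace_sum[OF Z] fun_mod.subspace_scale[OF Z]) auto
      have 1: "(\<Sum>v\<in>S. fscale (const_poly (c v)) v) =
          (\<Sum>v\<in>S. fscale (u v) v) - (\<Sum>v\<in>S. fscale (u v - const_poly (c v)) v)"
        by (simp add: fun_mod.scale_left_diff_distrib sum_subtractf)
      have "(\<Sum>v\<in>S. fscale (u v - const_poly (c v)) v) =
          (\<Sum>v\<in>S. \<Sum>i\<in>UNIV. fscale (var_poly i) (fscale (q v i) v))"
        unfolding q by (simp add: fun_mod.scale_sum_left mult.commute)
      also have "\<dots> = (\<Sum>i\<in>UNIV. fscale (var_poly i) (\<Sum>v\<in>S. fscale (q v i) v))"
        by (subst sum.swap) (simp add: fun_mod.scale_sum_right)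
      also have "\<dots> = - (\<Sum>i\<in>UNIV. fscale (var_poly i) (y i))"
        by (simp add: y_def sum_negf)
      finally have "(\<Sum>v\<in>S. fscale (const_poly (c v)) v) = (\<Sum>i\<in>UNIV. fscale (var_poly i) (y i))"
        unfolding 1 S3 by simp
      then show "(\<Sum>v\<in>S. fscale (const_poly (c v)) v) \<in> W" using WI[OF y] by simp
    qed
    have uq: "u v = (\<Sum>i\<in>UNIV. q v i * var_poly i)" if "v \<in> S" for v
      using q[of v] c0[OF that] by simp
    \<comment> \<open>the Koszul chain \<open>c\<^sub>i\<close> of degree one; its values matter only at singletons\<close>
    define cc where "cc E = (\<Sum>v\<in>S. fscale (q v (the_elem E)) v)" for E :: "'n set"
    have ccZ: "cc E \<in> Z" for E
      unfolding cc_def using S(2) BZ by (intro fun_mod.subspace_sum[OF Z] fun_mod.subspace_scale[OF Z]) auto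
    have "fun_koszul.kdiff cc {} = (\<Sum>i\<in>UNIV. \<Sum>v\<in>S. fscale (q v i * var_poly i) v)"
      by (simp add: fun_koszul.kdiff_def cc_def fun_mod.scale_sum_right mult.commute)
    also have "\<dots> = (\<Sum>v\<in>S. fscale (u v) v)"
      by (subst sum.swap) (simp add: uq fun_mod.scale_sum_left)
    finally have cc0: "fun_koszul.kdiff cc {} = 0" using S3 by simp
    obtain b where b: "\<And>E. card E = Suc (Suc 0) \<Longrightarrow> b E \<in> Z" "\<And>E. card E = Suc 0 \<Longrightarrow> cc E - fun_koszul.kdiff b E \<in> {0}"
      using fun_koszul.koszul_exactE[OF exact, of cc] ccZ cc0 by auto
    have "\<exists>p. card E = Suc (Suc 0) \<longrightarrow>
        finite (fst p) \<and> fst p \<subseteq> B \<and> b E = (\<Sum>v\<in>fst p. fscale (snd p v) v)" for E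
    proof (cases "card E = Suc (Suc 0)")
      case True
      then have "b E \<in> fun_mod.span B" using b(1) generates by blast
      then obtain t r where "b E = (\<Sum>v\<in>t. fscale (r v) v)" "finite t" "t \<subseteq> B"
        unfolding fun_mod.span_explicit by blast
      then show ?thesis by (intro exI[of _ "(t, r)"]) simp
    qed simp
    then have "\<exists>p. \<forall>E. card E = Suc (Suc 0) \<longrightarrow>
        finite (fst (p E)) \<and> fst (p E) \<subseteq> B \<and> b E = (\<Sum>v\<in>fst (p E). fscale (snd (p E) v) v)"
      by (intro choice allI)
    then obtain p where p: "\<forall>E. card E = Suc (Suc 0) \<longrightarrow>
        finite (fst (p E)) \<and> fst (p E) \<subseteq> B \<and> b E = (\<Sum>v\<in>fst (p E). fscale (snd (p E) v) v)" ..
    define t r where "t E = fst (p E)" and "r E = snd (p E)" for E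
    have tr: "finite (t E) \<and> t E \<subseteq> B \<and> b E = (\<Sum>v\<in>t E. fscale (r E v) v)"
      if "card E = Suc (Suc 0)" for E
      using p that by (simp add: t_def r_def)
    define T where "T = S \<union> (\<Union>E\<in>{E. card E = Suc (Suc 0)}. t E)"
    have T: "finite T" "T \<subseteq> B" using S tr by (auto simp: T_def)
    \<comment> \<open>all coefficients are extended by zero to the common finite support \<open>T\<close>\<close>
    define r' where "r' v E = (if v \<in> t E then r E v else 0)" for v E
    have b': "b E = (\<Sum>v\<in>T. fscale (r' v E) v)" if E: "card E = Suc (Suc 0)" for E
    proof -
      have "(\<Sum>v\<in>T. fscale (r' v E) v) = (\<Sum>v\<in>t E. fscale (r' v E) v)"
        using E T(1) by (intro sum.mono_neutral_right) (auto simp: T_def r'_def)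
      also have "\<dots> = b E" using tr[OF E] by (simp add: r'_def)
      finally show ?thesis by simp
    qed
    define q' where "q' v i = (if v \<in> S then q v i else 0)" for v i
    \<comment> \<open>the corrected coefficients, which form a relation for every \<open>i\<close>\<close>
    define s where "s i v = q' v i - ring_koszul.kdiff (r' v) {i}" for i v
    have rel: "(\<Sum>v\<in>T. fscale (s i v) v) = 0" for i
    proof -
      have "(\<Sum>v\<in>T. fscale (q' v i) v) = (\<Sum>v\<in>S. fscale (q' v i) v)"
        using T(1) by (intro sum.mono_neutral_right) (auto simp: T_def q'_def)
      then have 1: "(\<Sum>v\<in>T. fscale (q' v i) v) = cc {i}" by (simp add: cc_def q'_def)
      have "fun_koszul.kdiff b {i} = fun_koszul.kdiff (\<lambda>E. \<Sum>v\<in>T. fscale (r' v E) v) {i}"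
        by (rule fun_koszul.kdiff_cong[of "Suc 0"]) (auto simp: b')
      also have "\<dots> = (\<Sum>v\<in>T. fscale (ring_koszul.kdiff (r' v) {i}) v)"
        by (simp add: fun_koszul.kdiff_sum) (simp add: fun_koszul.kdiff_def ring_koszul.kdiff_def fun_mod.scale_sum_left)
      finally show ?thesis
        using 1 b(2)[of "{i}"] by (simp add: s_def fun_mod.scale_left_diff_distrib sum_subtractf)
    qed
    show ?case
    proof
      fix v assume v: "v \<in> S"
      have "(\<Sum>i\<in>UNIV. ring_koszul.kdiff (r' v) {i} * var_poly i) = ring_koszul.kdiff (ring_koszul.kdiff (r' v)) {}"
        by (simp add: ring_koszul.kdiff_def[of "ring_koszul.kdiff (r' v)"] mult.commute)
      then have "(\<Sum>i\<in>UNIV. ring_koszul.kdiff (r' v) {i} * var_poly i) = 0" by (simp add: ring_koszul.kdiff_kdiff)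
      then have "u v = (\<Sum>i\<in>UNIV. s i v * var_poly i)"
        using v by (simp add: uq s_def q'_def left_diff_distrib sum_subtractf)
      moreover have "order_ge n (s i v)" for i
        using Suc.IH[OF T rel] v by (auto simp: T_def)
      ultimately show "order_ge (Suc n) (u v)" by (auto intro: order_ge_sum order_ge_mult_var)
    qed
  qed simp
  have "fun_mod.independent B"
    unfolding fun_mod.independent_explicit_module
  proof (intro allI impI)
    fix S u v assume "finite S" "S \<subseteq> B" "(\<Sum>v\<in>S. fscale (u v) v) = 0" "v \<in> S"
    then have "order_ge n (u v)" for n using order[of S u n] by simp
    then show "u v = 0" by (rule order_ge_all)
  qed
  then show ?thesis using that BZ generates by blast
qed

section \<open>Coordinate determinants\<close>

text \<open>
  The sign of \<open>coord_det as bs\<close> compares two ordered bases.  It is computed as the determinant of the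
  matrix whose rows are the coordinates of \<open>bs\<close>.
\<close>

definition basis_list :: "(rat ^ 'n::finite) list \<Rightarrow> bool" where
  "basis_list as \<longleftrightarrow> distinct as \<and> vec.independent (set as)"

definition coord_mat :: "(rat ^ 'n::finite) list \<Rightarrow> (rat ^ 'n) list \<Rightarrow> rat mat" where
  "coord_mat as bs = Matrix.mat (length as) (length as)
    (\<lambda>(j, k). vec.representation (set as) (bs ! j) (as ! k))"

lemma coord_mat_carrier [simp]: "coord_mat as bs \<in> carrier_mat (length as) (length as)"
  by (simp add: coord_mat_def)

lemma coord_det_eq_det: "coord_det as bs = Determinant.det (coord_mat as bs)"
proof -
  have "(\<Prod>j<length as. vec.representation (set as) (bs ! j) (as ! p j)) =
      (\<Prod>i = 0..<length as. coord_mat as bs $$ (i, p i))" if "p permutes {0..<length as}" for p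
    unfolding lessThan_atLeast0
  proof (rule prod.cong)
    fix j assume "j \<in> {0..<length as}"
    then have "p j \<in> {0..<length as}" "j < length as" using permutes_in_image[OF that, of j] by auto
    then show "vec.representation (set as) (bs ! j) (as ! p j) = coord_mat as bs $$ (j, p j)"
      by (simp add: coord_mat_def)
  qed simp
  then have "(\<Sum>p | p permutes {0..<length as}.
       of_int (sign p) * (\<Prod>j<length as. vec.representation (set as) (bs ! j) (as ! p j))) =
     (\<Sum>p | p permutes {0..<length as}. of_int (sign p) * (\<Prod>i = 0..<length as. coord_mat as bs $$ (i, p i)))"
    by (intro sum.cong) simp_all
  moreover have "dim_row (coord_mat as bs) = length as" "dim_col (coord_mat as bs) = length as"
    by (simp_all add: coord_mat_def)
  ultimately show ?thesis
    unfolding coord_det_def Determinant.det_def lessThan_atLeast0[symmetric] by simp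
qed

lemma representation_basis_list:
  assumes "basis_list cs" "b \<in> vec.span (set cs)"
  shows "b = (\<Sum>l<length cs. vec.representation (set cs) b (cs ! l) *s cs ! l)"
proof -
  have "b = (\<Sum>c\<in>set cs. vec.representation (set cs) b c *s c)"
    using vec.sum_representation_eq[of "set cs" b "set cs"] assms by (simp add: basis_list_def)
  also have "\<dots> = (\<Sum>l<length cs. vec.representation (set cs) b (cs ! l) *s cs ! l)"
    using bij_betw_nth[of cs "{..<length cs}" "set cs"] assms(1)
    by (intro sum.reindex_bij_betw[symmetric]) (simp add: basis_list_def)
  finally show ?thesis .
qed

text \<open>
  Change of basis: the coordinates of \<open>bs\<close> with respect to \<open>as\<close> arise from those with respect to \<open>cs\<close> by
  the matrix of coordinates of \<open>cs\<close>.
\<close>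

lemma coord_det_mult:
  assumes as: "basis_list as" and cs: "basis_list cs" "set cs \<subseteq> vec.span (set as)"
    and bs: "set bs \<subseteq> vec.span (set cs)" and len: "length cs = length as" "length bs = length as"
  shows "coord_det as bs = coord_det cs bs * coord_det as cs"
proof -
  have "coord_mat as bs = coord_mat cs bs * coord_mat as cs"
  proof (rule eq_matI)
    fix j k assume "j < dim_row (coord_mat cs bs * coord_mat as cs)" "k < dim_col (coord_mat cs bs * coord_mat as cs)"
    then have jk: "j < length as" "k < length as" by (simp_all add: coord_mat_def len)
    have b: "bs ! j \<in> vec.span (set cs)" using bs jk(1) len(2) by (metis nth_mem subsetD)
    have c: "cs ! l \<in> vec.span (set as)" if "l < length as" for l
      using cs(2) that len(1) by (metis nth_mem subsetD)
    have "vec.representation (set as) (bs ! j) (as ! k) =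
        vec.representation (set as) (\<Sum>l<length cs. vec.representation (set cs) (bs ! j) (cs ! l) *s cs ! l) (as ! k)"
      using representation_basis_list[OF cs(1) b] by simp
    also have "\<dots> = (\<Sum>l<length as. vec.representation (set cs) (bs ! j) (cs ! l) * vec.representation (set as) (cs ! l) (as ! k))"
    proof -
      have ind: "vec.independent (set as)" using as by (simp add: basis_list_def)
      have "vec.representation (set as) (\<Sum>l<length as. vec.representation (set cs) (bs ! j) (cs ! l) *s cs ! l) =
          (\<lambda>b. \<Sum>l<length as. vec.representation (set as) (vec.representation (set cs) (bs ! j) (cs ! l) *s cs ! l) b)"
        by (intro vec.representation_sum ind vec.span_scale) (simp add: c)
      then show ?thesis by (simp add: len vec.representation_scale[OF ind c])
    qed
    also have "\<dots> = (coord_mat cs bs * coord_mat as cs) $$ (j, k)"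
      using jk by (simp add: coord_mat_def len scalar_prod_def lessThan_atLeast0)
    finally show "coord_mat as bs $$ (j, k) = (coord_mat cs bs * coord_mat as cs) $$ (j, k)"
      using jk by (simp add: coord_mat_def)
  qed (simp_all add: coord_mat_def len)
  then show ?thesis
    using det_mult[of "coord_mat cs bs" "length as" "coord_mat as cs"] coord_mat_carrier[of cs bs] coord_mat_carrier[of as cs]
    by (simp only: coord_det_eq_det len(1))
qed

lemma coord_det_self:
  assumes "basis_list as"
  shows "coord_det as as = 1"
proof -
  have "coord_mat as as = 1\<^sub>m (length as)"
    using assms by (intro eq_matI) (auto simp: coord_mat_def basis_list_def vec.representation_basis nth_eq_iff_index_eq)
  then show ?thesis by (simp add: coord_det_eq_det)
qed

lemma coord_det_nonzero:
  assumes "basis_list as" "basis_list bs" "length bs = length as" "vec.span (set bs) = vec.span (set as)"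
  shows "coord_det as bs \<noteq> 0"
proof -
  have "coord_det as as = coord_det bs as * coord_det as bs"
    using assms vec.span_superset[of "set as"] vec.span_superset[of "set bs"] by (intro coord_det_mult) auto
  then show ?thesis using coord_det_self[OF assms(1)] by auto
qed

lemma coord_det_swap:
  assumes "length as = Suc (Suc (length gs))"
  shows "coord_det as (y # x # gs) = - coord_det as (x # y # gs)"
proof -
  have "coord_mat as (y # x # gs) = swaprows 0 1 (coord_mat as (x # y # gs))"
    using assms by (intro eq_matI) (auto simp: coord_mat_def nth_Cons split: nat.splits)
  then show ?thesis
    using det_swaprows[of 0 "length as" 1 "coord_mat as (x # y # gs)"] coord_mat_carrier[of as] assms
    by (simp add: coord_det_eq_det)
qed

lemma basis_list_Cons:
  assumes "basis_list bs" "w \<notin> vec.span (set bs)"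
  shows "basis_list (w # bs)"
  using assms vec.span_base[of w "set bs"] by (auto simp: basis_list_def vec.independent_insert)

text \<open>
  The coordinate matrix is block triangular, because the vectors of \<open>ds\<close> have no component along \<open>a\<close>.
\<close>

lemma coord_det_Cons_Cons:
  assumes cs: "basis_list cs" "a \<notin> vec.span (set cs)" and w: "w - r *s a \<in> vec.span (set cs)"
    and ds: "set ds \<subseteq> vec.span (set cs)" and len: "length ds = length cs"
  shows "coord_det (a # cs) (w # ds) = r * coord_det cs ds"
proof -
  have bl: "basis_list (a # cs)" by (rule basis_list_Cons[OF cs])
  have ind: "vec.independent (set (a # cs))" using bl by (simp add: basis_list_def)
  have acs: "a \<notin> set cs" using cs(2) vec.span_base by blast
  have rep: "vec.representation (set (a # cs)) v = vec.representation (set cs) v" if "v \<in> vec.span (set cs)" for v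
    using that by (intro vec.representation_extend[OF ind]) auto
  have rep0: "vec.representation (set cs) v a = 0" for v
    using vec.representation_ne_zero acs by blast
  have r: "vec.representation (set (a # cs)) w a = r"
  proof -
    have 1: "w - r *s a \<in> vec.span (set (a # cs))" using w vec.span_mono[of "set cs" "set (a # cs)"] by auto
    have 2: "a \<in> vec.span (set (a # cs))" by (simp add: vec.span_base)
    have "vec.representation (set (a # cs)) ((w - r *s a) + r *s a) a = r"
      using vec.representation_add[OF ind vec.span_scale[OF 2, of r] 1] rep[OF w] rep0
        vec.representation_scale[OF ind 2, of r] vec.representation_basis[OF ind, of a] by simp
    then show ?thesis by simp
  qed
  let ?A = "Matrix.mat 1 1 (\<lambda>_. r)"
  let ?B = "Matrix.mat 1 (length cs) (\<lambda>(j, k). vec.representation (set (a # cs)) w (cs ! k))"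
  have "coord_mat (a # cs) (w # ds) = four_block_mat ?A ?B (0\<^sub>m (length cs) 1) (coord_mat cs ds)"
  proof (rule eq_matI)
    fix j k
    assume "j < dim_row (four_block_mat ?A ?B (0\<^sub>m (length cs) 1) (coord_mat cs ds))"
      "k < dim_col (four_block_mat ?A ?B (0\<^sub>m (length cs) 1) (coord_mat cs ds))"
    then have jk: "j < Suc (length cs)" "k < Suc (length cs)" by (simp_all add: coord_mat_def)
    have d: "vec.representation (set (a # cs)) (ds ! i) = vec.representation (set cs) (ds ! i)" if "i < length cs" for i
      using that ds len by (intro rep) (metis nth_mem subsetD)
    show "coord_mat (a # cs) (w # ds) $$ (j, k) = four_block_mat ?A ?B (0\<^sub>m (length cs) 1) (coord_mat cs ds) $$ (j, k)"
      using jk r d rep0 by (auto simp: coord_mat_def nth_Cons simp del: list.set split: nat.splits)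
  qed (simp_all add: coord_mat_def)
  then show ?thesis
    using det_four_block_mat_lower_left_zero[of ?A 1 ?B "length cs" "0\<^sub>m (length cs) 1" "coord_mat cs ds"]
    by (simp add: coord_det_eq_det det_single)
qed

lemma coord_det_change_first:
  assumes as: "basis_list as" and bs: "basis_list bs" "set bs \<subseteq> vec.span (set as)" "length as = Suc (length bs)"
    and w: "w \<in> vec.span (set as)" "w \<notin> vec.span (set bs)" and w': "w' - r *s w \<in> vec.span (set bs)"
  shows "coord_det as (w' # bs) = r * coord_det as (w # bs)"
proof -
  have "w' \<in> vec.span (set (w # bs))"
    using w' vec.span_breakdown_eq[of w' w "set bs"] by auto
  then have "coord_det as (w' # bs) = coord_det (w # bs) (w' # bs) * coord_det as (w # bs)"
    using w bs as by (intro coord_det_mult basis_list_Cons) (auto intro: vec.span_base)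
  also have "coord_det (w # bs) (w' # bs) = r * coord_det bs bs"
    using bs w w' by (intro coord_det_Cons_Cons) (auto intro: vec.span_base)
  finally show ?thesis by (simp add: coord_det_self bs(1))
qed

section \<open>Incidence signs\<close>

lemma span_eq_UNIV:
  fixes X :: "(rat ^ 'n::finite) set"
  assumes "vec.dim X = CARD('n)"
  shows "vec.span X = UNIV"
  using assms vec_dim_card[where 'a=rat and 'n='n] by (intro vec.subspace_dim_equal) auto

lemma orients_basis_list: "orients as X \<Longrightarrow> basis_list as"
  by (simp add: orients_def basis_list_def)

lemma orients_span: "orients as X \<Longrightarrow> vec.span (set as) = vec.span X"
  by (simp add: orients_def)

lemma orients_length: "orients as X \<Longrightarrow> length as = vec.dim X"
  by (metis distinct_card orients_def vec.dim_eq_card_independent vec.dim_span)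

lemma span_codim_one:
  fixes X Y :: "(rat ^ 'n::finite) set"
  assumes "Y \<subseteq> X" "vec.dim X = Suc (vec.dim Y)" "w \<in> vec.span X" "w \<notin> vec.span Y" "x \<in> vec.span X"
  obtains k where "x - k *s w \<in> vec.span Y"
proof -
  have "vec.span (insert w Y) = vec.span X"
  proof (rule vec.subspace_dim_equal)
    show "vec.span (insert w Y) \<subseteq> vec.span X"
      using assms(1,3) vec.span_superset[of X] by (intro vec.span_minimal) auto
    show "vec.dim (vec.span X) \<le> vec.dim (vec.span (insert w Y))"
      using assms(2,4) by (simp add: vec.dim_insert)
  qed simp_all
  then show ?thesis using that assms(5) vec.span_breakdown_eq[of x w Y] by auto
qed

lemma rdot_span_zero:
  assumes "x \<in> vec.span X" "\<And>y. y \<in> X \<Longrightarrow> rdot u y = 0"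
  shows "rdot u x = 0"
  using assms(1) by (induction x rule: vec.span_induct_alt) (use assms(2) in auto)

text \<open>
  The incidence sign may be computed with any vector \<open>w\<close> of \<open>\<alpha>\<close> outside the span of \<open>\<beta>\<close>: any two of them
  are positive multiples of each other modulo this span, since a functional defining the face \<open>\<beta>\<close> is
  positive on both.
\<close>

lemma incidence_eq:
  assumes ori: "orients (ori \<alpha>) \<alpha>" "orients (ori \<beta>) \<beta>" and dim: "vec.dim \<alpha> = Suc (vec.dim \<beta>)"
    and face: "cone_face \<beta> \<alpha>" and w: "w \<in> \<alpha>" "w \<notin> vec.span \<beta>"
  shows "incidence ori \<alpha> \<beta> = sgn (coord_det (ori \<alpha>) (- w # ori \<beta>))"
proof -
  define v where "v = (SOME w. w \<in> \<alpha> \<and> w \<notin> vec.span \<beta>)"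
  have v: "v \<in> \<alpha>" "v \<notin> vec.span \<beta>"
    unfolding v_def using someI[of "\<lambda>w. w \<in> \<alpha> \<and> w \<notin> vec.span \<beta>" w] w by auto
  obtain u where u: "\<And>x. x \<in> \<alpha> \<Longrightarrow> 0 \<le> rdot u x" "\<beta> = {x\<in>\<alpha>. rdot u x = 0}"
    using face unfolding cone_face_def by blast
  have sub: "\<beta> \<subseteq> \<alpha>" using u(2) by auto
  obtain k where k: "v - k *s w \<in> vec.span \<beta>"
    using span_codim_one[OF sub dim, of w v] w v vec.span_base by metis
  have "rdot u (v - k *s w) = 0" using k u(2) by (intro rdot_span_zero[OF k]) auto
  then have "rdot u v = k * rdot u w" by simp
  moreover have "rdot u v > 0" "rdot u w > 0"
    using u(1)[OF v(1)] u(1)[OF w(1)] v w vec.span_base[of _ \<beta>] u(2) by force+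
  ultimately have "k > 0" by (metis zero_less_mult_pos2)
  have "- v - k *s - w = - (v - k *s w)" by simp
  then have k': "- v - k *s - w \<in> vec.span \<beta>" using vec.span_neg[OF k] by simp
  have "coord_det (ori \<alpha>) (- v # ori \<beta>) = k * coord_det (ori \<alpha>) (- w # ori \<beta>)"
  proof (rule coord_det_change_first)
    show "set (ori \<beta>) \<subseteq> vec.span (set (ori \<alpha>))"
      using orients_span[OF ori(1)] orients_span[OF ori(2)] vec.span_superset[of "set (ori \<beta>)"] vec.span_mono[OF sub] by auto
    show "- w \<in> vec.span (set (ori \<alpha>))" "- w \<notin> vec.span (set (ori \<beta>))" "- v - k *s - w \<in> vec.span (set (ori \<beta>))"
      using k' w vec.span_base[of w \<alpha>] vec.span_neg[of "- w" \<beta>] by (auto simp: orients_span[OF ori(1)] orients_span[OF ori(2)] vec.span_neg)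
    show "length (ori \<alpha>) = Suc (length (ori \<beta>))" using dim ori by (simp add: orients_length)
  qed (use ori in \<open>simp_all add: orients_basis_list\<close>)
  then show ?thesis
    using \<open>k > 0\<close> by (simp add: incidence_def Let_def v_def[symmetric] sgn_mult)
qed

lemma cone_face_subset: "cone_face \<beta> \<alpha> \<Longrightarrow> \<beta> \<subseteq> \<alpha>"
  by (auto simp: cone_face_def)

text \<open>
  Along a chain of faces the incidence signs multiply to the sign of the basis that starts with the two
  outward normals, by change of basis through \<open>- w # ori \<beta>\<close>.
\<close>

lemma incidence_mult:
  assumes ori: "orients (ori \<alpha>) \<alpha>" "orients (ori \<beta>) \<beta>" "orients (ori \<gamma>) \<gamma>"
    and dim: "vec.dim \<alpha> = Suc (vec.dim \<beta>)" "vec.dim \<beta> = Suc (vec.dim \<gamma>)"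
    and face: "cone_face \<beta> \<alpha>" "cone_face \<gamma> \<beta>"
    and w: "w \<in> \<alpha>" "w \<notin> vec.span \<beta>" and v: "v \<in> \<beta>" "v \<notin> vec.span \<gamma>"
  shows "incidence ori \<alpha> \<beta> * incidence ori \<beta> \<gamma> = sgn (coord_det (ori \<alpha>) (- w # - v # ori \<gamma>))"
proof -
  have sub: "vec.span \<beta> \<subseteq> vec.span \<alpha>" "vec.span \<gamma> \<subseteq> vec.span \<beta>"
    using face by (auto intro!: vec.span_mono dest: cone_face_subset)
  have w': "- w \<in> vec.span \<alpha>" "- w \<notin> vec.span \<beta>" "- v \<in> vec.span \<beta>"
    using w v vec.span_base[of w \<alpha>] vec.span_base[of v \<beta>] vec.span_neg[of "- w" \<beta>] by (auto simp: vec.span_neg)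
  have incl: "set (ori \<alpha>) \<subseteq> vec.span \<alpha>" "set (ori \<beta>) \<subseteq> vec.span \<beta>" "set (ori \<gamma>) \<subseteq> vec.span \<gamma>"
    using ori vec.span_superset by (metis orients_span)+
  have bl: "basis_list (- w # ori \<beta>)"
    using ori w' by (intro basis_list_Cons) (auto simp: orients_basis_list orients_span)
  have "coord_det (ori \<alpha>) (- w # - v # ori \<gamma>) =
      coord_det (- w # ori \<beta>) (- w # - v # ori \<gamma>) * coord_det (ori \<alpha>) (- w # ori \<beta>)"
  proof (rule coord_det_mult[OF _ bl])
    have "vec.span \<beta> \<subseteq> vec.span (set (- w # ori \<beta>))"
      using vec.span_mono[of "set (ori \<beta>)" "set (- w # ori \<beta>)"] orients_span[OF ori(2)] by auto
    then show "set (- w # - v # ori \<gamma>) \<subseteq> vec.span (set (- w # ori \<beta>))"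
      using incl sub w' by (auto intro: vec.span_base)
    show "set (- w # ori \<beta>) \<subseteq> vec.span (set (ori \<alpha>))"
      using incl sub w' by (auto simp: orients_span[OF ori(1)])
  qed (use ori dim in \<open>simp_all add: orients_basis_list orients_length\<close>)
  also have "coord_det (- w # ori \<beta>) (- w # - v # ori \<gamma>) = 1 * coord_det (ori \<beta>) (- v # ori \<gamma>)"
  proof (rule coord_det_Cons_Cons)
    show "set (- v # ori \<gamma>) \<subseteq> vec.span (set (ori \<beta>))"
      using incl sub w' by (auto simp: orients_span[OF ori(2)])
  qed (use ori dim w' in \<open>simp_all add: orients_basis_list orients_length orients_span vec.span_zero\<close>)
  finally show ?thesis
    using incidence_eq[OF ori(1,2) dim(1) face(1) w] incidence_eq[OF ori(2,3) dim(2) face(2) v]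
    by (simp add: sgn_mult)
qed

text \<open>
  A vector of \<open>\<beta>1\<close> outside the span of \<open>\<beta>2\<close> serves both as the normal of \<open>\<gamma>\<close> in \<open>\<beta>1\<close> and as the normal
  of \<open>\<beta>2\<close> in \<open>\<alpha>\<close>, and the other way round.  So the two products compare \<open>ori \<alpha>\<close> with bases that differ
  by a transposition.
\<close>

lemma incidence_diamond:
  assumes ori: "orients (ori \<alpha>) \<alpha>" "orients (ori \<beta>1) \<beta>1" "orients (ori \<beta>2) \<beta>2" "orients (ori \<gamma>) \<gamma>"
    and dim: "vec.dim \<alpha> = Suc (Suc (vec.dim \<gamma>))" "vec.dim \<beta>1 = Suc (vec.dim \<gamma>)" "vec.dim \<beta>2 = Suc (vec.dim \<gamma>)"
    and face: "cone_face \<beta>1 \<alpha>" "cone_face \<beta>2 \<alpha>" "cone_face \<gamma> \<beta>1" "cone_face \<gamma> \<beta>2"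
    and b: "b1 \<in> \<beta>1" "b1 \<notin> vec.span \<beta>2" "b2 \<in> \<beta>2" "b2 \<notin> vec.span \<beta>1"
  shows "incidence ori \<alpha> \<beta>1 * incidence ori \<beta>1 \<gamma> = - (incidence ori \<alpha> \<beta>2 * incidence ori \<beta>2 \<gamma>)"
proof -
  have sub: "\<beta>1 \<subseteq> \<alpha>" "\<beta>2 \<subseteq> \<alpha>" "vec.span \<gamma> \<subseteq> vec.span \<beta>1" "vec.span \<gamma> \<subseteq> vec.span \<beta>2"
    using face by (auto intro!: vec.span_mono dest: cone_face_subset)
  have "incidence ori \<alpha> \<beta>1 * incidence ori \<beta>1 \<gamma> = sgn (coord_det (ori \<alpha>) (- b2 # - b1 # ori \<gamma>))"
    using sub b dim by (intro incidence_mult ori face) auto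
  moreover have "incidence ori \<alpha> \<beta>2 * incidence ori \<beta>2 \<gamma> = sgn (coord_det (ori \<alpha>) (- b1 # - b2 # ori \<gamma>))"
    using sub b dim by (intro incidence_mult ori face) auto
  moreover have "coord_det (ori \<alpha>) (- b2 # - b1 # ori \<gamma>) = - coord_det (ori \<alpha>) (- b1 # - b2 # ori \<gamma>)"
    using dim ori by (intro coord_det_swap) (simp add: orients_length)
  ultimately show ?thesis by (simp add: sgn_minus)
qed

text \<open>
  The reference basis \<open>E\<close> of the whole space separates the influence of the orientation of \<open>\<sigma>\<close> from that
  of the side of \<open>\<tau>\<close> on which \<open>\<sigma>\<close> lies.  With respect to \<open>E\<close>, the vectors \<open>- w\<close> and \<open>- w'\<close> lead to opposite
  signs.
\<close>

lemma incidence_opposite: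
  fixes \<sigma> \<sigma>' \<tau> :: "(rat ^ 'n::finite) set"
  assumes ori: "orients (ori \<sigma>) \<sigma>" "orients (ori \<sigma>') \<sigma>'" "orients (ori \<tau>) \<tau>"
    and dim: "vec.dim \<sigma> = CARD('n)" "vec.dim \<sigma>' = CARD('n)" "CARD('n) = Suc (vec.dim \<tau>)"
    and face: "cone_face \<tau> \<sigma>" "cone_face \<tau> \<sigma>'"
    and w: "w \<in> \<sigma>" "w' \<in> \<sigma>'" "rdot u w > 0" "rdot u w' < 0" "\<And>x. x \<in> \<tau> \<Longrightarrow> rdot u x = 0"
    and E: "basis_list E" "length E = CARD('n)"
  shows "\<exists>s. s \<noteq> 0 \<and> incidence ori \<sigma> \<tau> = sgn (coord_det (ori \<sigma>) E) * s \<and>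
    incidence ori \<sigma>' \<tau> = - (sgn (coord_det (ori \<sigma>') E) * s)"
proof -
  note full = span_eq_UNIV
  have spanE: "vec.span (set E) = UNIV"
    using E by (intro full) (metis basis_list_def distinct_card vec.dim_eq_card_independent)
  have z: "rdot u x = 0" if "x \<in> vec.span \<tau>" for x using rdot_span_zero[OF that w(5)] .
  have nw: "w \<notin> vec.span \<tau>" "w' \<notin> vec.span \<tau>" using z w(3,4) by force+
  have mult: "incidence ori \<rho> \<tau> = sgn (coord_det (ori \<rho>) E) * sgn (coord_det E (- v # ori \<tau>))"
    if \<rho>: "orients (ori \<rho>) \<rho>" "vec.dim \<rho> = CARD('n)" "cone_face \<tau> \<rho>" "v \<in> \<rho>" "v \<notin> vec.span \<tau>" for \<rho> v
  proof -
    have "coord_det (ori \<rho>) (- v # ori \<tau>) = coord_det E (- v # ori \<tau>) * coord_det (ori \<rho>) E"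
      using \<rho> E ori(3) dim(3) full[OF \<rho>(2)]
      by (intro coord_det_mult) (simp_all add: orients_basis_list orients_length orients_span spanE)
    then show ?thesis
      using incidence_eq[OF \<rho>(1) ori(3) _ \<rho>(3,4,5)] \<rho>(2) dim(3) by (simp add: sgn_mult)
  qed
  obtain k where k: "w' - k *s w \<in> vec.span \<tau>"
    using span_codim_one[OF cone_face_subset[OF face(1)], of w w'] nw full[OF dim(1)] dim by auto
  have "rdot u w' = k * rdot u w" using z[OF k] by simp
  then have "k < 0" using w(3,4) by (metis mult_less_0_iff not_less_iff_gr_or_eq)
  have "- w' - k *s - w = - (w' - k *s w)" by simp
  then have k': "- w' - k *s - w \<in> vec.span \<tau>" using vec.span_neg[OF k] by simp
  have nw': "- w \<notin> vec.span \<tau>" using nw(1) vec.span_neg[of "- w" \<tau>] by auto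
  have "coord_det E (- w' # ori \<tau>) = k * coord_det E (- w # ori \<tau>)"
    using E ori(3) dim(3) nw' k'
    by (intro coord_det_change_first) (simp_all add: orients_basis_list orients_length orients_span spanE)
  moreover have "coord_det E (- w # ori \<tau>) \<noteq> 0"
  proof (rule coord_det_nonzero)
    show bl: "basis_list (- w # ori \<tau>)"
      using nw' ori(3) by (intro basis_list_Cons) (simp_all add: orients_basis_list orients_span)
    have "vec.dim (set (- w # ori \<tau>)) = CARD('n)"
      using bl dim(3) ori(3) by (metis basis_list_def distinct_card length_Cons orients_length vec.dim_eq_card_independent)
    then show "vec.span (set (- w # ori \<tau>)) = vec.span (set E)" using full spanE by metis
  qed (use E ori(3) dim(3) in \<open>simp_all add: orients_length\<close>)
  ultimately show ?thesis
    using mult[OF ori(1) dim(1) face(1) w(1) nw(1)] mult[OF ori(2) dim(2) face(2) w(2) nw(2)] \<open>k < 0\<close>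
    by (intro exI[of _ "sgn (coord_det E (- w # ori \<tau>))"]) (simp add: sgn_mult sgn_0_0)
qed

lemma full_basis_list_exists:
  obtains E :: "(rat ^ 'n::finite) list" where "basis_list E" "length E = CARD('n)"
proof -
  obtain B :: "(rat ^ 'n) set" where B: "vec.independent B" "UNIV \<subseteq> vec.span B" "card B = vec.dim (UNIV :: (rat ^ 'n) set)"
    using vec.basis_exists[of "UNIV :: (rat ^ 'n) set"] by metis
  have "finite B" using vec.finiteI_independent[OF B(1)] .
  then obtain E where "set E = B" "distinct E" using finite_distinct_list by blast
  then show ?thesis using that[of E] B distinct_card[of E] by (simp add: basis_list_def vec_dim_card del: vec.dim_UNIV)
qed

section \<open>Polyhedral cones\<close>

definition gcone :: "(rat ^ 'n::finite) set \<Rightarrow> (rat ^ 'n) set" where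
  "gcone V = {(\<Sum>v\<in>V. c v *s v) | c. \<forall>v\<in>V. 0 \<le> c v}"

lemma polyhedral_cone_gcone: "polyhedral_cone \<sigma> \<longleftrightarrow> (\<exists>V. finite V \<and> \<sigma> = gcone V)"
  by (simp add: polyhedral_cone_def gcone_def)

lemma gconeI: "(\<And>v. v \<in> V \<Longrightarrow> 0 \<le> c v) \<Longrightarrow> (\<Sum>v\<in>V. c v *s v) \<in> gcone V"
  unfolding gcone_def by blast

lemma gconeE:
  assumes "x \<in> gcone V"
  obtains c where "x = (\<Sum>v\<in>V. c v *s v)" "\<And>v. v \<in> V \<Longrightarrow> 0 \<le> c v"
  using assms unfolding gcone_def by blast

lemma gcone_add:
  assumes "x \<in> gcone V" "y \<in> gcone V"
  shows "x + y \<in> gcone V"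
proof -
  obtain c where c: "x = (\<Sum>v\<in>V. c v *s v)" "\<And>v. v \<in> V \<Longrightarrow> 0 \<le> c v"
    by (rule gconeE[OF assms(1)]) (rule that)
  obtain d where "y = (\<Sum>v\<in>V. d v *s v)" "\<And>v. v \<in> V \<Longrightarrow> 0 \<le> d v"
    by (rule gconeE[OF assms(2)]) (rule that)
  with c show ?thesis
    using gconeI[of V "\<lambda>v. c v + d v"] by (simp add: vec.scale_left_distrib sum.distrib)
qed

lemma gcone_scale:
  assumes "x \<in> gcone V" "0 \<le> a"
  shows "a *s x \<in> gcone V"
proof -
  obtain c where "x = (\<Sum>v\<in>V. c v *s v)" "\<And>v. v \<in> V \<Longrightarrow> 0 \<le> c v"
    by (rule gconeE[OF assms(1)]) (rule that)
  then show ?thesis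
    using gconeI[of V "\<lambda>v. a * c v"] assms(2) by (simp add: vec.scale_sum_right)
qed

lemma gcone_superset:
  assumes "finite V" "V \<subseteq> W" "finite W"
  shows "gcone V \<subseteq> gcone W"
proof
  fix x assume x: "x \<in> gcone V"
  obtain c where c: "x = (\<Sum>v\<in>V. c v *s v)" "\<And>v. v \<in> V \<Longrightarrow> 0 \<le> c v"
    by (rule gconeE[OF x]) (rule that)
  have "(\<Sum>v\<in>W. (if v \<in> V then c v else 0) *s v) = (\<Sum>v\<in>V. (if v \<in> V then c v else 0) *s v)"
    using assms by (intro sum.mono_neutral_right) auto
  then have "x = (\<Sum>v\<in>W. (if v \<in> V then c v else 0) *s v)" by (simp add: c(1))
  then show "x \<in> gcone W" using gconeI[of W "\<lambda>v. if v \<in> V then c v else 0"] c(2) by simp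
qed

lemma generator_in_gcone:
  assumes "finite V" "v \<in> V"
  shows "v \<in> gcone V"
proof -
  have "(\<Sum>x\<in>V. (if x = v then 1 else 0) *s x) = (\<Sum>x\<in>V. if x = v then x else 0)"
    by (rule sum.cong) auto
  then have "(\<Sum>x\<in>V. (if x = v then 1 else 0) *s x) = v" using assms by simp
  then show ?thesis using gconeI[of V "\<lambda>x. if x = v then 1 else 0"] by simp
qed

lemma span_gcone: "finite V \<Longrightarrow> vec.span (gcone V) = vec.span V"
  using generator_in_gcone[of V] unfolding vec.span_eq
  by (auto elim!: gconeE intro: vec.span_base vec.span_sum vec.span_scale)

text \<open>
  If the generators are dependent, a nonnegative combination can be moved along a linear relation until
  the first coefficient vanishes.  The step length \<open>r\<close> is the least ratio over the generators on which
  the relation is positive.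
\<close>

lemma gcone_caratheodory:
  assumes "finite V" "x \<in> gcone V"
  shows "\<exists>T\<subseteq>V. vec.independent T \<and> x \<in> gcone T"
  using assms
proof (induction V rule: finite_psubset_induct)
  case (psubset V)
  show ?case
  proof (cases "vec.independent V")
    case False
    then obtain t u v0 where t: "finite t" "t \<subseteq> V" "(\<Sum>v\<in>t. u v *s v) = 0" "v0 \<in> t" "u v0 \<noteq> 0"
      unfolding vec.dependent_explicit by blast
    define w where "w v = (if v \<in> t then (if u v0 > 0 then u v else - u v) else 0)" for v
    have "(\<Sum>v\<in>V. w v *s v) = (\<Sum>v\<in>t. w v *s v)"
      using t(2) psubset(1) by (intro sum.mono_neutral_right) (auto simp: w_def)
    also have "\<dots> = (if u v0 > 0 then (\<Sum>v\<in>t. u v *s v) else - (\<Sum>v\<in>t. u v *s v))"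
      by (simp add: w_def sum_negf)
    finally have w0: "(\<Sum>v\<in>V. w v *s v) = 0" using t(3) by (simp split: if_splits)
    have wpos: "v0 \<in> V" "w v0 > 0" using t by (auto simp: w_def)
    obtain c where c: "x = (\<Sum>v\<in>V. c v *s v)" "\<And>v. v \<in> V \<Longrightarrow> 0 \<le> c v"
      by (rule gconeE[OF psubset(3)]) (rule that)
    define P where "P = {v\<in>V. w v > 0}"
    have P: "finite P" "P \<noteq> {}" using psubset(1) wpos by (auto simp: P_def)
    define r where "r = Min ((\<lambda>v. c v / w v) ` P)"
    have "r \<in> (\<lambda>v. c v / w v) ` P" unfolding r_def using P by (intro Min_in) auto
    then obtain v1 where v1: "v1 \<in> P" "r = c v1 / w v1" by blast
    have rle: "r \<le> c v / w v" if "v \<in> P" for v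
      unfolding r_def using P that by (intro Min_le) auto
    have r0: "0 \<le> r" using v1 c(2) by (simp add: P_def)
    define d where "d v = c v - r * w v" for v
    have d: "0 \<le> d v" if "v \<in> V" for v
    proof (cases "w v > 0")
      case True
      then show ?thesis using rle[of v] that by (simp add: P_def d_def pos_le_divide_eq)
    next
      case False
      then have "r * w v \<le> 0" using r0 by (simp add: mult_nonneg_nonpos)
      then show ?thesis using c(2)[OF that] by (simp add: d_def)
    qed
    have d1: "d v1 = 0" using v1 by (simp add: d_def P_def)
    have "(\<Sum>v\<in>V. d v *s v) = (\<Sum>v\<in>V. c v *s v) - r *s (\<Sum>v\<in>V. w v *s v)"
      by (simp add: d_def vec.scale_left_diff_distrib sum_subtractf vec.scale_sum_right)
    then have "x = (\<Sum>v\<in>V. d v *s v)" using w0 c(1) by simp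
    also have "\<dots> = (\<Sum>v\<in>V - {v1}. d v *s v)"
      using psubset(1) d1 v1(1) by (simp add: sum.remove[of V v1] P_def)
    finally have "x \<in> gcone (V - {v1})" using gconeI[of "V - {v1}" d] d by simp
    moreover have "V - {v1} \<subset> V" using v1(1) by (auto simp: P_def)
    ultimately show ?thesis using psubset(2)[of "V - {v1}"] by blast
  qed (use psubset in auto)
qed

text \<open>
  A finite union of conditions that holds for arbitrarily small positive parameters has one member that
  does.
\<close>

lemma arbitrarily_small_pigeonhole:
  assumes "finite S" "\<And>\<epsilon>. (0::rat) < \<epsilon> \<Longrightarrow> \<exists>\<delta>>0. \<delta> < \<epsilon> \<and> (\<exists>T\<in>S. P T \<delta>)"
  shows "\<exists>T\<in>S. \<forall>\<epsilon>>0. \<exists>\<delta>>0. \<delta> < \<epsilon> \<and> P T \<delta>"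
proof (rule ccontr)
  assume "\<not> ?thesis"
  then have "\<forall>T\<in>S. \<exists>\<epsilon>>0. \<forall>\<delta>>0. \<delta> < \<epsilon> \<longrightarrow> \<not> P T \<delta>" by blast
  then obtain e where e: "\<And>T. T \<in> S \<Longrightarrow> 0 < e T" "\<And>T \<delta>. T \<in> S \<Longrightarrow> 0 < \<delta> \<Longrightarrow> \<delta> < e T \<Longrightarrow> \<not> P T \<delta>"
    by metis
  define \<epsilon> where "\<epsilon> = Min (insert 1 (e ` S))"
  have "0 < \<epsilon>" unfolding \<epsilon>_def using assms(1) e(1) by (subst Min_gr_iff) auto
  then obtain \<delta> T where "0 < \<delta>" "\<delta> < \<epsilon>" "T \<in> S" "P T \<delta>" using assms(2) by blast
  moreover have "\<epsilon> \<le> e T" unfolding \<epsilon>_def using assms(1) \<open>T \<in> S\<close> by (intro Min_le) auto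
  ultimately show False using e(2)[of T \<delta>] by simp
qed

text \<open>
  For independent generators the coordinates are linear functions on the span, so the limit \<open>x\<close> of points
  \<open>x + \<delta> w\<close> of the cone has nonnegative coordinates as well.
\<close>

lemma independent_gcone_closed:
  assumes T: "vec.independent T" and small: "\<And>\<epsilon>. 0 < \<epsilon> \<Longrightarrow> \<exists>\<delta>>0. \<delta> < \<epsilon> \<and> x + \<delta> *s w \<in> gcone T"
  shows "x \<in> gcone T"
proof -
  have fin: "finite T" using T by (rule vec.finiteI_independent)
  have sub: "gcone T \<subseteq> vec.span T" using span_gcone[OF fin] vec.span_superset by blast
  obtain a where a: "0 < a" "x + a *s w \<in> gcone T" using small[of 1] by auto
  obtain b where b: "0 < b" "b < a" "x + b *s w \<in> gcone T" using small[of a] a by auto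
  have "(x + a *s w) - (x + b *s w) \<in> vec.span T" using a b sub by (intro vec.span_diff) auto
  then have "(a - b) *s w \<in> vec.span T" by (simp add: vec.scale_left_diff_distrib)
  then have "(1 / (a - b)) *s ((a - b) *s w) \<in> vec.span T" by (rule vec.span_scale)
  then have w: "w \<in> vec.span T" using b by simp
  have "(x + a *s w) - a *s w \<in> vec.span T" using a sub w by (intro vec.span_diff vec.span_scale) auto
  then have x: "x \<in> vec.span T" by simp
  let ?R = "vec.representation T"
  have rep: "?R (x + \<delta> *s w) v = ?R x v + \<delta> * ?R w v" for \<delta> v
    using vec.representation_add[OF T vec.span_scale[OF w] x] vec.representation_scale[OF T w]
    by (simp add: add.commute)
  have nonneg: "0 \<le> ?R y v" if y: "y \<in> gcone T" for y v
  proof (cases "v \<in> T")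
    case True
    obtain c where c: "y = (\<Sum>v\<in>T. c v *s v)" "\<And>v. v \<in> T \<Longrightarrow> 0 \<le> c v" by (rule gconeE[OF y]) (rule that)
    have 1: "?R y = (\<lambda>b. \<Sum>t\<in>T. ?R (c t *s t) b)"
      unfolding c(1) by (intro vec.representation_sum T vec.span_scale vec.span_base)
    have "?R (c t *s t) v = (if t = v then c t else 0)" if "t \<in> T" for t
      using that by (simp add: vec.representation_scale[OF T vec.span_base] vec.representation_basis[OF T])
    then have "?R y v = (\<Sum>t\<in>T. if t = v then c t else 0)" unfolding 1 by (intro sum.cong) auto
    then show ?thesis using True fin c(2) by simp
  qed (use vec.representation_ne_zero[of T y v] in force)
  have "0 \<le> ?R x v" for v
  proof (rule ccontr)
    assume neg: "\<not> 0 \<le> ?R x v"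
    define \<epsilon> where "\<epsilon> = - ?R x v / (\<bar>?R w v\<bar> + 1)"
    have "0 < \<epsilon>" unfolding \<epsilon>_def using neg by (intro divide_pos_pos) auto
    then obtain \<delta> where \<delta>: "0 < \<delta>" "\<delta> < \<epsilon>" "x + \<delta> *s w \<in> gcone T" using small by blast
    have "\<delta> * ?R w v \<le> \<delta> * (\<bar>?R w v\<bar> + 1)" using \<delta>(1) by (intro mult_left_mono) auto
    also have "\<dots> < \<epsilon> * (\<bar>?R w v\<bar> + 1)" using \<delta>(2) by (intro mult_strict_right_mono) auto
    also have "\<dots> = - ?R x v" unfolding \<epsilon>_def by (simp add: add_nonneg_pos)
    finally show False using nonneg[OF \<delta>(3), of v] rep[of \<delta> v] by simp
  qed
  then have "(\<Sum>v\<in>T. ?R x v *s v) \<in> gcone T" by (intro gconeI)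
  then show ?thesis using vec.sum_representation_eq[OF T x fin] by simp
qed

text \<open>
  Finite unions of polyhedral cones are closed along segments.  By the theorem of Caratheodory a cone is
  a finite union of cones with independent generators, to which the preceding lemma applies.
\<close>

lemma finite_cones_closed:
  assumes "finite F" "\<And>\<rho>. \<rho> \<in> F \<Longrightarrow> polyhedral_cone \<rho>"
    and small: "\<And>\<delta>. 0 < \<delta> \<Longrightarrow> \<delta> < e \<Longrightarrow> x + \<delta> *s w \<in> \<Union>F" and "0 < e"
  obtains \<rho> \<delta> where "\<rho> \<in> F" "x \<in> \<rho>" "0 < \<delta>" "x + \<delta> *s w \<in> \<rho>"
proof -
  obtain V where V: "\<And>\<rho>. \<rho> \<in> F \<Longrightarrow> finite (V \<rho>) \<and> \<rho> = gcone (V \<rho>)"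
    using assms(2) unfolding polyhedral_cone_gcone by metis
  define S where "S = (\<Union>\<rho>\<in>F. (\<lambda>T. (\<rho>, T)) ` {T. T \<subseteq> V \<rho> \<and> vec.independent T})"
  have "finite {T. T \<subseteq> V \<rho> \<and> vec.independent T}" if "\<rho> \<in> F" for \<rho>
  proof -
    have "finite (V \<rho>)" using V[OF that] by blast
    then show ?thesis by (rule finite_subset[rotated, OF finite_Pow_iff[THEN iffD2]]) auto
  qed
  then have finS: "finite S" unfolding S_def using assms(1) by auto
  have "\<exists>\<delta>>0. \<delta> < \<epsilon> \<and> (\<exists>p\<in>S. x + \<delta> *s w \<in> gcone (snd p))" if \<epsilon>: "0 < \<epsilon>" for \<epsilon>
  proof -
    define \<delta> where "\<delta> = min \<epsilon> e / 2"
    have \<delta>: "0 < \<delta>" "\<delta> < \<epsilon>" "\<delta> < e" using \<epsilon> \<open>0 < e\<close> by (auto simp: \<delta>_def min_def field_simps)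
    then obtain \<rho> where \<rho>: "\<rho> \<in> F" "x + \<delta> *s w \<in> \<rho>" using small by blast
    have "finite (V \<rho>)" "x + \<delta> *s w \<in> gcone (V \<rho>)" using V[OF \<rho>(1)] \<rho>(2) by blast+
    then obtain T where "T \<subseteq> V \<rho>" "vec.independent T" "x + \<delta> *s w \<in> gcone T"
      using gcone_caratheodory by blast
    then show ?thesis using \<delta> \<rho>(1) by (intro exI[of _ \<delta>]) (auto simp: S_def)
  qed
  then have "\<exists>p\<in>S. \<forall>\<epsilon>>0. \<exists>\<delta>>0. \<delta> < \<epsilon> \<and> x + \<delta> *s w \<in> gcone (snd p)"
    by (rule arbitrarily_small_pigeonhole[OF finS])
  then obtain \<rho> T where T: "\<rho> \<in> F" "T \<subseteq> V \<rho>" "vec.independent T"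
    and sm: "\<And>\<epsilon>. 0 < \<epsilon> \<Longrightarrow> \<exists>\<delta>>0. \<delta> < \<epsilon> \<and> x + \<delta> *s w \<in> gcone T"
    unfolding S_def by auto
  have sub: "gcone T \<subseteq> \<rho>"
    using gcone_superset[of T "V \<rho>"] V[OF T(1)] T(2) finite_subset by metis
  obtain \<delta> where "0 < \<delta>" "x + \<delta> *s w \<in> gcone T" using sm[of 1] by auto
  then show ?thesis
    using that[OF T(1), of \<delta>] independent_gcone_closed[OF T(3) sm] sub by blast
qed

text \<open>
  The two properties of a point of the relative interior that are used below: no proper face contains it,
  and it can be moved a little within the span, in finitely many directions simultaneously.  (As many
  directions as coordinates suffice.)
\<close>

definition relint_point :: "(rat ^ 'n::finite) set \<Rightarrow> rat ^ 'n \<Rightarrow> bool" where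
  "relint_point \<tau> p \<longleftrightarrow> p \<in> \<tau> \<and>
    (\<forall>u. (\<forall>x\<in>\<tau>. 0 \<le> rdot u x) \<longrightarrow> rdot u p = 0 \<longrightarrow> (\<forall>x\<in>\<tau>. rdot u x = 0)) \<and>
    (\<forall>h :: 'n \<Rightarrow> _. (\<forall>i. h i \<in> vec.span \<tau>) \<longrightarrow>
       (\<exists>\<epsilon>>0. \<forall>a. (\<forall>i. \<bar>a i\<bar> < \<epsilon>) \<longrightarrow> p + (\<Sum>i\<in>UNIV. a i *s h i) \<in> \<tau>))"

lemma relint_point_mem: "relint_point \<tau> p \<Longrightarrow> p \<in> \<tau>"
  by (simp add: relint_point_def)

lemma relint_point_functional:
  "relint_point \<tau> p \<Longrightarrow> (\<And>x. x \<in> \<tau> \<Longrightarrow> 0 \<le> rdot u x) \<Longrightarrow> rdot u p = 0 \<Longrightarrow> x \<in> \<tau> \<Longrightarrow> rdot u x = 0"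
  unfolding relint_point_def by blast

lemma relint_point_neighbourhood:
  fixes p :: "rat ^ 'n::finite"
  assumes "relint_point \<tau> p" "\<And>i::'n. h i \<in> vec.span \<tau>"
  obtains \<epsilon> where "0 < \<epsilon>" "\<And>a. (\<And>i. \<bar>a i\<bar> < \<epsilon>) \<Longrightarrow> p + (\<Sum>i\<in>UNIV. a i *s h i) \<in> \<tau>"
proof -
  have "\<forall>h :: 'n \<Rightarrow> _. (\<forall>i. h i \<in> vec.span \<tau>) \<longrightarrow>
       (\<exists>\<epsilon>>0. \<forall>a. (\<forall>i. \<bar>a i\<bar> < \<epsilon>) \<longrightarrow> p + (\<Sum>i\<in>UNIV. a i *s h i) \<in> \<tau>)"
    using assms(1) unfolding relint_point_def by (elim conjE)
  from this[rule_format, of h] obtain \<epsilon> where \<epsilon>: "0 < \<epsilon>"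
    "\<forall>a. (\<forall>i. \<bar>a i\<bar> < \<epsilon>) \<longrightarrow> p + (\<Sum>i\<in>UNIV. a i *s h i) \<in> \<tau>" using assms(2) by metis
  show ?thesis using \<epsilon>(2) by (intro that[OF \<epsilon>(1)]) blast
qed

text \<open>
  The sum of the generators is such a point.
\<close>

lemma relint_point_exists:
  fixes \<tau> :: "(rat ^ 'n::finite) set"
  assumes "polyhedral_cone \<tau>"
  obtains p where "relint_point \<tau> p"
proof -
  obtain V where V: "finite V" "\<tau> = gcone V" using assms by (auto simp: polyhedral_cone_gcone)
  define p where "p = (\<Sum>v\<in>V. v)"
  have p: "p = (\<Sum>v\<in>V. 1 *s v)" by (simp add: p_def)
  show ?thesis
  proof (rule that[of p], unfold relint_point_def, intro conjI allI impI)
    show "p \<in> \<tau>" unfolding p V(2) by (rule gconeI) simp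
  next
    fix u assume u: "\<forall>x\<in>\<tau>. 0 \<le> rdot u x" "rdot u p = 0"
    have "(\<Sum>v\<in>V. rdot u v) = 0" using u(2) by (simp add: p_def rdot_sum)
    moreover have "0 \<le> rdot u v" if "v \<in> V" for v using u(1) V that generator_in_gcone by blast
    ultimately have "rdot u v = 0" if "v \<in> V" for v
      using sum_nonneg_eq_0_iff[of V "rdot u"] V(1) that by auto
    then show "\<forall>x\<in>\<tau>. rdot u x = 0" unfolding V(2) by (auto elim!: gconeE simp: rdot_sum)
  next
    fix h :: "'n \<Rightarrow> rat ^ 'n" assume h: "\<forall>i. h i \<in> vec.span \<tau>"
    have "\<forall>i. \<exists>c. h i = (\<Sum>v\<in>V. c v *s v)"
      using h vec.span_finite[OF V(1)] span_gcone[OF V(1)] V(2) by auto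
    then obtain c where c: "\<And>i. h i = (\<Sum>v\<in>V. c i v *s v)" by metis
    define M where "M = (\<Sum>i\<in>UNIV. \<Sum>v\<in>V. \<bar>c i v\<bar>)"
    have M0: "0 \<le> M" unfolding M_def by (intro sum_nonneg) auto
    have "p + (\<Sum>i\<in>UNIV. a i *s h i) \<in> \<tau>" if a: "\<forall>i. \<bar>a i\<bar> < 1 / (M + 1)" for a
    proof -
      have "p + (\<Sum>i\<in>UNIV. a i *s h i) = (\<Sum>v\<in>V. (1 + (\<Sum>i\<in>UNIV. a i * c i v)) *s v)"
        unfolding p c
        by (simp add: vec.scale_sum_right sum.swap[of _ UNIV] vec.scale_left_distrib sum.distrib vec.scale_sum_left)
      moreover have "0 \<le> 1 + (\<Sum>i\<in>UNIV. a i * c i v)" if v: "v \<in> V" for v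
      proof -
        have "\<bar>\<Sum>i\<in>UNIV. a i * c i v\<bar> \<le> (\<Sum>i\<in>UNIV. \<bar>a i * c i v\<bar>)" by (rule sum_abs)
        also have "\<dots> \<le> (\<Sum>i\<in>UNIV. 1 / (M + 1) * (\<Sum>v\<in>V. \<bar>c i v\<bar>))"
        proof (rule sum_mono)
          fix i
          have "\<bar>c i v\<bar> \<le> (\<Sum>v\<in>V. \<bar>c i v\<bar>)" using V(1) v by (intro member_le_sum) auto
          then show "\<bar>a i * c i v\<bar> \<le> 1 / (M + 1) * (\<Sum>v\<in>V. \<bar>c i v\<bar>)"
            unfolding abs_mult using a M0 by (intro mult_mono) (auto intro: less_imp_le)
        qed
        also have "\<dots> = 1 / (M + 1) * M" unfolding M_def by (simp only: sum_distrib_left)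
        also have "\<dots> \<le> 1" using M0 by (simp add: field_simps)
        finally show ?thesis by linarith
      qed
      ultimately show ?thesis unfolding V(2) by (simp only: gconeI)
    qed
    then show "\<exists>\<epsilon>>0. \<forall>a. (\<forall>i::'n. \<bar>a i\<bar> < \<epsilon>) \<longrightarrow> p + (\<Sum>i\<in>UNIV. a i *s h i) \<in> \<tau>"
      using M0 by (intro exI[of _ "1 / (M + 1)"]) auto
  qed
qed

lemma polyhedral_cone_add: "polyhedral_cone \<sigma> \<Longrightarrow> x \<in> \<sigma> \<Longrightarrow> y \<in> \<sigma> \<Longrightarrow> x + y \<in> \<sigma>"
  by (auto simp: polyhedral_cone_gcone gcone_add)

lemma polyhedral_cone_scale: "polyhedral_cone \<sigma> \<Longrightarrow> x \<in> \<sigma> \<Longrightarrow> 0 \<le> a \<Longrightarrow> a *s x \<in> \<sigma>"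
  by (auto simp: polyhedral_cone_gcone gcone_scale)

lemma polyhedral_cone_add_scale:
  "polyhedral_cone \<sigma> \<Longrightarrow> x \<in> \<sigma> \<Longrightarrow> y \<in> \<sigma> \<Longrightarrow> 0 \<le> a \<Longrightarrow> x + a *s y \<in> \<sigma>"
  by (simp add: polyhedral_cone_add polyhedral_cone_scale)

lemma functional_exists:
  fixes x :: "rat ^ 'n::finite"
  assumes "x \<notin> vec.span W"
  obtains u where "rdot u x = 1" "\<And>y. y \<in> W \<Longrightarrow> rdot u y = 0"
proof -
  obtain A where A: "A \<subseteq> W" "vec.independent A" "W \<subseteq> vec.span A"
    using vec.maximal_independent_subset by blast
  have x: "x \<notin> vec.span A" using assms A(1) vec.span_mono by blast
  have ind: "vec.independent (insert x A)" using A(2) x by (simp add: vec.independent_insert)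
  obtain C where C: "insert x A \<subseteq> C" "vec.independent C" "UNIV \<subseteq> vec.span C"
    using vec.maximal_independent_subset_extend[OF subset_UNIV ind] by metis
  define u where "u = (\<chi> i. vec.representation C (axis i 1) x)"
  have u: "rdot u y = vec.representation C y x" for y
  proof -
    have "vec.representation C y x = vec.representation C (\<Sum>i\<in>UNIV. y $ i *s axis i 1) x"
      using sum_axis[of y] by simp
    also have "\<dots> = (\<Sum>i\<in>UNIV. y $ i * vec.representation C (axis i 1) x)"
    proof -
      have s: "v \<in> vec.span C" for v using C(3) by blast
      have "vec.representation C (\<Sum>i\<in>UNIV. y $ i *s axis i 1) =
          (\<lambda>b. \<Sum>i\<in>UNIV. vec.representation C (y $ i *s axis i 1) b)"
        by (rule vec.representation_sum[OF C(2) s])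
      then show ?thesis by (simp add: vec.representation_scale[OF C(2) s])
    qed
    finally show ?thesis by (simp add: u_def rdot_def mult.commute)
  qed
  show ?thesis
  proof (rule that[of u])
    show "rdot u x = 1" unfolding u using C by (subst vec.representation_basis) auto
    fix y assume "y \<in> W"
    then have "y \<in> vec.span A" using A by blast
    then have "vec.representation C y = vec.representation A y"
      using C by (intro vec.representation_extend) auto
    then show "rdot u y = 0"
      unfolding u using vec.representation_ne_zero[of A y x] x vec.span_base by metis
  qed
qed

section \<open>The diamond property\<close>

text \<open>
  Modulo the span of \<open>\<gamma>\<close>, the cone \<open>\<alpha>\<close> is a pointed plane cone, and its two boundary rays are the cones
  in between.  Let \<open>u0\<close> be a functional that defines \<open>\<gamma>\<close>, and \<open>u1\<close> a second one, so that both vanish on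
  \<open>\<gamma>\<close> and separate the points of the plane.  The slope \<open>u1 / u0\<close> is defined on the generators outside \<open>\<gamma>\<close>;
  those of least and of greatest slope, \<open>m\<close> and \<open>M\<close>, span the two rays.
\<close>

lemma cone_diamond:
  fixes \<alpha> \<gamma> :: "(rat ^ 'n::finite) set"
  assumes "polyhedral_cone \<alpha>" and face: "cone_face \<gamma> \<alpha>" and dim: "vec.dim \<alpha> = Suc (Suc (vec.dim \<gamma>))"
  obtains \<beta>1 \<beta>2 b1 b2 where "cone_face \<beta>1 \<alpha>" "cone_face \<beta>2 \<alpha>" "\<gamma> \<subseteq> \<beta>1" "\<gamma> \<subseteq> \<beta>2"
    "vec.dim \<beta>1 = Suc (vec.dim \<gamma>)" "vec.dim \<beta>2 = Suc (vec.dim \<gamma>)"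
    "b1 \<in> \<beta>1" "b1 \<notin> vec.span \<beta>2" "b2 \<in> \<beta>2" "b2 \<notin> vec.span \<beta>1"
    "\<And>\<beta>. cone_face \<beta> \<alpha> \<Longrightarrow> \<gamma> \<subseteq> \<beta> \<Longrightarrow> vec.dim \<beta> = Suc (vec.dim \<gamma>) \<Longrightarrow> \<beta> = \<beta>1 \<or> \<beta> = \<beta>2"
proof -
  obtain V where V: "finite V" "\<alpha> = gcone V" using assms(1) by (auto simp: polyhedral_cone_gcone)
  have V\<alpha>: "V \<subseteq> \<alpha>" using generator_in_gcone[OF V(1)] V(2) by blast
  obtain u0 where u0: "\<And>x. x \<in> \<alpha> \<Longrightarrow> 0 \<le> rdot u0 x" "\<gamma> = {x\<in>\<alpha>. rdot u0 x = 0}"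
    using face unfolding cone_face_def by blast
  have \<gamma>\<alpha>: "\<gamma> \<subseteq> \<alpha>" using u0(2) by blast
  have zero\<gamma>: "rdot u0 x = 0" if "x \<in> vec.span \<gamma>" for x using rdot_span_zero[OF that] u0(2) by auto
  have "\<gamma> \<noteq> \<alpha>" using dim by auto
  then obtain p where p: "p \<in> \<alpha>" "p \<notin> \<gamma>" using \<gamma>\<alpha> by blast
  then have p0: "rdot u0 p > 0" using u0(1)[of p] u0(2) by force
  have "p \<notin> vec.span \<gamma>" using zero\<gamma> p0 by force
  then have dimp: "vec.dim (insert p \<gamma>) = Suc (vec.dim \<gamma>)" by (simp add: vec.dim_insert)
  have "\<not> \<alpha> \<subseteq> vec.span (insert p \<gamma>)"
    using vec.dim_subset[of \<alpha> "vec.span (insert p \<gamma>)"] dim dimp by auto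
  then obtain q where q: "q \<in> \<alpha>" "q \<notin> vec.span (insert p \<gamma>)" by blast
  obtain u1 where u1: "rdot u1 q = 1" "\<And>y. y \<in> insert p \<gamma> \<Longrightarrow> rdot u1 y = 0"
    using functional_exists[OF q(2)] by blast
  have kernel: "x \<in> vec.span \<gamma>" if x: "x \<in> vec.span \<alpha>" "rdot u0 x = 0" "rdot u1 x = 0" for x
  proof -
    obtain t where t: "x - t *s q \<in> vec.span (insert p \<gamma>)"
    proof (rule span_codim_one)
      show "insert p \<gamma> \<subseteq> \<alpha>" "vec.dim \<alpha> = Suc (vec.dim (insert p \<gamma>))" "q \<in> vec.span \<alpha>"
        using p \<gamma>\<alpha> dim dimp q vec.span_base by auto
    qed (use q x(1) that in auto)
    have "rdot u1 (x - t *s q) = 0" by (rule rdot_span_zero[OF t]) (use u1 in auto)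
    then have "t = 0" using u1 x by simp
    then obtain s where s: "x - s *s p \<in> vec.span \<gamma>" using t vec.span_breakdown_eq[of x p \<gamma>] by auto
    then have "s = 0" using zero\<gamma>[OF s] x(2) p0 by simp
    then show ?thesis using s by simp
  qed
  define V' where "V' = {v\<in>V. 0 < rdot u0 v}"
  have pos: "v \<in> V' \<or> v \<in> \<gamma>" if "v \<in> V" for v
    using that V\<alpha> u0(1)[of v] u0(2) by (force simp: V'_def)
  have "V' \<noteq> {}"
  proof
    assume "V' = {}"
    then have "V \<subseteq> \<gamma>" using pos by blast
    then have "vec.span \<alpha> \<subseteq> vec.span \<gamma>" using span_gcone[OF V(1)] V(2) vec.span_mono by metis
    then show False using \<open>p \<notin> vec.span \<gamma>\<close> p(1) vec.span_base by blast
  qed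
  have finV': "finite V'" using V(1) by (simp add: V'_def)
  define s where "s v = rdot u1 v / rdot u0 v" for v
  define m M where "m = Min (s ` V')" and "M = Max (s ` V')"
  have "m \<in> s ` V'" "M \<in> s ` V'" unfolding m_def M_def using finV' \<open>V' \<noteq> {}\<close> by auto
  then obtain b1 b2 where b: "b1 \<in> V'" "m = s b1" "b2 \<in> V'" "M = s b2" by blast
  have b\<alpha>: "b1 \<in> \<alpha>" "b2 \<in> \<alpha>" using b V\<alpha> by (auto simp: V'_def)
  have b0: "rdot u0 b1 > 0" "rdot u0 b2 > 0" using b by (auto simp: V'_def)
  have b1: "rdot u1 b1 = m * rdot u0 b1" "rdot u1 b2 = M * rdot u0 b2" using b b0 by (simp_all add: s_def)
  have bounds: "m * rdot u0 x \<le> rdot u1 x \<and> rdot u1 x \<le> M * rdot u0 x" if x: "x \<in> \<alpha>" for x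
  proof -
    obtain c where c: "x = (\<Sum>v\<in>V. c v *s v)" "\<And>v. v \<in> V \<Longrightarrow> 0 \<le> c v" by (rule gconeE[OF x[unfolded V(2)]]) (rule that)
    have v: "m * rdot u0 v \<le> rdot u1 v \<and> rdot u1 v \<le> M * rdot u0 v" if "v \<in> V" for v
    proof (cases "v \<in> V'")
      case True
      then have "m \<le> s v" "s v \<le> M" "0 < rdot u0 v" unfolding m_def M_def using finV' by (auto simp: V'_def)
      then show ?thesis by (simp add: s_def pos_le_divide_eq pos_divide_le_eq)
    next
      case False
      then show ?thesis using pos[OF that] u1(2)[of v] u0(2) by simp
    qed
    have "c v * (m * rdot u0 v) \<le> c v * rdot u1 v \<and> c v * rdot u1 v \<le> c v * (M * rdot u0 v)" if "v \<in> V" for v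
      using v[OF that] c(2)[OF that] by (simp add: mult_left_mono)
    then have "(\<Sum>v\<in>V. c v * (m * rdot u0 v)) \<le> (\<Sum>v\<in>V. c v * rdot u1 v)"
      "(\<Sum>v\<in>V. c v * rdot u1 v) \<le> (\<Sum>v\<in>V. c v * (M * rdot u0 v))"
      by (simp_all add: sum_mono)
    then show ?thesis by (simp add: c(1) rdot_sum sum_distrib_left mult.left_commute)
  qed
  have "m < M"
  proof (rule ccontr)
    assume "\<not> m < M"
    moreover have "m \<le> M" using bounds[OF b\<alpha>(1)] b1(1) b0(1) by simp
    ultimately have "m = M" by simp
    then have e: "rdot u1 x = m * rdot u0 x" if "x \<in> \<alpha>" for x using bounds[OF that] by simp
    have "m = 0" using e[OF p(1)] u1(2)[of p] p0 by simp
    then show False using e[OF q(1)] u1(1) by simp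
  qed
  \<comment> \<open>every point of the plane is a combination of the two rays, by Cramer's rule\<close>
  have decomp: "\<exists>a b. x - (a *s b1 + b *s b2) \<in> vec.span \<gamma> \<and>
      b * (rdot u0 b2 * (M - m)) = rdot u1 x - m * rdot u0 x \<and>
      a * (rdot u0 b1 * (M - m)) = M * rdot u0 x - rdot u1 x" if x: "x \<in> vec.span \<alpha>" for x
  proof -
    define a where "a = (M * rdot u0 x - rdot u1 x) / (rdot u0 b1 * (M - m))"
    define b where "b = (rdot u1 x - m * rdot u0 x) / (rdot u0 b2 * (M - m))"
    have a': "a * (rdot u0 b1 * (M - m)) = M * rdot u0 x - rdot u1 x"
      unfolding a_def using b0 \<open>m < M\<close> by simp
    have b': "b * (rdot u0 b2 * (M - m)) = rdot u1 x - m * rdot u0 x"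
      unfolding b_def using b0 \<open>m < M\<close> by simp
    have "(a * rdot u0 b1 + b * rdot u0 b2) * (M - m) = rdot u0 x * (M - m)"
      using a' b' by (simp add: algebra_simps)
    then have 0: "a * rdot u0 b1 + b * rdot u0 b2 = rdot u0 x" using \<open>m < M\<close> by simp
    have "(a * rdot u1 b1 + b * rdot u1 b2) * (M - m) =
        m * (a * (rdot u0 b1 * (M - m))) + M * (b * (rdot u0 b2 * (M - m)))"
      by (simp add: b1 algebra_simps)
    also have "\<dots> = rdot u1 x * (M - m)" unfolding a' b' by (simp add: algebra_simps)
    finally have 1: "a * rdot u1 b1 + b * rdot u1 b2 = rdot u1 x" using \<open>m < M\<close> by simp
    have "x - (a *s b1 + b *s b2) \<in> vec.span \<alpha>"
      using x b\<alpha> by (intro vec.span_diff vec.span_add vec.span_scale) (auto intro: vec.span_base)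
    then have "x - (a *s b1 + b *s b2) \<in> vec.span \<gamma>"
      using 0 1 by (intro kernel) simp_all
    then show ?thesis using a' b' by blast
  qed
  define \<beta>1 where "\<beta>1 = {x\<in>\<alpha>. rdot (u1 - m *s u0) x = 0}"
  define \<beta>2 where "\<beta>2 = {x\<in>\<alpha>. rdot (M *s u0 - u1) x = 0}"
  have face1: "cone_face \<beta>1 \<alpha>" unfolding cone_face_def \<beta>1_def
    using bounds by (intro exI[of _ "u1 - m *s u0"]) auto
  have face2: "cone_face \<beta>2 \<alpha>" unfolding cone_face_def \<beta>2_def
    using bounds by (intro exI[of _ "M *s u0 - u1"]) auto
  have "x \<in> \<alpha> \<and> rdot u0 x = 0 \<and> rdot u1 x = 0" if "x \<in> \<gamma>" for x
    using that u0(2) u1(2)[of x] by blast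
  then have sub: "\<gamma> \<subseteq> \<beta>1" "\<gamma> \<subseteq> \<beta>2" by (auto simp: \<beta>1_def \<beta>2_def)
  have b\<beta>: "b1 \<in> \<beta>1" "b2 \<in> \<beta>2" using b\<alpha> b1 by (auto simp: \<beta>1_def \<beta>2_def)
  have nb: "b1 \<notin> vec.span \<gamma>" "b2 \<notin> vec.span \<gamma>" using zero\<gamma> b0 by force+
  have dim_ins: "vec.dim \<beta> = Suc (vec.dim \<gamma>)"
    if "\<gamma> \<subseteq> \<beta>" "b \<in> \<beta>" "b \<notin> vec.span \<gamma>" "\<And>x. x \<in> \<beta> \<Longrightarrow> \<exists>k. x - k *s b \<in> vec.span \<gamma>" for \<beta> b
  proof -
    have "\<beta> \<subseteq> vec.span (insert b \<gamma>)" using that(4) vec.span_breakdown_eq by blast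
    then have "vec.span \<beta> = vec.span (insert b \<gamma>)"
      unfolding vec.span_eq using that(1,2) by (auto intro: vec.span_base)
    then have "vec.dim \<beta> = vec.dim (insert b \<gamma>)" by (metis vec.dim_span)
    then show ?thesis using that(3) by (simp add: vec.dim_insert)
  qed
  have dim1: "vec.dim \<beta>1 = Suc (vec.dim \<gamma>)"
  proof (rule dim_ins[OF sub(1) b\<beta>(1) nb(1)])
    fix x assume "x \<in> \<beta>1"
    then have x: "x \<in> \<alpha>" "rdot u1 x = m * rdot u0 x" by (auto simp: \<beta>1_def)
    obtain a b where ab: "x - (a *s b1 + b *s b2) \<in> vec.span \<gamma>" "b * (rdot u0 b2 * (M - m)) = rdot u1 x - m * rdot u0 x"
      using decomp[OF vec.span_base[OF x(1)]] by blast
    then have "b = 0" using x(2) b0 \<open>m < M\<close> by simp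
    then show "\<exists>k. x - k *s b1 \<in> vec.span \<gamma>" using ab(1) by auto
  qed
  have dim2: "vec.dim \<beta>2 = Suc (vec.dim \<gamma>)"
  proof (rule dim_ins[OF sub(2) b\<beta>(2) nb(2)])
    fix x assume "x \<in> \<beta>2"
    then have x: "x \<in> \<alpha>" "rdot u1 x = M * rdot u0 x" by (auto simp: \<beta>2_def)
    obtain a b where ab: "x - (a *s b1 + b *s b2) \<in> vec.span \<gamma>" "a * (rdot u0 b1 * (M - m)) = M * rdot u0 x - rdot u1 x"
      using decomp[OF vec.span_base[OF x(1)]] by blast
    then have "a = 0" using x(2) b0 \<open>m < M\<close> by simp
    then show "\<exists>k. x - k *s b2 \<in> vec.span \<gamma>" using ab(1) by auto
  qed
  have off1: "b1 \<notin> vec.span \<beta>2"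
  proof
    assume "b1 \<in> vec.span \<beta>2"
    then have "rdot (M *s u0 - u1) b1 = 0" by (rule rdot_span_zero) (auto simp: \<beta>2_def)
    then show False using b1(1) b0(1) \<open>m < M\<close> by simp
  qed
  have off2: "b2 \<notin> vec.span \<beta>1"
  proof
    assume "b2 \<in> vec.span \<beta>1"
    then have "rdot (u1 - m *s u0) b2 = 0" by (rule rdot_span_zero) (auto simp: \<beta>1_def)
    then show False using b1(2) b0(2) \<open>m < M\<close> by simp
  qed
  have unique: "\<beta> = \<beta>1 \<or> \<beta> = \<beta>2"
    if \<beta>: "cone_face \<beta> \<alpha>" "\<gamma> \<subseteq> \<beta>" "vec.dim \<beta> = Suc (vec.dim \<gamma>)" for \<beta>
  proof -
    obtain u where u: "\<And>x. x \<in> \<alpha> \<Longrightarrow> 0 \<le> rdot u x" "\<beta> = {x\<in>\<alpha>. rdot u x = 0}"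
      using \<beta>(1) unfolding cone_face_def by blast
    have u\<gamma>: "rdot u x = 0" if "x \<in> vec.span \<gamma>" for x
      using \<beta>(2) u(2) by (intro rdot_span_zero[OF that]) auto
    \<comment> \<open>on \<open>\<alpha>\<close> the functional of \<open>\<beta>\<close> is a combination, with nonnegative coefficients, of its values on the rays\<close>
    have expand: "rdot u x * (rdot u0 b1 * rdot u0 b2 * (M - m)) =
        (M * rdot u0 x - rdot u1 x) * rdot u0 b2 * rdot u b1 + (rdot u1 x - m * rdot u0 x) * rdot u0 b1 * rdot u b2"
      if x: "x \<in> \<alpha>" for x
    proof -
      obtain a b where ab: "x - (a *s b1 + b *s b2) \<in> vec.span \<gamma>"
        "b * (rdot u0 b2 * (M - m)) = rdot u1 x - m * rdot u0 x"
        "a * (rdot u0 b1 * (M - m)) = M * rdot u0 x - rdot u1 x"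
        using decomp[OF vec.span_base[OF x]] by blast
      have "rdot u x = a * rdot u b1 + b * rdot u b2" using u\<gamma>[OF ab(1)] by simp
      then show ?thesis unfolding ab(2)[symmetric] ab(3)[symmetric] by (simp add: algebra_simps)
    qed
    have D: "rdot u0 b1 * rdot u0 b2 * (M - m) > 0" using b0 \<open>m < M\<close> by simp
    have ub: "0 \<le> rdot u b1" "0 \<le> rdot u b2" using u(1) b\<alpha> by auto
    have notboth: "\<not> (rdot u b1 = 0 \<and> rdot u b2 = 0)"
    proof
      assume "rdot u b1 = 0 \<and> rdot u b2 = 0"
      then have "rdot u x = 0" if "x \<in> \<alpha>" for x using expand[OF that] D by (metis add_0 less_numeral_extra(3) mult_zero_right mult_eq_0_iff)
      then have "\<beta> = \<alpha>" using u(2) by auto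
      then show False using \<beta>(3) dim by simp
    qed
    have "\<not> \<beta> \<subseteq> vec.span \<gamma>" using vec.dim_subset[of \<beta> "vec.span \<gamma>"] \<beta>(3) by auto
    then obtain x where x: "x \<in> \<beta>" "x \<notin> vec.span \<gamma>" by blast
    have x\<alpha>: "x \<in> \<alpha>" "rdot u x = 0" using x(1) u(2) by auto
    have "x \<notin> \<gamma>" using x(2) vec.span_base by blast
    then have x0: "rdot u0 x > 0" using u0(1)[OF x\<alpha>(1)] u0(2) x\<alpha>(1) by force
    have e: "(M * rdot u0 x - rdot u1 x) * rdot u0 b2 * rdot u b1 = 0"
        "(rdot u1 x - m * rdot u0 x) * rdot u0 b1 * rdot u b2 = 0"
    proof -
      have "0 \<le> (M * rdot u0 x - rdot u1 x) * rdot u0 b2 * rdot u b1"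
        "0 \<le> (rdot u1 x - m * rdot u0 x) * rdot u0 b1 * rdot u b2"
        using bounds[OF x\<alpha>(1)] b0 ub by simp_all
      moreover have "(M * rdot u0 x - rdot u1 x) * rdot u0 b2 * rdot u b1 +
          (rdot u1 x - m * rdot u0 x) * rdot u0 b1 * rdot u b2 = 0"
        unfolding expand[OF x\<alpha>(1), symmetric] x\<alpha>(2) by simp
      ultimately show "(M * rdot u0 x - rdot u1 x) * rdot u0 b2 * rdot u b1 = 0"
        "(rdot u1 x - m * rdot u0 x) * rdot u0 b1 * rdot u b2 = 0"
        by linarith+
    qed
    have "M * rdot u0 x - rdot u1 x \<noteq> 0 \<or> rdot u1 x - m * rdot u0 x \<noteq> 0"
    proof (rule ccontr)
      assume "\<not> ?thesis"
      then have "(M - m) * rdot u0 x = 0" by (simp add: algebra_simps)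
      then show False using x0 \<open>m < M\<close> by simp
    qed
    then have "rdot u b1 = 0 \<or> rdot u b2 = 0" using e b0 by auto
    then show ?thesis
    proof
      assume u1b: "rdot u b1 = 0"
      then have "rdot u b2 \<noteq> 0" using notboth by simp
      then have "rdot u x = 0 \<longleftrightarrow> rdot u1 x - m * rdot u0 x = 0" if "x \<in> \<alpha>" for x
        using expand[OF that] u1b D b0 \<open>m < M\<close> by auto
      then have "\<beta> = \<beta>1" unfolding u(2) \<beta>1_def by auto
      then show ?thesis ..
    next
      assume u2b: "rdot u b2 = 0"
      then have "rdot u b1 \<noteq> 0" using notboth by simp
      then have "rdot u x = 0 \<longleftrightarrow> M * rdot u0 x - rdot u1 x = 0" if "x \<in> \<alpha>" for x
        using expand[OF that] u2b D b0 \<open>m < M\<close> by auto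
      then have "\<beta> = \<beta>2" unfolding u(2) \<beta>2_def by auto
      then show ?thesis ..
    qed
  qed
  show ?thesis by (rule that[OF face1 face2 sub dim1 dim2 b\<beta>(1) off1 b\<beta>(2) off2 unique])
qed

section \<open>Facets of full-dimensional cones in a fan\<close>

lemma fan_polyhedral: "fan \<Sigma> \<Longrightarrow> \<sigma> \<in> \<Sigma> \<Longrightarrow> polyhedral_cone \<sigma>"
  by (simp add: fan_def)

lemma fan_finite: "fan \<Sigma> \<Longrightarrow> finite \<Sigma>"
  by (simp add: fan_def)

lemma fan_face_closed: "fan \<Sigma> \<Longrightarrow> \<sigma> \<in> \<Sigma> \<Longrightarrow> cone_face \<tau> \<sigma> \<Longrightarrow> \<tau> \<in> \<Sigma>"
  unfolding fan_def by blast

lemma fan_Int_face: "fan \<Sigma> \<Longrightarrow> \<sigma> \<in> \<Sigma> \<Longrightarrow> \<tau> \<in> \<Sigma> \<Longrightarrow> cone_face (\<sigma> \<inter> \<tau>) \<sigma>"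
  unfolding fan_def by blast

lemma fan_subset_face: "fan \<Sigma> \<Longrightarrow> \<sigma> \<in> \<Sigma> \<Longrightarrow> \<tau> \<in> \<Sigma> \<Longrightarrow> \<tau> \<subseteq> \<sigma> \<Longrightarrow> cone_face \<tau> \<sigma>"
  using fan_Int_face[of \<Sigma> \<sigma> \<tau>] by (simp add: Int_absorb1)

lemma not_boundaryI:
  assumes "0 < e" "\<And>y. (\<And>i. \<bar>y $ i - x $ i\<bar> < e) \<Longrightarrow> y \<in> A"
  shows "x \<notin> boundary_set A"
  using assms unfolding boundary_set_def by blast

lemma not_boundaryE:
  assumes "x \<in> A" "x \<notin> boundary_set A"
  obtains e where "0 < e" "\<And>y. (\<And>i. \<bar>y $ i - x $ i\<bar> < e) \<Longrightarrow> y \<in> A"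
proof -
  obtain e where e: "0 < e" "\<not> ((\<exists>y\<in>A. \<forall>i. \<bar>y $ i - x $ i\<bar> < e) \<and> (\<exists>y\<in>- A. \<forall>i. \<bar>y $ i - x $ i\<bar> < e))"
    using assms(2) unfolding boundary_set_def by blast
  moreover have "\<exists>y\<in>A. \<forall>i. \<bar>y $ i - x $ i\<bar> < e" using assms(1) e(1) by (intro bexI[of _ x]) auto
  ultimately show ?thesis using that by blast
qed

lemma not_subset_lower_dim_span:
  "vec.dim \<tau> < vec.dim \<sigma> \<Longrightarrow> \<exists>w\<in>\<sigma>. w \<notin> vec.span \<tau>"
  using vec.dim_subset[of \<sigma> "vec.span \<tau>"] by fastforce

lemma decompose_codim_one:
  fixes \<tau> :: "(rat ^ 'n::finite) set"
  assumes "CARD('n) = Suc (vec.dim \<tau>)" "w \<notin> vec.span \<tau>"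
  shows "\<exists>k. x - k *s w \<in> vec.span \<tau>"
proof -
  have "vec.dim (UNIV :: (rat ^ 'n) set) = Suc (vec.dim \<tau>)"
    using assms(1) vec_dim_card[where 'a=rat and 'n='n] by simp
  then show ?thesis
    using span_codim_one[of \<tau> UNIV w x] assms(2) by auto
qed

text \<open>
  Two full-dimensional cones on the same side of a common facet \<open>\<tau>\<close> share points \<open>z\<close> near the relative
  interior of \<open>\<tau>\<close>.  Their intersection is then a face of each of them that contains \<open>\<tau>\<close> and a point
  outside its span, so it is the whole cone.
\<close>

lemma same_side_facet_eq:
  fixes \<sigma> \<sigma>' \<tau> :: "(rat ^ 'n::finite) set"
  assumes fan: "fan \<Sigma>" "\<sigma> \<in> \<Sigma>" "\<sigma>' \<in> \<Sigma>" and dim: "CARD('n) = Suc (vec.dim \<tau>)"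
    and face: "cone_face \<tau> \<sigma>" "cone_face \<tau> \<sigma>'"
    and w: "w \<in> \<sigma>" "w' \<in> \<sigma>'" "w \<notin> vec.span \<tau>" "w' - k *s w \<in> vec.span \<tau>" "0 < k"
  shows "\<sigma> = \<sigma>'"
proof -
  have \<tau>: "\<tau> \<subseteq> \<sigma>" "\<tau> \<subseteq> \<sigma>'" using face by (auto dest: cone_face_subset)
  have poly: "polyhedral_cone \<sigma>" "polyhedral_cone \<sigma>'" "polyhedral_cone \<tau>"
    using fan_polyhedral[OF fan(1)] fan_face_closed[OF fan(1,2) face(1)] fan(2,3) by auto
  obtain p where p: "relint_point \<tau> p" by (rule relint_point_exists[OF poly(3)])
  have "k *s w - w' \<in> vec.span \<tau>" using vec.span_neg[OF w(4)] by simp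
  then obtain \<epsilon> where \<epsilon>: "0 < \<epsilon>"
    "\<And>a. (\<And>i::'n. \<bar>a i\<bar> < \<epsilon>) \<Longrightarrow> p + (\<Sum>i\<in>UNIV. a i *s (k *s w - w')) \<in> \<tau>"
    using relint_point_neighbourhood[OF p, of "\<lambda>_. k *s w - w'"] by blast
  define t where "t = of_nat CARD('n) * (\<epsilon> / 2)"
  have t: "0 < t" using \<epsilon>(1) by (simp add: t_def)
  have "p + (\<Sum>i::'n\<in>UNIV. (\<epsilon> / 2) *s (k *s w - w')) \<in> \<tau>" using \<epsilon>(1) by (intro \<epsilon>(2)) auto
  moreover have "(\<Sum>i::'n\<in>UNIV. (\<epsilon> / 2) *s (k *s w - w')) = t *s (k *s w - w')"
    by (simp add: vec.sum_constant_scale t_def del: sum_constant)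
  ultimately have 1: "p + t *s (k *s w - w') \<in> \<tau>" by simp
  define z where "z = p + (t * k) *s w"
  have "z \<in> \<sigma>" unfolding z_def
    using relint_point_mem[OF p] \<tau> w t by - (rule polyhedral_cone_add_scale[OF poly(1)], auto)
  moreover have "z = (p + t *s (k *s w - w')) + t *s w'"
    by (simp add: z_def vec.scale_right_diff_distrib)
  then have "z \<in> \<sigma>'"
    using 1 \<tau> w t by (simp only:) (rule polyhedral_cone_add_scale[OF poly(2)], auto)
  ultimately have z: "z \<in> \<sigma> \<inter> \<sigma>'" by simp
  have "\<rho> \<subseteq> \<sigma> \<inter> \<sigma>'" if \<rho>: "cone_face (\<sigma> \<inter> \<sigma>') \<rho>" for \<rho>
  proof -
    obtain u where u: "\<sigma> \<inter> \<sigma>' = {x\<in>\<rho>. rdot u x = 0}" using \<rho> unfolding cone_face_def by blast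
    have u0: "rdot u y = 0" if "y \<in> vec.span \<tau>" for y
      using u \<tau> by (intro rdot_span_zero[OF that]) blast
    have "rdot u z = 0" using u z by blast
    then have uw: "rdot u w = 0" using u0[OF vec.span_base[OF relint_point_mem[OF p]]] t w(5) by (simp add: z_def)
    have "rdot u x = 0" for x
    proof -
      obtain c where "x - c *s w \<in> vec.span \<tau>" using decompose_codim_one[OF dim w(3)] by blast
      from u0[OF this] uw show ?thesis by simp
    qed
    then show ?thesis using u by blast
  qed
  then show ?thesis
    using fan_Int_face[OF fan(1,2,3)] fan_Int_face[OF fan(1,3,2)] by (auto simp: Int_commute)
qed

text \<open>
  A third cone would be on the same side as one of the first two.  As these lie on opposite sides, a
  neighbourhood of a relative interior point \<open>p\<close> of \<open>\<tau>\<close> is contained in their union: a displacement is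
  split into a part in the span of \<open>\<tau>\<close> and a multiple of \<open>w1\<close> or, if this multiple is negative, of \<open>w2\<close>.
\<close>

lemma facet_star:
  fixes \<sigma>1 \<sigma>2 \<tau> :: "(rat ^ 'n::finite) set"
  assumes fan: "fan \<Sigma>" and \<sigma>: "\<sigma>1 \<in> cones_of_dim \<Sigma> CARD('n)" "\<sigma>2 \<in> cones_of_dim \<Sigma> CARD('n)" "\<sigma>1 \<noteq> \<sigma>2"
    and dim: "CARD('n) = Suc (vec.dim \<tau>)" and face: "cone_face \<tau> \<sigma>1" "cone_face \<tau> \<sigma>2"
  shows "{\<sigma>\<in>cones_of_dim \<Sigma> CARD('n). cone_face \<tau> \<sigma>} = {\<sigma>1, \<sigma>2}"
    and "\<not> \<tau> \<subseteq> boundary_set (\<Union>\<Sigma>)"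
    and "\<exists>u. \<exists>w1\<in>\<sigma>1. \<exists>w2\<in>\<sigma>2. rdot u w1 > 0 \<and> rdot u w2 < 0 \<and> (\<forall>x\<in>\<tau>. rdot u x = 0)"
proof -
  have in\<Sigma>: "\<sigma>1 \<in> \<Sigma>" "\<sigma>2 \<in> \<Sigma>" and dims: "vec.dim \<sigma>1 = CARD('n)" "vec.dim \<sigma>2 = CARD('n)"
    using \<sigma> by (auto simp: cones_of_dim_def)
  have \<tau>: "\<tau> \<subseteq> \<sigma>1" "\<tau> \<subseteq> \<sigma>2" "\<tau> \<in> \<Sigma>"
    using face fan_face_closed[OF fan in\<Sigma>(1)] by (auto dest: cone_face_subset)
  obtain w1 where w1: "w1 \<in> \<sigma>1" "w1 \<notin> vec.span \<tau>" using not_subset_lower_dim_span[of \<tau> \<sigma>1] dims dim by auto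
  obtain w2 where w2: "w2 \<in> \<sigma>2" "w2 \<notin> vec.span \<tau>" using not_subset_lower_dim_span[of \<tau> \<sigma>2] dims dim by auto
  obtain k where k: "w2 - k *s w1 \<in> vec.span \<tau>" using decompose_codim_one[OF dim w1(2)] by blast
  have "k \<noteq> 0" using k w2(2) by auto
  moreover have "\<not> 0 < k" using same_side_facet_eq[OF fan in\<Sigma> dim face w1(1) w2(1) w1(2) k] \<sigma>(3) by blast
  ultimately have k0: "k < 0" by simp
  show "{\<sigma>\<in>cones_of_dim \<Sigma> CARD('n). cone_face \<tau> \<sigma>} = {\<sigma>1, \<sigma>2}"
  proof (intro subset_antisym subsetI)
    fix \<sigma> assume "\<sigma> \<in> {\<sigma>\<in>cones_of_dim \<Sigma> CARD('n). cone_face \<tau> \<sigma>}"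
    then have s: "\<sigma> \<in> \<Sigma>" "vec.dim \<sigma> = CARD('n)" "cone_face \<tau> \<sigma>" by (auto simp: cones_of_dim_def)
    obtain w where w: "w \<in> \<sigma>" "w \<notin> vec.span \<tau>" using not_subset_lower_dim_span[of \<tau> \<sigma>] s dim by auto
    obtain l where l: "w - l *s w1 \<in> vec.span \<tau>" using decompose_codim_one[OF dim w1(2)] by blast
    have "l \<noteq> 0" using l w(2) by auto
    then consider "0 < l" | "l < 0" by linarith
    then show "\<sigma> \<in> {\<sigma>1, \<sigma>2}"
    proof cases
      case 1
      then show ?thesis
        using same_side_facet_eq[OF fan in\<Sigma>(1) s(1) dim face(1) s(3) w1(1) w(1) w1(2) l] by simp
    next
      case 2
      have "(w - l *s w1) - (l / k) *s (w2 - k *s w1) \<in> vec.span \<tau>"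
        by (rule vec.span_diff[OF l vec.span_scale[OF k]])
      then have "w - (l / k) *s w2 \<in> vec.span \<tau>"
        using \<open>k \<noteq> 0\<close> by (simp add: vec.scale_right_diff_distrib)
      then show ?thesis
        using same_side_facet_eq[OF fan in\<Sigma>(2) s(1) dim face(2) s(3) w2(1) w(1) w2(2)] 2 k0
        by (simp add: zero_less_divide_iff)
    qed
  qed (use \<sigma> face in auto)
  obtain u where u: "rdot u w1 = 1" "\<And>y. y \<in> \<tau> \<Longrightarrow> rdot u y = 0" using functional_exists[OF w1(2)] by blast
  have "rdot u (w2 - k *s w1) = 0" using u(2) by (rule rdot_span_zero[OF k])
  then have "rdot u w2 < 0" using u(1) k0 by simp
  then show "\<exists>u. \<exists>w1\<in>\<sigma>1. \<exists>w2\<in>\<sigma>2. rdot u w1 > 0 \<and> rdot u w2 < 0 \<and> (\<forall>x\<in>\<tau>. rdot u x = 0)"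
    using u w1 w2 by (intro exI[of _ u]) force
  have poly: "polyhedral_cone \<sigma>1" "polyhedral_cone \<sigma>2" "polyhedral_cone \<tau>"
    using fan_polyhedral[OF fan] in\<Sigma> \<tau> by auto
  obtain p where p: "relint_point \<tau> p" by (rule relint_point_exists[OF poly(3)])
  obtain c where c: "\<And>i. axis i 1 - c i *s w1 \<in> vec.span \<tau>"
  proof -
    have "\<forall>i. \<exists>k. axis i 1 - k *s w1 \<in> vec.span \<tau>" using decompose_codim_one[OF dim w1(2)] by blast
    from choice[OF this] show ?thesis using that by blast
  qed
  define g where "g i = axis i 1 - c i *s w1" for i
  define g' where "g' i = axis i 1 - (c i / k) *s w2" for i
  have g': "g' i \<in> vec.span \<tau>" for i
  proof -
    have "(axis i 1 - c i *s w1) - (c i / k) *s (w2 - k *s w1) \<in> vec.span \<tau>"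
      by (rule vec.span_diff[OF c vec.span_scale[OF k]])
    then show ?thesis using \<open>k \<noteq> 0\<close> by (simp add: g'_def vec.scale_right_diff_distrib)
  qed
  have g: "g i \<in> vec.span \<tau>" for i using c by (simp add: g_def)
  obtain \<epsilon>1 where \<epsilon>1: "0 < \<epsilon>1" "\<And>a. (\<And>i::'n. \<bar>a i\<bar> < \<epsilon>1) \<Longrightarrow> p + (\<Sum>i\<in>UNIV. a i *s g i) \<in> \<tau>"
    using relint_point_neighbourhood[OF p, of g] g by blast
  obtain \<epsilon>2 where \<epsilon>2: "0 < \<epsilon>2" "\<And>a. (\<And>i::'n. \<bar>a i\<bar> < \<epsilon>2) \<Longrightarrow> p + (\<Sum>i\<in>UNIV. a i *s g' i) \<in> \<tau>"
    using relint_point_neighbourhood[OF p, of g'] g' by blast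
  have "p \<notin> boundary_set (\<Union>\<Sigma>)"
  proof (rule not_boundaryI)
    show "0 < min \<epsilon>1 \<epsilon>2" using \<epsilon>1 \<epsilon>2 by simp
    fix y assume y: "\<And>i. \<bar>y $ i - p $ i\<bar> < min \<epsilon>1 \<epsilon>2"
    define a where "a i = y $ i - p $ i" for i
    define s where "s = (\<Sum>i\<in>UNIV. a i * c i)"
    have "y - p = (\<Sum>i\<in>UNIV. a i *s axis i 1)"
      using sum_axis[of "y - p"] by (simp add: a_def)
    then have yp: "y = p + (\<Sum>i\<in>UNIV. a i *s axis i 1)" by (simp add: algebra_simps)
    have e1: "y = (p + (\<Sum>i\<in>UNIV. a i *s g i)) + s *s w1"
      unfolding yp g_def s_def
      by (simp add: vec.scale_right_diff_distrib sum_subtractf vec.scale_sum_left)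
    have e2: "y = (p + (\<Sum>i\<in>UNIV. a i *s g' i)) + (s / k) *s w2"
      unfolding yp g'_def s_def
      by (simp add: vec.scale_right_diff_distrib sum_subtractf vec.scale_sum_left sum_divide_distrib)
    show "y \<in> \<Union>\<Sigma>"
    proof (cases "0 \<le> s")
      case True
      have "(p + (\<Sum>i\<in>UNIV. a i *s g i)) + s *s w1 \<in> \<sigma>1"
        using \<epsilon>1(2)[of a] y \<tau> w1 True
        by - (rule polyhedral_cone_add_scale[OF poly(1)], auto simp: a_def)
      then show ?thesis using in\<Sigma> e1 by auto
    next
      case False
      have "(p + (\<Sum>i\<in>UNIV. a i *s g' i)) + (s / k) *s w2 \<in> \<sigma>2"
        using \<epsilon>2(2)[of a] y \<tau> w2 False k0
        by - (rule polyhedral_cone_add_scale[OF poly(2)], auto simp: a_def zero_le_divide_iff)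
      then show ?thesis using in\<Sigma> e2 by auto
    qed
  qed
  then show "\<not> \<tau> \<subseteq> boundary_set (\<Union>\<Sigma>)" using relint_point_mem[OF p] by blast
qed

lemma full_dimensional_interior:
  fixes \<sigma> :: "(rat ^ 'n::finite) set"
  assumes "fan \<Sigma>" "\<sigma> \<in> \<Sigma>" "vec.dim \<sigma> = CARD('n)"
  shows "\<not> \<sigma> \<subseteq> boundary_set (\<Union>\<Sigma>)"
proof -
  obtain p where p: "relint_point \<sigma> p" by (rule relint_point_exists[OF fan_polyhedral[OF assms(1,2)]])
  obtain \<epsilon> where \<epsilon>: "0 < \<epsilon>" "\<And>a. (\<And>i::'n. \<bar>a i\<bar> < \<epsilon>) \<Longrightarrow> p + (\<Sum>i\<in>UNIV. a i *s axis i 1) \<in> \<sigma>"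
    using relint_point_neighbourhood[OF p, of "\<lambda>i. axis i 1"] span_eq_UNIV[OF assms(3)] by auto
  have "p \<notin> boundary_set (\<Union>\<Sigma>)"
  proof (rule not_boundaryI[OF \<epsilon>(1)])
    fix y assume y: "\<And>i. \<bar>y $ i - p $ i\<bar> < \<epsilon>"
    have "y - p = (\<Sum>i\<in>UNIV. (y $ i - p $ i) *s axis i 1)" using sum_axis[of "y - p"] by simp
    then have "y = p + (\<Sum>i\<in>UNIV. (y $ i - p $ i) *s axis i 1)" by (simp add: algebra_simps)
    moreover have "p + (\<Sum>i\<in>UNIV. (y $ i - p $ i) *s axis i 1) \<in> \<sigma>" using y by (intro \<epsilon>(2)) simp
    ultimately show "y \<in> \<Union>\<Sigma>" using assms(2) by auto
  qed
  then show ?thesis using relint_point_mem[OF p] by blast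
qed

text \<open>
  Let \<open>x\<close> be a point of \<open>\<tau>\<close> inside the support, and \<open>y\<close> a relative interior point of \<open>\<tau>\<close> near \<open>x\<close>.  On each
  side of \<open>\<tau>\<close>, the points near \<open>y\<close> lie in the support.  As there are finitely many cones and these are
  closed, some cone contains \<open>y\<close> together with a point of this side.  It meets \<open>\<tau>\<close> in a face containing
  \<open>y\<close>, hence in all of \<open>\<tau>\<close>.
\<close>

lemma interior_facet_two_cones:
  fixes \<tau> :: "(rat ^ 'n::finite) set"
  assumes fan: "fan \<Sigma>" and \<tau>: "\<tau> \<in> \<Sigma>" "CARD('n) = Suc (vec.dim \<tau>)" "\<not> \<tau> \<subseteq> boundary_set (\<Union>\<Sigma>)"
  obtains \<sigma>1 \<sigma>2 where "\<sigma>1 \<in> cones_of_dim \<Sigma> CARD('n)" "\<sigma>2 \<in> cones_of_dim \<Sigma> CARD('n)" "\<sigma>1 \<noteq> \<sigma>2"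
    "cone_face \<tau> \<sigma>1" "cone_face \<tau> \<sigma>2"
proof -
  have poly: "polyhedral_cone \<tau>" using fan_polyhedral[OF fan \<tau>(1)] .
  obtain x where x: "x \<in> \<tau>" "x \<notin> boundary_set (\<Union>\<Sigma>)" using \<tau>(3) by blast
  obtain e where e: "0 < e" "\<And>y. (\<And>i. \<bar>y $ i - x $ i\<bar> < e) \<Longrightarrow> y \<in> \<Union>\<Sigma>"
    using not_boundaryE[of x "\<Union>\<Sigma>"] x \<tau>(1) by blast
  obtain p where rp: "relint_point \<tau> p" by (rule relint_point_exists[OF poly])
  note p = relint_point_mem[OF rp]
  have "vec.span \<tau> \<noteq> UNIV"
    using \<tau>(2) by (metis n_not_Suc_n vec.dim_span vec_dim_card)
  then obtain w where w: "w \<notin> vec.span \<tau>" by blast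
  define M where "M = (\<Sum>i\<in>UNIV. \<bar>p $ i\<bar>) + (\<Sum>i\<in>UNIV. \<bar>w $ i\<bar>) + 1"
  have M: "\<bar>p $ i\<bar> \<le> M" "\<bar>w $ i\<bar> \<le> M" "0 < M" for i
  proof -
    have "0 \<le> (\<Sum>i\<in>UNIV. \<bar>p $ i\<bar>)" "0 \<le> (\<Sum>i\<in>UNIV. \<bar>w $ i\<bar>)" by (auto intro: sum_nonneg)
    moreover have "\<bar>p $ i\<bar> \<le> (\<Sum>i\<in>UNIV. \<bar>p $ i\<bar>)" "\<bar>w $ i\<bar> \<le> (\<Sum>i\<in>UNIV. \<bar>w $ i\<bar>)"
      by (rule member_le_sum; simp)+
    ultimately show "\<bar>p $ i\<bar> \<le> M" "\<bar>w $ i\<bar> \<le> M" "0 < M" by (auto simp: M_def)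
  qed
  define \<delta> where "\<delta> = e / (2 * M)"
  have \<delta>: "0 < \<delta>" using e(1) M(3) by (simp add: \<delta>_def)
  define y where "y = x + \<delta> *s p"
  have y\<tau>: "y \<in> \<tau>" unfolding y_def
    using x(1) p \<delta> by - (rule polyhedral_cone_add_scale[OF poly], auto)
  have near: "y + t *s v \<in> \<Union>\<Sigma>" if t: "0 < t" "t < \<delta>" and v: "\<And>i. \<bar>v $ i\<bar> \<le> M" for t v
  proof (rule e(2))
    fix i
    have "\<bar>(y + t *s v) $ i - x $ i\<bar> = \<bar>\<delta> * p $ i + t * v $ i\<bar>" by (simp add: y_def)
    also have "\<dots> \<le> \<bar>\<delta> * p $ i\<bar> + \<bar>t * v $ i\<bar>" by (rule abs_triangle_ineq)
    also have "\<dots> \<le> \<delta> * M + t * M"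
      using \<delta> t M(1)[of i] v[of i] by (intro add_mono) (auto simp: abs_mult)
    also have "\<dots> < \<delta> * M + \<delta> * M" using t(2) M(3) by simp
    also have "\<dots> = e" using M(3) by (simp add: \<delta>_def field_simps)
    finally show "\<bar>(y + t *s v) $ i - x $ i\<bar> < e" .
  qed
  have cone: "\<exists>\<rho> t. \<rho> \<in> cones_of_dim \<Sigma> CARD('n) \<and> cone_face \<tau> \<rho> \<and> 0 < t \<and> y + t *s v \<in> \<rho>"
    if v: "\<And>i. \<bar>v $ i\<bar> \<le> M" "v \<notin> vec.span \<tau>" for v
  proof -
    obtain \<rho> t where \<rho>: "\<rho> \<in> \<Sigma>" "y \<in> \<rho>" "0 < t" "y + t *s v \<in> \<rho>"
      by (rule finite_cones_closed[OF fan_finite[OF fan] fan_polyhedral[OF fan] near[OF _ _ v(1)] \<delta>])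
    obtain u where u: "\<And>x. x \<in> \<tau> \<Longrightarrow> 0 \<le> rdot u x" "\<tau> \<inter> \<rho> = {x\<in>\<tau>. rdot u x = 0}"
      using fan_Int_face[OF fan \<tau>(1) \<rho>(1)] unfolding cone_face_def by blast
    have "rdot u y = 0" using u(2) y\<tau> \<rho>(2) by blast
    then have "rdot u x + \<delta> * rdot u p = 0" by (simp add: y_def)
    then have "\<delta> * rdot u p = 0"
      using u(1)[OF x(1)] u(1)[OF p] \<delta> by (metis add_nonneg_eq_0_iff less_imp_le mult_nonneg_nonneg)
    then have "rdot u p = 0" using \<delta> by simp
    then have "\<forall>x\<in>\<tau>. rdot u x = 0" using relint_point_functional[OF rp, of u] u(1) by blast
    then have sub: "\<tau> \<subseteq> \<rho>" using u(2) by blast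
    have "(1 / t) *s ((y + t *s v) - y) \<in> vec.span \<rho>"
      using \<rho> by (intro vec.span_scale vec.span_diff) (auto intro: vec.span_base)
    then have v\<rho>: "v \<in> vec.span \<rho>" using \<rho>(3) by simp
    have "vec.dim (insert v \<tau>) \<le> vec.dim (vec.span \<rho>)"
      using v\<rho> sub vec.span_superset[of \<rho>] by (intro vec.dim_subset) auto
    then have "CARD('n) \<le> vec.dim \<rho>" using v(2) \<tau>(2) by (simp add: vec.dim_insert)
    moreover have "vec.dim \<rho> \<le> CARD('n)"
      using vec.dim_subset[of \<rho> UNIV] vec_dim_card[where 'a=rat and 'n='n] by simp
    ultimately have "\<rho> \<in> cones_of_dim \<Sigma> CARD('n)" using \<rho>(1) by (simp add: cones_of_dim_def)
    then show ?thesis using fan_subset_face[OF fan \<rho>(1) \<tau>(1) sub] \<rho> by blast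
  qed
  obtain \<sigma>1 t1 where s1: "\<sigma>1 \<in> cones_of_dim \<Sigma> CARD('n)" "cone_face \<tau> \<sigma>1" "0 < t1" "y + t1 *s w \<in> \<sigma>1"
    using cone[of w] M(2) w by blast
  have "- w \<notin> vec.span \<tau>" using w vec.span_neg[of "- w" \<tau>] by auto
  then obtain \<sigma>2 t2 where s2: "\<sigma>2 \<in> cones_of_dim \<Sigma> CARD('n)" "cone_face \<tau> \<sigma>2" "0 < t2" "y + t2 *s - w \<in> \<sigma>2"
    using cone[of "- w"] M(2) by auto
  have "\<sigma>1 \<noteq> \<sigma>2"
  proof
    assume eq: "\<sigma>1 = \<sigma>2"
    obtain u where u: "\<And>x. x \<in> \<sigma>1 \<Longrightarrow> 0 \<le> rdot u x" "\<tau> = {x\<in>\<sigma>1. rdot u x = 0}"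
      using s1(2) unfolding cone_face_def by blast
    have uy: "rdot u y = 0" using y\<tau> u(2) by blast
    have "0 \<le> t1 * rdot u w" "0 \<le> t2 * rdot u (- w)" using u(1)[OF s1(4)] u(1)[of "y + t2 *s - w"] s2(4) eq uy by simp_all
    then have "rdot u w = 0" using s1(3) s2(3) by (simp add: zero_le_mult_iff mult_le_0_iff)
    then have "y + t1 *s w \<in> \<tau>" using uy s1(4) u(2) by simp
    then have "(1 / t1) *s ((y + t1 *s w) - y) \<in> vec.span \<tau>"
      using y\<tau> by (intro vec.span_scale vec.span_diff) (auto intro: vec.span_base)
    then show False using w s1(3) by simp
  qed
  then show ?thesis using that s1 s2 by blast
qed

section \<open>Modules as subquotients\<close>

text \<open>
  The map \<open>q\<close> induces an isomorphism from \<open>Z / K\<close> to the module \<open>M\<close>, where \<open>Z\<close> and \<open>K\<close> are submodules of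
  a type.  The laws of an abelian group for \<open>M\<close> follow from surjectivity of \<open>q\<close>, so \<open>M\<close> may be any record
  with the right operations on its carrier.
\<close>

locale presentation = Modules.module s for s :: "'n::finite mpoly \<Rightarrow> 'z::ab_group_add \<Rightarrow> 'z" +
  fixes Z K :: "'z set" and M :: "('n mpoly, 'b, 'm) module_scheme" and q :: "'z \<Rightarrow> 'b"
  assumes sub: "subspace Z" "subspace K" "K \<subseteq> Z"
    and surj: "carrier M = q ` Z"
    and add: "\<And>a b. a \<in> Z \<Longrightarrow> b \<in> Z \<Longrightarrow> q (a + b) = q a \<oplus>\<^bsub>M\<^esub> q b"
    and zero: "q 0 = \<zero>\<^bsub>M\<^esub>"
    and smult: "\<And>r a. a \<in> Z \<Longrightarrow> q (s r a) = r \<odot>\<^bsub>M\<^esub> q a"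
    and kernel: "\<And>a b. a \<in> Z \<Longrightarrow> b \<in> Z \<Longrightarrow> q a = q b \<longleftrightarrow> a - b \<in> K"
begin

lemma abelian_monoid: "abelian_monoid M"
proof (rule abelian_monoidI)
  show "\<zero>\<^bsub>M\<^esub> \<in> carrier M" using subspace_0[OF sub(1)] by (metis imageI surj zero)
  fix x y z assume "x \<in> carrier M" "y \<in> carrier M" "z \<in> carrier M"
  then obtain a b c where abc: "a \<in> Z" "b \<in> Z" "c \<in> Z" "x = q a" "y = q b" "z = q c"
    unfolding surj by blast
  have ab: "a + b \<in> Z" "b + c \<in> Z" using subspace_add[OF sub(1)] abc by auto
  show "x \<oplus>\<^bsub>M\<^esub> y \<in> carrier M" using abc ab(1) by (metis add imageI surj)
  show "(x \<oplus>\<^bsub>M\<^esub> y) \<oplus>\<^bsub>M\<^esub> z = x \<oplus>\<^bsub>M\<^esub> (y \<oplus>\<^bsub>M\<^esub> z)"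
    using abc ab by (simp add: add[symmetric] add.assoc)
  show "x \<oplus>\<^bsub>M\<^esub> y = y \<oplus>\<^bsub>M\<^esub> x" using abc by (simp add: add[symmetric] add.commute)
  show "\<zero>\<^bsub>M\<^esub> \<oplus>\<^bsub>M\<^esub> x = x"
    using abc(1,4) add[of 0 a] subspace_0[OF sub(1)] by (simp add: zero)
qed

lemma q_closed: "a \<in> Z \<Longrightarrow> q a \<in> carrier M"
  by (simp add: surj)

lemma finsum_q:
  assumes "finite I" "\<And>i. i \<in> I \<Longrightarrow> g i \<in> Z" "\<And>i. i \<in> I \<Longrightarrow> f i = q (g i)"
  shows "(\<Oplus>\<^bsub>M\<^esub>i\<in>I. f i) = q (\<Sum>i\<in>I. g i)"
proof -
  interpret M: abelian_monoid M by (rule abelian_monoid)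
  show ?thesis using assms
  proof (induction I rule: finite_induct)
    case empty
    show "(\<Oplus>\<^bsub>M\<^esub>i\<in>{}. f i) = q (\<Sum>i\<in>{}. g i)" by (simp add: zero)
  next
    case (insert i I)
    have I: "(\<Sum>i\<in>I. g i) \<in> Z" using insert.prems(1) by (intro subspace_sum[OF sub(1)]) simp
    have "(\<Oplus>\<^bsub>M\<^esub>i\<in>insert i I. f i) = f i \<oplus>\<^bsub>M\<^esub> (\<Oplus>\<^bsub>M\<^esub>i\<in>I. f i)"
      using insert.hyps insert.prems by (intro M.finsum_insert) (auto simp: q_closed)
    also have "\<dots> = q (g i) \<oplus>\<^bsub>M\<^esub> q (\<Sum>i\<in>I. g i)" using insert by simp
    also have "\<dots> = q (\<Sum>i\<in>insert i I. g i)"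
      using insert.hyps insert.prems(1) I by (simp add: add)
    finally show "(\<Oplus>\<^bsub>M\<^esub>i\<in>insert i I. f i) = q (\<Sum>i\<in>insert i I. g i)" .
  qed
qed

lemma zero_module_kernel:
  assumes "zero_module M"
  shows "Z \<subseteq> K"
proof
  fix z assume z: "z \<in> Z"
  then have "q z = q 0" using assms q_closed[OF z] by (simp add: zero_module_def zero)
  then show "z \<in> K" using kernel[OF z subspace_0[OF sub(1)]] by simp
qed

text \<open>
  The preimage of \<open>(f\<^sub>1, \<dots>, f\<^sub>n) M\<close> under \<open>q\<close>.
\<close>

definition list_times :: "'n mpoly list \<Rightarrow> 'z set" where
  "list_times fs = {k + (\<Sum>i<length fs. s (fs ! i) (y i)) | k y. k \<in> K \<and> (\<forall>i. y i \<in> Z)}"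

lemma q_mem_list_times:
  assumes z: "z \<in> Z"
  shows "q z \<in> list_times_module M fs \<longleftrightarrow> z \<in> list_times fs"
proof -
  have sum: "(\<Sum>i<length fs. s (fs ! i) (y i)) \<in> Z" if "\<And>i. i < length fs \<Longrightarrow> y i \<in> Z" for y
    using that by (intro subspace_sum[OF sub(1)] subspace_scale[OF sub(1)]) auto
  have fin: "(\<Oplus>\<^bsub>M\<^esub>k\<in>{..<length fs}. fs ! k \<odot>\<^bsub>M\<^esub> x k) = q (\<Sum>i<length fs. s (fs ! i) (y i))"
    if "\<And>i. i < length fs \<Longrightarrow> y i \<in> Z" "\<And>i. i < length fs \<Longrightarrow> x i = q (y i)" for x y
    using that by (intro finsum_q) (auto simp: smult intro: subspace_scale[OF sub(1)])
  show ?thesis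
  proof
    assume "q z \<in> list_times_module M fs"
    then obtain x where x: "q z = (\<Oplus>\<^bsub>M\<^esub>k\<in>{..<length fs}. fs ! k \<odot>\<^bsub>M\<^esub> x k)" "x \<in> {..<length fs} \<rightarrow> carrier M"
      unfolding list_times_module_def by blast
    have "\<forall>i. \<exists>a. a \<in> Z \<and> (i < length fs \<longrightarrow> x i = q a)"
      using x(2) subspace_0[OF sub(1)] unfolding surj by blast
    from choice[OF this] obtain y where y: "\<And>i. y i \<in> Z" "\<And>i. i < length fs \<Longrightarrow> x i = q (y i)" by blast
    have "q z = q (\<Sum>i<length fs. s (fs ! i) (y i))" using x(1) fin[OF y] by simp
    then have "z - (\<Sum>i<length fs. s (fs ! i) (y i)) \<in> K" using kernel[OF z sum[OF y(1)]] by simp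
    then show "z \<in> list_times fs"
      unfolding list_times_def using y(1)
      by (intro CollectI exI[of _ "z - (\<Sum>i<length fs. s (fs ! i) (y i))"] exI[of _ y]) simp
  next
    assume "z \<in> list_times fs"
    then obtain k y where ky: "z = k + (\<Sum>i<length fs. s (fs ! i) (y i))" "k \<in> K" "\<And>i. y i \<in> Z"
      unfolding list_times_def by blast
    have "q z = q (\<Sum>i<length fs. s (fs ! i) (y i))"
      using kernel[OF z sum[OF ky(3)]] ky(1,2) by simp
    also have "\<dots> = (\<Oplus>\<^bsub>M\<^esub>k\<in>{..<length fs}. fs ! k \<odot>\<^bsub>M\<^esub> q (y k))"
      using fin[of y "\<lambda>i. q (y i)"] ky(3) by simp
    finally show "q z \<in> list_times_module M fs"
      unfolding list_times_module_def using ky(3) q_closed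
      by (intro CollectI exI[of _ "\<lambda>i. q (y i)"]) auto
  qed
qed

lemma list_times_Nil: "list_times [] = K"
  unfolding list_times_def using subspace_0[OF sub(1)] by auto

lemma list_times_snoc: "list_times (fs @ [f]) = {l + s f y | l y. l \<in> list_times fs \<and> y \<in> Z}"
proof (intro subset_antisym subsetI)
  fix z assume "z \<in> list_times (fs @ [f])"
  then obtain k y where ky: "z = k + (\<Sum>i<length (fs @ [f]). s ((fs @ [f]) ! i) (y i))" "k \<in> K" "\<And>i. y i \<in> Z"
    unfolding list_times_def by blast
  have "z = (k + (\<Sum>i<length fs. s (fs ! i) (y i))) + s f (y (length fs))"
    by (simp add: ky(1) nth_append add.assoc)
  moreover have "k + (\<Sum>i<length fs. s (fs ! i) (y i)) \<in> list_times fs"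
    unfolding list_times_def using ky by blast
  ultimately show "z \<in> {l + s f y | l y. l \<in> list_times fs \<and> y \<in> Z}" using ky(3) by blast
next
  fix z assume "z \<in> {l + s f y | l y. l \<in> list_times fs \<and> y \<in> Z}"
  then obtain l x where l: "z = l + s f x" "l \<in> list_times fs" "x \<in> Z" by blast
  then obtain k y where ky: "l = k + (\<Sum>i<length fs. s (fs ! i) (y i))" "k \<in> K" "\<And>i. y i \<in> Z"
    unfolding list_times_def by blast
  define y' where "y' = y(length fs := x)"
  have "z = k + (\<Sum>i<length (fs @ [f]). s ((fs @ [f]) ! i) (y' i))"
    by (simp add: l(1) ky(1) y'_def nth_append add.assoc)
  moreover have "y' i \<in> Z" for i using ky(3) l(3) by (simp add: y'_def)
  ultimately show "z \<in> list_times (fs @ [f])"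
    unfolding list_times_def using ky(2) by blast
qed

end

text \<open>
  By \<open>list_times_snoc\<close>, the submodules \<open>(f\<^sub>1, \<dots>, f\<^sub>j) M\<close> in the definition of a regular sequence correspond
  to the successive enlargements of \<open>K\<close>.
\<close>

lemma (in presentation) regular_sequence_regular_on:
  assumes "koszul s" "regular_sequence poly_ring M fs"
  shows "koszul.regular_on s Z K fs"
proof -
  interpret koszul s var_poly by (rule assms(1))
  have step: "y \<in> list_times (take j fs)"
    if "j < length fs" "y \<in> Z" "s (fs ! j) y \<in> list_times (take j fs)" for j y
  proof -
    have "fs ! j \<odot>\<^bsub>M\<^esub> q y \<in> list_times_module M (take j fs)"
      using that q_mem_list_times[OF subspace_scale[OF sub(1) that(2)]] by (simp add: smult)
    then have "q y \<in> list_times_module M (take j fs)"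
      using assms(2) that q_closed unfolding regular_sequence_def by blast
    then show ?thesis using q_mem_list_times[OF that(2)] by simp
  qed
  have "regular_on Z (list_times gs) hs" if "gs @ hs = fs" for gs hs
    using that
  proof (induction hs arbitrary: gs)
    case (Cons h hs)
    then have fs: "fs = gs @ h # hs" by simp
    have "regular_on Z (list_times (gs @ [h])) hs" using Cons by simp
    moreover have "\<forall>y\<in>Z. s h y \<in> list_times gs \<longrightarrow> y \<in> list_times gs"
      using step[of "length gs"] by (simp add: fs)
    ultimately show ?case by (simp add: list_times_snoc)
  qed simp
  then show ?thesis using list_times_Nil by (metis append_Nil)
qed

lemma presentation_quot_module:
  assumes "presentation s Z K M q"
    and B: "Modules.module.subspace s B" "K \<subseteq> B" "B \<subseteq> Z" and N: "N = q ` B"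
  shows "presentation s Z B (quot_module M N) (\<lambda>z. N +>\<^bsub>M\<^esub> q z)"
proof -
  interpret presentation s Z K M q by (rule assms(1))
  have coset: "N +>\<^bsub>M\<^esub> q z = q ` {y\<in>Z. y - z \<in> B}" if z: "z \<in> Z" for z
  proof -
    have "N +>\<^bsub>M\<^esub> q z = {q b \<oplus>\<^bsub>M\<^esub> q z | b. b \<in> B}"
      by (auto simp: a_r_coset_def' N)
    also have "\<dots> = (\<lambda>b. q b \<oplus>\<^bsub>M\<^esub> q z) ` B" by blast
    also have "\<dots> = (\<lambda>b. q (b + z)) ` B" using z B(3) by (intro image_cong) (auto simp: add)
    also have "\<dots> = {q (b + z) | b. b \<in> B}" by blast
    also have "\<dots> = q ` {y\<in>Z. y - z \<in> B}"
    proof (intro subset_antisym subsetI)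
      fix x assume "x \<in> {q (b + z) | b. b \<in> B}"
      then obtain b where b: "x = q (b + z)" "b \<in> B" by blast
      then have "b + z \<in> Z" using subspace_add[OF sub(1)] B(3) z by blast
      then show "x \<in> q ` {y\<in>Z. y - z \<in> B}" using b by (intro image_eqI[of _ _ "b + z"]) simp_all
    next
      fix x assume "x \<in> q ` {y\<in>Z. y - z \<in> B}"
      then obtain y where y: "x = q y" "y - z \<in> B" by blast
      then show "x \<in> {q (b + z) | b. b \<in> B}" by (intro CollectI exI[of _ "y - z"]) simp
    qed
    finally show ?thesis .
  qed
  have coset_eq: "N +>\<^bsub>M\<^esub> q a = N +>\<^bsub>M\<^esub> q b" if ab: "a \<in> Z" "b \<in> Z" "a - b \<in> B" for a b
  proof -
    have "y - a \<in> B \<longleftrightarrow> y - b \<in> B" for y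
      using subspace_add[OF B(1) _ ab(3), of "y - a"] subspace_diff[OF B(1) _ ab(3), of "y - b"] by auto
    then show ?thesis using ab by (simp add: coset)
  qed
  show ?thesis
  proof (unfold_locales)
    show "subspace Z" "subspace B" "B \<subseteq> Z" by (rule sub B)+
    show "carrier (quot_module M N) = (\<lambda>z. N +>\<^bsub>M\<^esub> q z) ` Z"
      by (auto simp: quot_module_def A_RCOSETS_def' surj)
    show "N +>\<^bsub>M\<^esub> q 0 = \<zero>\<^bsub>quot_module M N\<^esub>"
    proof -
      have "{y\<in>Z. y - 0 \<in> B} = B" using B(3) by auto
      then show ?thesis unfolding coset[OF subspace_0[OF sub(1)]] by (simp add: quot_module_def N)
    qed
    show "N +>\<^bsub>M\<^esub> q a = N +>\<^bsub>M\<^esub> q b \<longleftrightarrow> a - b \<in> B" if ab: "a \<in> Z" "b \<in> Z" for a b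
    proof
      assume "N +>\<^bsub>M\<^esub> q a = N +>\<^bsub>M\<^esub> q b"
      then have "q a \<in> q ` {y\<in>Z. y - b \<in> B}"
        using ab coset subspace_0[OF B(1)] by auto
      then obtain y where y: "q a = q y" "y \<in> Z" "y - b \<in> B" by blast
      then have "a - y \<in> B" using kernel ab(1) B(2) by blast
      then show "a - b \<in> B" using subspace_add[OF B(1) _ y(3), of "a - y"] by simp
    qed (use coset_eq ab in blast)
    show "N +>\<^bsub>M\<^esub> q (a + b) = (N +>\<^bsub>M\<^esub> q a) \<oplus>\<^bsub>quot_module M N\<^esub> (N +>\<^bsub>M\<^esub> q b)"
      if ab: "a \<in> Z" "b \<in> Z" for a b
    proof -
      have abZ: "a + b \<in> Z" using subspace_add[OF sub(1)] ab by blast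
      have "(N +>\<^bsub>M\<^esub> q a) \<oplus>\<^bsub>quot_module M N\<^esub> (N +>\<^bsub>M\<^esub> q b) =
          {q y \<oplus>\<^bsub>M\<^esub> q y' | y y'. y \<in> Z \<and> y - a \<in> B \<and> y' \<in> Z \<and> y' - b \<in> B}"
        by (auto simp: quot_module_def set_add_def' coset ab)
      also have "\<dots> = {q (y + y') | y y'. y \<in> Z \<and> y - a \<in> B \<and> y' \<in> Z \<and> y' - b \<in> B}"
        by (metis (no_types, lifting) add)
      also have "\<dots> = q ` {y\<in>Z. y - (a + b) \<in> B}"
      proof (intro subset_antisym subsetI)
        fix x assume "x \<in> {q (y + y') | y y'. y \<in> Z \<and> y - a \<in> B \<and> y' \<in> Z \<and> y' - b \<in> B}"
        then obtain y y' where y: "x = q (y + y')" "y \<in> Z" "y - a \<in> B" "y' \<in> Z" "y' - b \<in> B" by blast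
        have "(y - a) + (y' - b) \<in> B" using subspace_add[OF B(1)] y by blast
        then have "y + y' - (a + b) \<in> B" by (simp add: algebra_simps)
        moreover have "y + y' \<in> Z" using subspace_add[OF sub(1)] y by blast
        ultimately show "x \<in> q ` {y\<in>Z. y - (a + b) \<in> B}" using y(1) by blast
      next
        fix x assume "x \<in> q ` {y\<in>Z. y - (a + b) \<in> B}"
        then obtain y where y: "x = q y" "y \<in> Z" "y - (a + b) \<in> B" by blast
        have "x = q ((y - b) + b) \<and> y - b \<in> Z \<and> (y - b) - a \<in> B \<and> b \<in> Z \<and> b - b \<in> B"
          using y ab subspace_diff[OF sub(1)] subspace_0[OF B(1)] by (simp add: algebra_simps)
        then show "x \<in> {q (y + y') | y y'. y \<in> Z \<and> y - a \<in> B \<and> y' \<in> Z \<and> y' - b \<in> B}" by blast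
      qed
      finally show ?thesis by (simp add: coset[OF abZ])
    qed
    show "N +>\<^bsub>M\<^esub> q (s r a) = r \<odot>\<^bsub>quot_module M N\<^esub> (N +>\<^bsub>M\<^esub> q a)" if a: "a \<in> Z" for r a
    proof -
      have eq: "N +>\<^bsub>M\<^esub> (r \<odot>\<^bsub>M\<^esub> q y) = N +>\<^bsub>M\<^esub> q (s r a)" if y: "y \<in> Z" "y - a \<in> B" for y
      proof -
        have "s r y - s r a \<in> B" using subspace_scale[OF B(1) y(2), of r] by (simp add: scale_right_diff_distrib)
        then show ?thesis
          using coset_eq[OF subspace_scale[OF sub(1) y(1)] subspace_scale[OF sub(1) a]] smult[OF y(1)] by metis
      qed
      have ne: "a \<in> {y\<in>Z. y - a \<in> B}" using a subspace_0[OF B(1)] by simp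
      have "r \<odot>\<^bsub>quot_module M N\<^esub> (N +>\<^bsub>M\<^esub> q a) = (\<Union>y\<in>{y\<in>Z. y - a \<in> B}. N +>\<^bsub>M\<^esub> (r \<odot>\<^bsub>M\<^esub> q y))"
        by (simp add: quot_module_def coset[OF a])
      also have "\<dots> = (\<Union>y\<in>{y\<in>Z. y - a \<in> B}. N +>\<^bsub>M\<^esub> q (s r a))" using eq by (intro SUP_cong) auto
      also have "\<dots> = N +>\<^bsub>M\<^esub> q (s r a)" using ne by blast
      finally show ?thesis by simp
    qed
  qed
qed

lemma presentation_subcarrier:
  assumes "presentation s Z K M q" "Modules.module.subspace s Z'" "K \<subseteq> Z'" "Z' \<subseteq> Z" "C = q ` Z'"
  shows "presentation s Z' K (M\<lparr>carrier := C\<rparr>) q"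
proof -
  interpret presentation s Z K M q by (rule assms(1))
  show ?thesis
    using assms(2-) sub add zero smult kernel by unfold_locales (simp_all add: subset_iff)
qed

lemma presentation_ring: "presentation (*) UNIV {0} (ring_as_module poly_ring) (\<lambda>p :: 'n::finite mpoly. p)"
  by unfold_locales (simp_all add: ring_as_module_def poly_ring_def)

lemma presentation_direct_sum:
  fixes A :: "'i set" and q :: "'i \<Rightarrow> 'n::finite mpoly \<Rightarrow> 'b"
  assumes "\<And>a. a \<in> A \<Longrightarrow> presentation (*) UNIV (I a) (M a) (q a)"
  shows "presentation fscale {f. \<forall>a. a \<notin> A \<longrightarrow> f a = 0} {f. \<forall>a. (a \<in> A \<longrightarrow> f a \<in> I a) \<and> (a \<notin> A \<longrightarrow> f a = 0)}
    (direct_sum_module A M) (\<lambda>f. \<lambda>a\<in>A. q a (f a))"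
proof unfold_locales
  note P = assms[unfolded presentation_def presentation_axioms_def]
  have subI: "ring_mod.subspace (I a)" if "a \<in> A" for a using P[OF that] by blast
  show "fun_mod.subspace {f. \<forall>a. a \<notin> A \<longrightarrow> f a = 0}"
    by (rule fun_mod.subspaceI) auto
  show "fun_mod.subspace {f. \<forall>a. (a \<in> A \<longrightarrow> f a \<in> I a) \<and> (a \<notin> A \<longrightarrow> f a = 0)}"
    using ring_mod.subspace_0[OF subI] ring_mod.subspace_add[OF subI] ring_mod.subspace_scale[OF subI]
    by (intro fun_mod.subspaceI) auto
  show "{f. \<forall>a. (a \<in> A \<longrightarrow> f a \<in> I a) \<and> (a \<notin> A \<longrightarrow> f a = 0)} \<subseteq> {f. \<forall>a. a \<notin> A \<longrightarrow> f a = 0}" by auto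
  show "carrier (direct_sum_module A M) = (\<lambda>f. \<lambda>a\<in>A. q a (f a)) ` {f. \<forall>a. a \<notin> A \<longrightarrow> f a = 0}"
  proof (intro subset_antisym subsetI)
    fix g assume "g \<in> carrier (direct_sum_module A M)"
    then have g: "g \<in> (\<Pi>\<^sub>E a\<in>A. carrier (M a))" by (simp add: direct_sum_module_def)
    have "\<forall>a. \<exists>p. (a \<in> A \<longrightarrow> g a = q a p) \<and> (a \<notin> A \<longrightarrow> p = 0)"
    proof
      fix a show "\<exists>p. (a \<in> A \<longrightarrow> g a = q a p) \<and> (a \<notin> A \<longrightarrow> p = 0)"
      proof (cases "a \<in> A")
        case True
        then have "g a \<in> q a ` UNIV" using PiE_mem[OF g True] P[OF True] by blast
        then show ?thesis using True by blast
      qed simp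
    qed
    from choice[OF this] obtain f where f: "\<And>a. a \<in> A \<Longrightarrow> g a = q a (f a)" "\<And>a. a \<notin> A \<Longrightarrow> f a = 0" by blast
    have "g = (\<lambda>a\<in>A. q a (f a))" using f(1) PiE_arb[OF g] by (auto simp: fun_eq_iff restrict_def)
    then show "g \<in> (\<lambda>f. \<lambda>a\<in>A. q a (f a)) ` {f. \<forall>a. a \<notin> A \<longrightarrow> f a = 0}" using f(2) by blast
  next
    fix g assume "g \<in> (\<lambda>f. \<lambda>a\<in>A. q a (f a)) ` {f. \<forall>a. a \<notin> A \<longrightarrow> f a = 0}"
    moreover have "q a p \<in> carrier (M a)" if "a \<in> A" for a p using P[OF that] by blast
    ultimately show "g \<in> carrier (direct_sum_module A M)" by (auto simp: direct_sum_module_def)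
  qed
  have "q a 0 = \<zero>\<^bsub>M a\<^esub>" if "a \<in> A" for a using P[OF that] by blast
  then show "(\<lambda>a\<in>A. q a ((0 :: 'i \<Rightarrow> 'n mpoly) a)) = \<zero>\<^bsub>direct_sum_module A M\<^esub>"
    by (auto simp: direct_sum_module_def fun_eq_iff restrict_def)
  fix f g :: "'i \<Rightarrow> 'n mpoly"
  have "q a (p + p') = q a p \<oplus>\<^bsub>M a\<^esub> q a p'" if "a \<in> A" for a p p' using P[OF that] by blast
  then show "(\<lambda>a\<in>A. q a ((f + g) a)) = (\<lambda>a\<in>A. q a (f a)) \<oplus>\<^bsub>direct_sum_module A M\<^esub> (\<lambda>a\<in>A. q a (g a))"
    by (auto simp: direct_sum_module_def fun_eq_iff restrict_def)
  have "q a (r * p) = r \<odot>\<^bsub>M a\<^esub> q a p" if "a \<in> A" for a r p using P[OF that] by blast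
  then show "(\<lambda>a\<in>A. q a (fscale r f a)) = r \<odot>\<^bsub>direct_sum_module A M\<^esub> (\<lambda>a\<in>A. q a (f a))" for r
    by (auto simp: direct_sum_module_def fun_eq_iff restrict_def)
  assume fg: "f \<in> {f. \<forall>a. a \<notin> A \<longrightarrow> f a = 0}" "g \<in> {f. \<forall>a. a \<notin> A \<longrightarrow> f a = 0}"
  have ker: "q a p = q a p' \<longleftrightarrow> p - p' \<in> I a" if "a \<in> A" for a p p' using P[OF that] by blast
  have "(\<lambda>a\<in>A. q a (f a)) = (\<lambda>a\<in>A. q a (g a)) \<longleftrightarrow> (\<forall>a\<in>A. q a (f a) = q a (g a))"
    by (auto simp: fun_eq_iff restrict_def)
  also have "\<dots> \<longleftrightarrow> (\<forall>a\<in>A. f a - g a \<in> I a)" using ker by blast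
  finally show "(\<lambda>a\<in>A. q a (f a)) = (\<lambda>a\<in>A. q a (g a)) \<longleftrightarrow>
      f - g \<in> {f. \<forall>a. (a \<in> A \<longrightarrow> f a \<in> I a) \<and> (a \<notin> A \<longrightarrow> f a = 0)}"
    using fg by auto
qed

lemma (in presentation) free_moduleI:
  assumes K0: "K = {0}" and B: "B \<subseteq> Z" "Z \<subseteq> span B" "independent B"
  shows "free_module poly_ring M"
proof -
  have inj: "a = b" if "q a = q b" "a \<in> Z" "b \<in> Z" for a b
    using kernel[OF that(2,3)] that(1) K0 by simp
  have injB: "inj_on q B" using inj B(1) by (intro inj_onI) blast
  have comb: "(\<Oplus>\<^bsub>M\<^esub>b\<in>q ` T. c b \<odot>\<^bsub>M\<^esub> b) = q (\<Sum>v\<in>T. s (c (q v)) v)"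
    if T: "finite T" "T \<subseteq> B" for T c
  proof -
    have "inj_on q T" using injB T(2) by (rule inj_on_subset)
    then have bij: "the_inv_into T q (q v) = v" if "v \<in> T" for v using that by (rule the_inv_into_f_f)
    have "(\<Oplus>\<^bsub>M\<^esub>b\<in>q ` T. c b \<odot>\<^bsub>M\<^esub> b) = q (\<Sum>b\<in>q ` T. s (c b) (the_inv_into T q b))"
      using T B(1) by (intro finsum_q) (auto simp: bij smult intro!: subspace_scale[OF sub(1)])
    also have "(\<Sum>b\<in>q ` T. s (c b) (the_inv_into T q b)) = (\<Sum>v\<in>T. s (c (q v)) v)"
      using \<open>inj_on q T\<close> by (simp add: sum.reindex bij)
    finally show ?thesis .
  qed
  have "generates_module poly_ring M (q ` B)"
    unfolding generates_module_def
  proof (intro conjI ballI)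
    show "q ` B \<subseteq> carrier M" using B(1) q_closed by blast
    fix x assume "x \<in> carrier M"
    then obtain z where z: "x = q z" "z \<in> Z" unfolding surj by blast
    then have "z \<in> span B" using B(2) by blast
    then obtain t r where tr: "z = (\<Sum>v\<in>t. s (r v) v)" "finite t" "t \<subseteq> B" unfolding span_explicit by blast
    define c where "c b = r (the_inv_into B q b)" for b
    have "c (q v) = r v" if "v \<in> t" for v
      using that tr(3) the_inv_into_f_f[OF injB] by (auto simp: c_def)
    then have "x = (\<Oplus>\<^bsub>M\<^esub>b\<in>q ` t. c b \<odot>\<^bsub>M\<^esub> b)"
      using comb[OF tr(2,3), of c] by (simp add: z(1) tr(1))
    then show "\<exists>A c. finite A \<and> A \<subseteq> q ` B \<and> c \<in> A \<rightarrow> carrier poly_ring \<and> x = (\<Oplus>\<^bsub>M\<^esub>b\<in>A. c b \<odot>\<^bsub>M\<^esub> b)"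
      using tr by (intro exI[of _ "q ` t"] exI[of _ c]) (auto simp: poly_ring_def)
  qed
  moreover have "independent_in_module poly_ring M (q ` B)"
    unfolding independent_in_module_def
  proof (intro conjI allI impI ballI)
    show "q ` B \<subseteq> carrier M" using B(1) q_closed by blast
    fix A c b
    assume A: "finite A \<and> A \<subseteq> q ` B \<and> c \<in> A \<rightarrow> carrier poly_ring \<and> (\<Oplus>\<^bsub>M\<^esub>b\<in>A. c b \<odot>\<^bsub>M\<^esub> b) = \<zero>\<^bsub>M\<^esub>"
      and b: "b \<in> A"
    obtain T where T: "T \<subseteq> B" "A = q ` T" using A by (meson subset_image_iff)
    have finT: "finite T" using A T injB by (metis finite_imageD inj_on_subset)
    have "q (\<Sum>v\<in>T. s (c (q v)) v) = q 0" using A comb[OF finT T(1), of c] by (simp add: T(2) zero)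
    moreover have "(\<Sum>v\<in>T. s (c (q v)) v) \<in> Z"
      using T(1) B(1) by (intro subspace_sum[OF sub(1)] subspace_scale[OF sub(1)]) blast
    ultimately have "(\<Sum>v\<in>T. s (c (q v)) v) = 0" using inj subspace_0[OF sub(1)] by blast
    then have "c (q v) = 0" if "v \<in> T" for v
      using independentD[OF B(3) finT T(1), of "\<lambda>v. c (q v)"] that by blast
    then show "c b = \<zero>\<^bsub>poly_ring\<^esub>" using b T(2) by (auto simp: poly_ring_def)
  qed
  ultimately show ?thesis unfolding free_module_def by blast
qed

section \<open>The cellular complex\<close>

text \<open>
  Chains with polynomials instead of residue classes as values.  The complex of direct sums of the
  \<open>S / I\<^sub>\<xi>\<close> is the quotient by the chains \<open>null_chains\<close> whose value at each \<open>\<xi>\<close> lies in \<open>I\<^sub>\<xi>\<close>; accordingly,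
  a chain is a cycle if its boundary is null, and null chains count as boundaries.
\<close>

definition lifted_chains :: "(rat ^ 'n::finite) set set \<Rightarrow> nat \<Rightarrow> ((rat ^ 'n) set \<Rightarrow> 'n mpoly) set" where
  "lifted_chains \<Sigma> k = {f. \<forall>\<xi>. \<xi> \<notin> chain_cones \<Sigma> k \<longrightarrow> f \<xi> = 0}"

definition null_chains :: "(rat ^ 'n::finite) set set \<Rightarrow> nat \<Rightarrow> ((rat ^ 'n) set \<Rightarrow> 'n mpoly) set" where
  "null_chains \<Sigma> k = {f. \<forall>\<xi>. (\<xi> \<in> chain_cones \<Sigma> k \<longrightarrow> f \<xi> \<in> cone_ideal \<xi>) \<and> (\<xi> \<notin> chain_cones \<Sigma> k \<longrightarrow> f \<xi> = 0)}"

definition bdry :: "(rat ^ 'n::finite) set set \<Rightarrow> ((rat ^ 'n) set \<Rightarrow> (rat ^ 'n) list) \<Rightarrow> nat \<Rightarrow>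
    ((rat ^ 'n) set \<Rightarrow> 'n mpoly) \<Rightarrow> (rat ^ 'n) set \<Rightarrow> 'n mpoly" where
  "bdry \<Sigma> ori k f = (\<lambda>\<beta>. if \<beta> \<in> chain_cones \<Sigma> (k - 1)
     then \<Sum>\<alpha>\<in>{\<alpha>\<in>chain_cones \<Sigma> k. cone_face \<beta> \<alpha>}. const_poly (incidence ori \<alpha> \<beta>) * f \<alpha> else 0)"

definition cycle_chains where
  "cycle_chains \<Sigma> ori k = {f\<in>lifted_chains \<Sigma> k. bdry \<Sigma> ori k f \<in> null_chains \<Sigma> (k - 1)}"

definition boundary_chains where
  "boundary_chains \<Sigma> ori k = {bdry \<Sigma> ori (Suc k) g + l | g l. g \<in> lifted_chains \<Sigma> (Suc k) \<and> l \<in> null_chains \<Sigma> k}"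

definition chain_coset :: "(rat ^ 'n::finite) set set \<Rightarrow> nat \<Rightarrow> ((rat ^ 'n) set \<Rightarrow> 'n mpoly) \<Rightarrow>
    (rat ^ 'n) set \<Rightarrow> 'n mpoly set" where
  "chain_coset \<Sigma> k f = (\<lambda>\<xi>\<in>chain_cones \<Sigma> k. cone_ideal \<xi> +>\<^bsub>ring_as_module poly_ring\<^esub> f \<xi>)"

lemma presentation_cone_module:
  "presentation (*) UNIV (cone_ideal \<xi>) (cone_module \<xi>) (\<lambda>p. cone_ideal \<xi> +>\<^bsub>ring_as_module poly_ring\<^esub> p)"
  unfolding cone_module_def
  by (rule presentation_quot_module[OF presentation_ring])
     (simp_all add: subspace_cone_ideal ring_mod.subspace_0[OF subspace_cone_ideal])

lemma presentation_chain_module: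
  "presentation fscale (lifted_chains \<Sigma> k) (null_chains \<Sigma> k) (chain_module \<Sigma> k) (chain_coset \<Sigma> k)"
  unfolding lifted_chains_def null_chains_def chain_module_def chain_coset_def
  by (rule presentation_direct_sum) (rule presentation_cone_module)

lemmas subspace_chains = presentation.sub(1)[OF presentation_chain_module]
  and subspace_null_chains = presentation.sub(2)[OF presentation_chain_module]
  and null_chains_subset = presentation.sub(3)[OF presentation_chain_module]

lemma chain_cones_dim: "\<xi> \<in> chain_cones \<Sigma> k \<Longrightarrow> \<xi> \<in> \<Sigma> \<and> vec.dim \<xi> = k \<and> \<not> \<xi> \<subseteq> boundary_set (\<Union>\<Sigma>) \<and> k \<noteq> 0"
  by (auto simp: chain_cones_def interior_cones_def cones_of_dim_def split: if_splits)

lemma finite_chain_cones: "fan \<Sigma> \<Longrightarrow> finite (chain_cones \<Sigma> k)"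
  by (rule finite_subset[of _ \<Sigma>]) (auto simp: fan_finite dest: chain_cones_dim)

lemma cone_ideal_face: "cone_face \<beta> \<alpha> \<Longrightarrow> cone_ideal \<alpha> \<subseteq> cone_ideal \<beta>"
  by (intro cone_ideal_mono vec.span_mono cone_face_subset)

lemma bdry_add: "bdry \<Sigma> ori k (f + g) = bdry \<Sigma> ori k f + bdry \<Sigma> ori k g"
  by (auto simp: bdry_def fun_eq_iff distrib_left sum.distrib)

lemma bdry_scale: "bdry \<Sigma> ori k (fscale r f) = fscale r (bdry \<Sigma> ori k f)"
  by (auto simp: bdry_def fun_eq_iff sum_distrib_left mult_ac)

lemma bdry_chains: "bdry \<Sigma> ori k f \<in> lifted_chains \<Sigma> (k - 1)"
  by (simp add: bdry_def lifted_chains_def)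

lemma bdry_null_chains:
  assumes "f \<in> null_chains \<Sigma> k"
  shows "bdry \<Sigma> ori k f \<in> null_chains \<Sigma> (k - 1)"
proof -
  have "(\<Sum>\<alpha>\<in>{\<alpha>\<in>chain_cones \<Sigma> k. cone_face \<beta> \<alpha>}. const_poly (incidence ori \<alpha> \<beta>) * f \<alpha>) \<in> cone_ideal \<beta>" for \<beta>
    using assms cone_ideal_face
    by (intro ring_mod.subspace_sum ring_mod.subspace_scale subspace_cone_ideal) (auto simp: null_chains_def)
  then show ?thesis by (simp add: bdry_def null_chains_def)
qed

lemma chain_boundary_chain_coset:
  fixes \<Sigma> :: "(rat ^ 'n::finite) set set"
  assumes "fan \<Sigma>"
  shows "chain_boundary \<Sigma> ori k (chain_coset \<Sigma> k f) = chain_coset \<Sigma> (k - 1) (bdry \<Sigma> ori k f)"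
proof
  fix \<beta> :: "(rat ^ 'n) set"
  let ?c = "\<lambda>\<xi> p. cone_ideal \<xi> +>\<^bsub>ring_as_module poly_ring\<^esub> p"
  interpret P: presentation "(*)" UNIV "cone_ideal \<beta>" "cone_module \<beta>" "?c \<beta>"
    by (rule presentation_cone_module)
  have coset: "?c \<xi> p = {h + p | h. h \<in> cone_ideal \<xi>}" for \<xi> :: "(rat ^ 'n) set" and p
    by (auto simp: a_r_coset_def' ring_as_module_def poly_ring_def)
  have proj: "cone_ideal \<beta> <+>\<^bsub>poly_ring\<^esub> ?c \<alpha> p = ?c \<beta> p" if "cone_face \<beta> \<alpha>" for \<alpha> p
  proof -
    have "cone_ideal \<beta> <+>\<^bsub>poly_ring\<^esub> ?c \<alpha> p = {h + (a + p) | h a. h \<in> cone_ideal \<beta> \<and> a \<in> cone_ideal \<alpha>}"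
      unfolding coset by (auto simp: set_add_def' poly_ring_def)
    also have "\<dots> = {h + p | h. h \<in> cone_ideal \<beta>}"
    proof (intro subset_antisym subsetI)
      fix x assume "x \<in> {h + (a + p) | h a. h \<in> cone_ideal \<beta> \<and> a \<in> cone_ideal \<alpha>}"
      then obtain h a where ha: "x = (h + a) + p" "h \<in> cone_ideal \<beta>" "a \<in> cone_ideal \<alpha>"
        by (auto simp: add.assoc)
      then have "h + a \<in> cone_ideal \<beta>"
        using cone_ideal_face[OF that] ring_mod.subspace_add[OF subspace_cone_ideal] by blast
      then show "x \<in> {h + p | h. h \<in> cone_ideal \<beta>}" using ha(1) by blast
    next
      fix x assume "x \<in> {h + p | h. h \<in> cone_ideal \<beta>}"
      then obtain h where "x = h + (0 + p)" "h \<in> cone_ideal \<beta>" by auto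
      then show "x \<in> {h + (a + p) | h a. h \<in> cone_ideal \<beta> \<and> a \<in> cone_ideal \<alpha>}"
        using ring_mod.subspace_0[OF subspace_cone_ideal] by blast
    qed
    finally show ?thesis unfolding coset .
  qed
  show "chain_boundary \<Sigma> ori k (chain_coset \<Sigma> k f) \<beta> = chain_coset \<Sigma> (k - 1) (bdry \<Sigma> ori k f) \<beta>"
  proof (cases "\<beta> \<in> chain_cones \<Sigma> (k - 1)")
    case True
    let ?A = "{\<alpha>\<in>chain_cones \<Sigma> k. cone_face \<beta> \<alpha>}"
    have "(\<Oplus>\<^bsub>cone_module \<beta>\<^esub>\<alpha>\<in>?A. const_poly (incidence ori \<alpha> \<beta>) \<odot>\<^bsub>cone_module \<beta>\<^esub>
         (cone_ideal \<beta> <+>\<^bsub>poly_ring\<^esub> chain_coset \<Sigma> k f \<alpha>)) =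
       ?c \<beta> (\<Sum>\<alpha>\<in>?A. const_poly (incidence ori \<alpha> \<beta>) * f \<alpha>)"
      using finite_chain_cones[OF assms, of k]
      by (intro P.finsum_q) (auto simp: chain_coset_def proj P.smult)
    then show ?thesis using True by (simp add: chain_boundary_def chain_coset_def bdry_def)
  qed (simp add: chain_boundary_def chain_coset_def)
qed

text \<open>
  The relation holds already for the lifted chains.  If \<open>\<gamma>\<close> is interior, so are all cones that contain it,
  hence both cones of a diamond above \<open>\<gamma>\<close> occur in the sum.
\<close>

lemma bdry_bdry:
  fixes \<Sigma> :: "(rat ^ 'n::finite) set set"
  assumes fan: "fan \<Sigma>" and ori: "\<And>\<xi>. \<xi> \<in> \<Sigma> \<Longrightarrow> orients (ori \<xi>) \<xi>"
  shows "bdry \<Sigma> ori k (bdry \<Sigma> ori (Suc k) g) = 0"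
proof
  fix \<gamma>
  show "bdry \<Sigma> ori k (bdry \<Sigma> ori (Suc k) g) \<gamma> = 0 \<gamma>"
  proof (cases "\<gamma> \<in> chain_cones \<Sigma> (k - 1)")
    case True
    then have \<gamma>: "\<gamma> \<in> \<Sigma>" "vec.dim \<gamma> = k - 1" "\<not> \<gamma> \<subseteq> boundary_set (\<Union>\<Sigma>)" "k = Suc (vec.dim \<gamma>)"
      using chain_cones_dim[OF True] by auto
    let ?B = "{\<beta>\<in>chain_cones \<Sigma> k. cone_face \<gamma> \<beta>}"
    let ?A = "chain_cones \<Sigma> (Suc k)"
    have fin: "finite ?A" "finite ?B" using finite_chain_cones[OF fan] by auto
    have signs: "(\<Sum>\<beta>\<in>{\<beta>\<in>?B. cone_face \<beta> \<alpha>}. incidence ori \<alpha> \<beta> * incidence ori \<beta> \<gamma>) = 0" if \<alpha>: "\<alpha> \<in> ?A" for \<alpha>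
    proof (cases "{\<beta>\<in>?B. cone_face \<beta> \<alpha>} = {}")
      case False
      have a: "\<alpha> \<in> \<Sigma>" "vec.dim \<alpha> = Suc (Suc (vec.dim \<gamma>))" using chain_cones_dim[OF \<alpha>] \<gamma>(4) by auto
      have "\<gamma> \<subseteq> \<alpha>" using False by (blast dest: cone_face_subset)
      then have face: "cone_face \<gamma> \<alpha>" by (rule fan_subset_face[OF fan a(1) \<gamma>(1)])
      obtain \<beta>1 \<beta>2 b1 b2 where \<beta>: "cone_face \<beta>1 \<alpha>" "cone_face \<beta>2 \<alpha>" "\<gamma> \<subseteq> \<beta>1" "\<gamma> \<subseteq> \<beta>2"
        "vec.dim \<beta>1 = Suc (vec.dim \<gamma>)" "vec.dim \<beta>2 = Suc (vec.dim \<gamma>)"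
        "b1 \<in> \<beta>1" "b1 \<notin> vec.span \<beta>2" "b2 \<in> \<beta>2" "b2 \<notin> vec.span \<beta>1"
        and unique: "\<And>\<beta>. cone_face \<beta> \<alpha> \<Longrightarrow> \<gamma> \<subseteq> \<beta> \<Longrightarrow> vec.dim \<beta> = Suc (vec.dim \<gamma>) \<Longrightarrow> \<beta> = \<beta>1 \<or> \<beta> = \<beta>2"
        by (rule cone_diamond[OF fan_polyhedral[OF fan a(1)] face a(2)]) (rule that)
      have \<beta>\<Sigma>: "\<beta>1 \<in> \<Sigma>" "\<beta>2 \<in> \<Sigma>" using fan_face_closed[OF fan a(1)] \<beta>(1,2) by auto
      have \<gamma>\<beta>: "cone_face \<gamma> \<beta>1" "cone_face \<gamma> \<beta>2"
        using fan_subset_face[OF fan \<beta>\<Sigma>(1) \<gamma>(1)] fan_subset_face[OF fan \<beta>\<Sigma>(2) \<gamma>(1)] \<beta>(3,4) by auto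
      have "\<beta>1 \<in> chain_cones \<Sigma> k" "\<beta>2 \<in> chain_cones \<Sigma> k"
        using \<beta>\<Sigma> \<beta>(3-6) \<gamma>(3,4) by (auto simp: chain_cones_def interior_cones_def cones_of_dim_def)
      then have "{\<beta>\<in>?B. cone_face \<beta> \<alpha>} = {\<beta>1, \<beta>2}"
        using \<beta>(1,2) \<gamma>\<beta> unique \<gamma>(4) by (auto dest: cone_face_subset chain_cones_dim)
      moreover have "\<beta>1 \<noteq> \<beta>2" using \<beta>(7,8) vec.span_base by blast
      moreover have "incidence ori \<alpha> \<beta>1 * incidence ori \<beta>1 \<gamma> = - (incidence ori \<alpha> \<beta>2 * incidence ori \<beta>2 \<gamma>)"
        by (rule incidence_diamond[OF ori[OF a(1)] ori[OF \<beta>\<Sigma>(1)] ori[OF \<beta>\<Sigma>(2)] ori[OF \<gamma>(1)]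
              a(2) \<beta>(5,6,1,2) \<gamma>\<beta> \<beta>(7-10)])
      ultimately show ?thesis by simp
    next
      case True
      then show ?thesis by (simp only: sum.empty)
    qed
    have "bdry \<Sigma> ori k (bdry \<Sigma> ori (Suc k) g) \<gamma> =
        (\<Sum>\<beta>\<in>?B. \<Sum>\<alpha>\<in>{\<alpha>\<in>?A. cone_face \<beta> \<alpha>}. const_poly (incidence ori \<alpha> \<beta> * incidence ori \<beta> \<gamma>) * g \<alpha>)"
      using True by (auto simp: bdry_def sum_distrib_left const_poly_mult mult_ac intro!: sum.cong)
    also have "\<dots> = (\<Sum>\<alpha>\<in>?A. \<Sum>\<beta>\<in>{\<beta>\<in>?B. cone_face \<beta> \<alpha>}. const_poly (incidence ori \<alpha> \<beta> * incidence ori \<beta> \<gamma>) * g \<alpha>)"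
      by (rule sum.swap_restrict[OF fin(2,1)])
    also have "\<dots> = (\<Sum>\<alpha>\<in>?A. const_poly (\<Sum>\<beta>\<in>{\<beta>\<in>?B. cone_face \<beta> \<alpha>}. incidence ori \<alpha> \<beta> * incidence ori \<beta> \<gamma>) * g \<alpha>)"
      by (simp add: const_poly_sum sum_distrib_right)
    also have "\<dots> = 0" using signs by simp
    finally show ?thesis by simp
  qed (simp add: bdry_def)
qed

lemma subspace_cycle_chains: "fun_mod.subspace (cycle_chains \<Sigma> ori k)"
proof (rule fun_mod.subspaceI)
  have "bdry \<Sigma> ori k 0 = 0" by (simp add: bdry_def fun_eq_iff)
  then show "0 \<in> cycle_chains \<Sigma> ori k"
    by (simp add: cycle_chains_def fun_mod.subspace_0[OF subspace_chains] fun_mod.subspace_0[OF subspace_null_chains])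
qed (simp_all add: cycle_chains_def bdry_add bdry_scale fun_mod.subspace_add[OF subspace_chains]
    fun_mod.subspace_add[OF subspace_null_chains] fun_mod.subspace_scale[OF subspace_chains]
    fun_mod.subspace_scale[OF subspace_null_chains])

lemma subspace_boundary_chains: "fun_mod.subspace (boundary_chains \<Sigma> ori k)"
proof (rule fun_mod.subspaceI)
  have "bdry \<Sigma> ori (Suc k) 0 = 0" by (simp add: bdry_def fun_eq_iff)
  then have "0 = bdry \<Sigma> ori (Suc k) 0 + 0" by simp
  then show "0 \<in> boundary_chains \<Sigma> ori k"
    using fun_mod.subspace_0[OF subspace_chains] fun_mod.subspace_0[OF subspace_null_chains]
    unfolding boundary_chains_def by blast
next
  fix x y assume "x \<in> boundary_chains \<Sigma> ori k" "y \<in> boundary_chains \<Sigma> ori k"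
  then obtain g l g' l' where "x = bdry \<Sigma> ori (Suc k) g + l" "y = bdry \<Sigma> ori (Suc k) g' + l'"
    "g \<in> lifted_chains \<Sigma> (Suc k)" "g' \<in> lifted_chains \<Sigma> (Suc k)" "l \<in> null_chains \<Sigma> k" "l' \<in> null_chains \<Sigma> k"
    unfolding boundary_chains_def by blast
  moreover from this have "x + y = bdry \<Sigma> ori (Suc k) (g + g') + (l + l')"
    by (simp add: bdry_add add.assoc add.left_commute)
  ultimately show "x + y \<in> boundary_chains \<Sigma> ori k"
    using fun_mod.subspace_add[OF subspace_chains] fun_mod.subspace_add[OF subspace_null_chains]
    unfolding boundary_chains_def by blast
next
  fix r x assume "x \<in> boundary_chains \<Sigma> ori k"
  then obtain g l where "x = bdry \<Sigma> ori (Suc k) g + l" "g \<in> lifted_chains \<Sigma> (Suc k)" "l \<in> null_chains \<Sigma> k"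
    unfolding boundary_chains_def by blast
  moreover from this have "fscale r x = bdry \<Sigma> ori (Suc k) (fscale r g) + fscale r l"
    by (simp add: bdry_scale fun_mod.scale_right_distrib)
  ultimately show "fscale r x \<in> boundary_chains \<Sigma> ori k"
    using fun_mod.subspace_scale[OF subspace_chains] fun_mod.subspace_scale[OF subspace_null_chains]
    unfolding boundary_chains_def by blast
qed

lemma null_subset_boundary_chains: "null_chains \<Sigma> k \<subseteq> boundary_chains \<Sigma> ori k"
proof
  fix l assume "l \<in> null_chains \<Sigma> k"
  moreover have "l = bdry \<Sigma> ori (Suc k) 0 + l" by (simp add: bdry_def fun_eq_iff)
  ultimately show "l \<in> boundary_chains \<Sigma> ori k"
    using fun_mod.subspace_0[OF subspace_chains] unfolding boundary_chains_def by blast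
qed

lemma boundary_subset_cycle_chains:
  assumes "fan \<Sigma>" "\<And>\<xi>. \<xi> \<in> \<Sigma> \<Longrightarrow> orients (ori \<xi>) \<xi>"
  shows "boundary_chains \<Sigma> ori k \<subseteq> cycle_chains \<Sigma> ori k"
proof
  fix x assume "x \<in> boundary_chains \<Sigma> ori k"
  then obtain g l where gl: "x = bdry \<Sigma> ori (Suc k) g + l" "g \<in> lifted_chains \<Sigma> (Suc k)" "l \<in> null_chains \<Sigma> k"
    unfolding boundary_chains_def by blast
  have "x \<in> lifted_chains \<Sigma> k"
    unfolding gl(1) using bdry_chains[of \<Sigma> ori "Suc k" g] null_chains_subset gl(3)
    by (intro fun_mod.subspace_add[OF subspace_chains]) auto
  moreover have "bdry \<Sigma> ori k x = bdry \<Sigma> ori k l"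
    using bdry_bdry[OF assms] by (simp add: gl(1) bdry_add)
  ultimately show "x \<in> cycle_chains \<Sigma> ori k"
    using bdry_null_chains[OF gl(3)] by (simp add: cycle_chains_def)
qed

lemma homology_presentation:
  assumes "fan \<Sigma>" "\<And>\<xi>. \<xi> \<in> \<Sigma> \<Longrightarrow> orients (ori \<xi>) \<xi>"
  obtains q where "presentation fscale (cycle_chains \<Sigma> ori k) (boundary_chains \<Sigma> ori k) (homology \<Sigma> ori k) q"
proof -
  interpret C: presentation fscale "lifted_chains \<Sigma> k" "null_chains \<Sigma> k" "chain_module \<Sigma> k" "chain_coset \<Sigma> k"
    by (rule presentation_chain_module)
  interpret C': presentation fscale "lifted_chains \<Sigma> (k - 1)" "null_chains \<Sigma> (k - 1)" "chain_module \<Sigma> (k - 1)" "chain_coset \<Sigma> (k - 1)"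
    by (rule presentation_chain_module)
  interpret C'': presentation fscale "lifted_chains \<Sigma> (Suc k)" "null_chains \<Sigma> (Suc k)" "chain_module \<Sigma> (Suc k)" "chain_coset \<Sigma> (Suc k)"
    by (rule presentation_chain_module)
  have cyc: "cycles \<Sigma> ori k = chain_coset \<Sigma> k ` cycle_chains \<Sigma> ori k"
  proof -
    have "chain_boundary \<Sigma> ori k (chain_coset \<Sigma> k f) = \<zero>\<^bsub>chain_module \<Sigma> (k - 1)\<^esub> \<longleftrightarrow> bdry \<Sigma> ori k f \<in> null_chains \<Sigma> (k - 1)" for f
      unfolding chain_boundary_chain_coset[OF assms(1)] C'.zero[symmetric]
      using C'.kernel[OF bdry_chains fun_mod.subspace_0[OF subspace_chains], of ori f] by simp
    then show ?thesis unfolding cycles_def C.surj cycle_chains_def by blast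
  qed
  have bd: "boundaries \<Sigma> ori k = chain_coset \<Sigma> k ` boundary_chains \<Sigma> ori k"
  proof -
    have "boundaries \<Sigma> ori k = (\<lambda>g. chain_coset \<Sigma> k (bdry \<Sigma> ori (Suc k) g)) ` lifted_chains \<Sigma> (Suc k)"
      unfolding boundaries_def C''.surj image_image chain_boundary_chain_coset[OF assms(1)] by simp
    also have "\<dots> = chain_coset \<Sigma> k ` boundary_chains \<Sigma> ori k"
    proof (intro subset_antisym subsetI)
      fix x assume "x \<in> (\<lambda>g. chain_coset \<Sigma> k (bdry \<Sigma> ori (Suc k) g)) ` lifted_chains \<Sigma> (Suc k)"
      then obtain g where g: "x = chain_coset \<Sigma> k (bdry \<Sigma> ori (Suc k) g + 0)" "g \<in> lifted_chains \<Sigma> (Suc k)" by auto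
      then have "bdry \<Sigma> ori (Suc k) g + 0 \<in> boundary_chains \<Sigma> ori k"
        unfolding boundary_chains_def using fun_mod.subspace_0[OF subspace_null_chains] by blast
      then show "x \<in> chain_coset \<Sigma> k ` boundary_chains \<Sigma> ori k" using g(1) by blast
    next
      fix x assume "x \<in> chain_coset \<Sigma> k ` boundary_chains \<Sigma> ori k"
      then obtain g l where gl: "x = chain_coset \<Sigma> k (bdry \<Sigma> ori (Suc k) g + l)" "g \<in> lifted_chains \<Sigma> (Suc k)" "l \<in> null_chains \<Sigma> k"
        unfolding boundary_chains_def by blast
      have b: "bdry \<Sigma> ori (Suc k) g \<in> lifted_chains \<Sigma> k" using bdry_chains[of \<Sigma> ori "Suc k" g] by simp
      have "bdry \<Sigma> ori (Suc k) g + l \<in> lifted_chains \<Sigma> k"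
        using gl(3) null_chains_subset b fun_mod.subspace_add[OF subspace_chains] by blast
      then have "x = chain_coset \<Sigma> k (bdry \<Sigma> ori (Suc k) g)"
        using C.kernel[OF _ b] gl by simp
      then show "x \<in> (\<lambda>g. chain_coset \<Sigma> k (bdry \<Sigma> ori (Suc k) g)) ` lifted_chains \<Sigma> (Suc k)" using gl(2) by blast
    qed
    finally show ?thesis .
  qed
  have sub: "null_chains \<Sigma> k \<subseteq> cycle_chains \<Sigma> ori k" "cycle_chains \<Sigma> ori k \<subseteq> lifted_chains \<Sigma> k"
    using null_subset_boundary_chains boundary_subset_cycle_chains[OF assms] by (blast, auto simp: cycle_chains_def)
  have "presentation fscale (cycle_chains \<Sigma> ori k) (null_chains \<Sigma> k)
      (chain_module \<Sigma> k\<lparr>carrier := cycles \<Sigma> ori k\<rparr>) (chain_coset \<Sigma> k)"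
    by (rule presentation_subcarrier[OF presentation_chain_module subspace_cycle_chains sub cyc])
  then have "presentation fscale (cycle_chains \<Sigma> ori k) (boundary_chains \<Sigma> ori k) (homology \<Sigma> ori k)
      (\<lambda>z. boundaries \<Sigma> ori k +>\<^bsub>chain_module \<Sigma> k\<lparr>carrier := cycles \<Sigma> ori k\<rparr>\<^esub> chain_coset \<Sigma> k z)"
    unfolding homology_def
    by (rule presentation_quot_module[OF _ subspace_boundary_chains null_subset_boundary_chains
          boundary_subset_cycle_chains[OF assms] bd])
  then show ?thesis by (rule that)
qed

section \<open>Koszul homology along the complex\<close>

lemma koszul_fscale: "koszul fscale"
  by unfold_locales

lemma koszul_exact_chains:
  assumes "CARD('n) \<le> j + k"
  shows "fun_koszul.koszul_exact (lifted_chains \<Sigma> k) (null_chains \<Sigma> k :: ((rat ^ 'n::finite) set \<Rightarrow> _) set) j"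
  unfolding fun_koszul.koszul_exact_def
proof (intro allI impI)
  fix c :: "'n set \<Rightarrow> (rat ^ 'n) set \<Rightarrow> 'n mpoly"
  assume c: "\<forall>A. card A = Suc j \<longrightarrow> c A \<in> lifted_chains \<Sigma> k" "\<forall>A. card A = j \<longrightarrow> fun_koszul.kdiff c A \<in> null_chains \<Sigma> k"
  have kd: "fun_koszul.kdiff c A \<xi> = ring_koszul.kdiff (\<lambda>A. c A \<xi>) A" for c :: "'n set \<Rightarrow> (rat ^ 'n) set \<Rightarrow> 'n mpoly" and A \<xi>
    by (simp add: fun_koszul.kdiff_def ring_koszul.kdiff_def sum_apply)
  have "\<exists>b. \<forall>A. card A = Suc j \<longrightarrow> c A \<xi> - ring_koszul.kdiff b A \<in> cone_ideal \<xi>" if \<xi>: "\<xi> \<in> chain_cones \<Sigma> k" for \<xi>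
  proof -
    have "ring_koszul.koszul_exact UNIV (cone_ideal \<xi>) j"
      using assms chain_cones_dim[OF \<xi>] by (intro cone_quotient_koszul_exact) simp
    moreover have "ring_koszul.kdiff (\<lambda>A. c A \<xi>) A \<in> cone_ideal \<xi>" if "card A = j" for A
      using c(2) that \<xi> by (simp add: null_chains_def kd)
    ultimately show ?thesis
      using ring_koszul.koszul_exactE[of UNIV "cone_ideal \<xi>" j "\<lambda>A. c A \<xi>"] by blast
  qed
  then obtain b where b: "\<And>\<xi> A. \<xi> \<in> chain_cones \<Sigma> k \<Longrightarrow> card A = Suc j \<Longrightarrow> c A \<xi> - ring_koszul.kdiff (b \<xi>) A \<in> cone_ideal \<xi>"
    by metis
  define b' where "b' A \<xi> = (if \<xi> \<in> chain_cones \<Sigma> k then b \<xi> A else 0)" for A \<xi>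
  have "b' A \<in> lifted_chains \<Sigma> k" for A by (simp add: b'_def lifted_chains_def)
  moreover have "c A - fun_koszul.kdiff b' A \<in> null_chains \<Sigma> k" if A: "card A = Suc j" for A
    unfolding null_chains_def
  proof (intro CollectI allI conjI impI)
    fix \<xi>
    {
      assume "\<xi> \<in> chain_cones \<Sigma> k"
      then show "(c A - fun_koszul.kdiff b' A) \<xi> \<in> cone_ideal \<xi>"
        using b[of \<xi> A] A by (simp add: kd b'_def)
    next
      assume "\<xi> \<notin> chain_cones \<Sigma> k"
      then show "(c A - fun_koszul.kdiff b' A) \<xi> = 0"
        using c(1) A by (simp add: kd b'_def lifted_chains_def ring_koszul.kdiff_def)
    }
  qed
  ultimately show "\<exists>b. (\<forall>A. card A = Suc (Suc j) \<longrightarrow> b A \<in> lifted_chains \<Sigma> k) \<and>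
      (\<forall>A. card A = Suc j \<longrightarrow> c A - fun_koszul.kdiff b A \<in> null_chains \<Sigma> k)"
    by blast
qed

text \<open>
  A finite supremum of lengths is attained, unless it is \<open>0\<close>; then the empty sequence, which need not be
  regular in the sense of the definition, takes its place.
\<close>

lemma depth_regular_sequence:
  assumes "depth R I M = enat m"
  obtains fs where "length fs = m \<or> m = 0 \<and> fs = []" "fs = [] \<or> set fs \<subseteq> I \<and> regular_sequence R M fs"
proof (cases m)
  case 0
  then show ?thesis using that[of "[]"] by simp
next
  case (Suc m')
  have "\<exists>fs. set fs \<subseteq> I \<and> regular_sequence R M fs \<and> length fs \<ge> m"
  proof (rule ccontr)
    assume "\<not> ?thesis"
    then have "depth R I M \<le> enat m'"
      unfolding depth_def using Suc by (intro Sup_least) (auto simp: not_less_eq_eq)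
    then show False using assms Suc by simp
  qed
  then obtain fs where fs: "set fs \<subseteq> I" "regular_sequence R M fs" "length fs \<ge> m" by blast
  have "enat (length fs) \<le> depth R I M"
    unfolding depth_def using fs by (intro Sup_upper) blast
  then have "length fs = m" using fs(3) assms by simp
  then show ?thesis using that fs by blast
qed

text \<open>
  Codimension \<open>d - i + 1\<close> means dimension \<open>i - 1\<close>, since \<open>0 < i\<close>.  So there is a regular sequence of length
  \<open>i - 1\<close>, and \<open>Tor\<^sub>j\<^sub>+\<^sub>1\<close> vanishes as soon as \<open>d \<le> j + (i - 1)\<close>.
\<close>

lemma cohen_macaulay_koszul_exact:
  fixes M :: "('n::finite mpoly, 'b, 'c) module_scheme"
  assumes "presentation fscale Z B M q" "cohen_macaulay M" "codimension M = enat (CARD('n) - i + 1)"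
    and i: "0 < i" "i < CARD('n)" and j: "CARD('n) < j + i"
  shows "fun_koszul.koszul_exact Z B j"
proof -
  interpret presentation fscale Z B M q by (rule assms(1))
  have "module_dim poly_ring M = enat (i - 1)"
  proof (cases "module_dim poly_ring M")
    case (enat m)
    then have "CARD('n) - m = CARD('n) - i + 1" using assms(3) by (simp add: codimension_def)
    then show ?thesis using enat i by simp
  next
    case infinity
    then show ?thesis using assms(3) by (simp add: codimension_def zero_enat_def)
  qed
  then have "depth poly_ring irrelevant_ideal M = enat (i - 1)"
    using assms(2) by (simp add: cohen_macaulay_def)
  then obtain fs where fs: "length fs = i - 1" "fs = [] \<or> set fs \<subseteq> irrelevant_ideal \<and> regular_sequence poly_ring M fs"
    by (rule depth_regular_sequence) auto
  show ?thesis
  proof (rule fun_koszul.koszul_exact_regular_sequence)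
    show "fun_koszul.regular_on Z B fs"
      using fs(2) regular_sequence_regular_on[OF koszul_fscale] by auto
    show "\<exists>g. f = (\<Sum>i\<in>UNIV. g i * var_poly i)" if "f \<in> set fs" for f
      using fs(2) that by (intro irrelevant_ideal_vars) auto
    show "CARD('n) \<le> j + length fs" using fs(1) i j by simp
  qed (rule sub)+
qed

text \<open>
  The induction on the degree: \<open>Z\<^sub>i\<^sub>+\<^sub>1\<close> is the kernel of the map from \<open>C\<^sub>i\<^sub>+\<^sub>1\<close> onto \<open>B\<^sub>i\<close>, and \<open>B\<^sub>i\<^sub>+\<^sub>1\<close> is the
  kernel of the map from \<open>Z\<^sub>i\<^sub>+\<^sub>1\<close> onto \<open>H\<^sub>i\<^sub>+\<^sub>1\<close>.  It starts with \<open>B\<^sub>0 = 0\<close>, the complex being zero in degree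
  \<open>0\<close>.
\<close>

lemma koszul_exact_cycles_boundaries:
  fixes \<Sigma> :: "(rat ^ 'n::finite) set set"
  assumes fan: "fan \<Sigma>" and ori: "\<And>\<xi>. \<xi> \<in> \<Sigma> \<Longrightarrow> orients (ori \<xi>) \<xi>"
    and hom: "\<And>i. i < CARD('n) \<Longrightarrow> zero_module (homology \<Sigma> ori i) \<or>
           (cohen_macaulay (homology \<Sigma> ori i) \<and> codimension (homology \<Sigma> ori i) = enat (CARD('n) - i + 1))"
  shows "i < CARD('n) \<Longrightarrow> CARD('n) \<le> j + i \<Longrightarrow>
      fun_koszul.koszul_exact (boundary_chains \<Sigma> ori i) (null_chains \<Sigma> i) j"
    and "0 < i \<Longrightarrow> i \<le> CARD('n) \<Longrightarrow> CARD('n) \<le> j + i \<Longrightarrow>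
      fun_koszul.koszul_exact (cycle_chains \<Sigma> ori i) (null_chains \<Sigma> i) j"
proof -
  have cyc: "fun_koszul.koszul_exact (cycle_chains \<Sigma> ori (Suc i)) (null_chains \<Sigma> (Suc i)) j"
    if ex: "\<And>j. CARD('n) \<le> j + i \<Longrightarrow> fun_koszul.koszul_exact (boundary_chains \<Sigma> ori i) (null_chains \<Sigma> i) j"
      and j: "CARD('n) \<le> j + Suc i" for i j
  proof (rule fun_koszul.koszul_exact_sub)
    show "fun_koszul.koszul_exact (lifted_chains \<Sigma> (Suc i)) (null_chains \<Sigma> (Suc i)) j"
      using j by (rule koszul_exact_chains)
    show "null_chains \<Sigma> (Suc i) \<subseteq> cycle_chains \<Sigma> ori (Suc i)"
      using null_subset_boundary_chains boundary_subset_cycle_chains[OF fan ori] by blast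
    show "cycle_chains \<Sigma> ori (Suc i) \<subseteq> lifted_chains \<Sigma> (Suc i)" by (auto simp: cycle_chains_def)
    have ex': "fun_koszul.koszul_exact (boundary_chains \<Sigma> ori i) (null_chains \<Sigma> i) (Suc j)" using j by (intro ex) simp
    show "fun_koszul.koszul_exact (lifted_chains \<Sigma> (Suc i)) (cycle_chains \<Sigma> ori (Suc i)) (Suc j)"
    proof (rule koszul_exact_pullback[where h = "bdry \<Sigma> ori (Suc i)", OF koszul_fscale koszul_fscale bdry_add bdry_scale _ _ _ _ _ ex'])
      show "bdry \<Sigma> ori (Suc i) ` lifted_chains \<Sigma> (Suc i) \<subseteq> boundary_chains \<Sigma> ori i"
      proof
        fix f assume "f \<in> bdry \<Sigma> ori (Suc i) ` lifted_chains \<Sigma> (Suc i)"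
        then obtain g where "f = bdry \<Sigma> ori (Suc i) g + 0" "g \<in> lifted_chains \<Sigma> (Suc i)" by auto
        then show "f \<in> boundary_chains \<Sigma> ori i"
          unfolding boundary_chains_def using fun_mod.subspace_0[OF subspace_null_chains] by blast
      qed
      show "boundary_chains \<Sigma> ori i \<subseteq> {bdry \<Sigma> ori (Suc i) y + l | y l. y \<in> lifted_chains \<Sigma> (Suc i) \<and> l \<in> null_chains \<Sigma> i}"
        by (simp add: boundary_chains_def)
    qed (simp_all add: cycle_chains_def subspace_chains subspace_null_chains)
  qed (rule subspace_chains subspace_cycle_chains subspace_null_chains)+
  have bd: "i < CARD('n) \<longrightarrow> CARD('n) \<le> j + i \<longrightarrow>
      fun_koszul.koszul_exact (boundary_chains \<Sigma> ori i) (null_chains \<Sigma> i) j" for i j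
  proof (induction i arbitrary: j)
    case 0
    have "boundary_chains \<Sigma> ori 0 \<subseteq> null_chains \<Sigma> 0"
    proof
      fix x assume "x \<in> boundary_chains \<Sigma> ori 0"
      then have "x \<in> lifted_chains \<Sigma> 0"
        using boundary_subset_cycle_chains[OF fan ori] by (auto simp: cycle_chains_def)
      then show "x \<in> null_chains \<Sigma> 0" by (simp add: lifted_chains_def null_chains_def chain_cones_def)
    qed
    then show ?case using fun_koszul.koszul_exact_trivial[OF subspace_boundary_chains] by blast
  next
    case (Suc i)
    show ?case
    proof (intro impI)
      assume i: "Suc i < CARD('n)" and j: "CARD('n) \<le> j + Suc i"
      obtain q where q: "presentation fscale (cycle_chains \<Sigma> ori (Suc i)) (boundary_chains \<Sigma> ori (Suc i)) (homology \<Sigma> ori (Suc i)) q"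
        by (rule homology_presentation[OF fan ori])
      have "fun_koszul.koszul_exact (cycle_chains \<Sigma> ori (Suc i)) (boundary_chains \<Sigma> ori (Suc i)) (Suc j)"
        using hom[OF i]
      proof
        assume "zero_module (homology \<Sigma> ori (Suc i))"
        then show ?thesis
          by (intro fun_koszul.koszul_exact_trivial subspace_cycle_chains presentation.zero_module_kernel[OF q])
      next
        assume cm: "cohen_macaulay (homology \<Sigma> ori (Suc i)) \<and>
          codimension (homology \<Sigma> ori (Suc i)) = enat (CARD('n) - Suc i + 1)"
        then show ?thesis using cohen_macaulay_koszul_exact[OF q, of "Suc i" "Suc j"] i j by simp
      qed
      moreover have "fun_koszul.koszul_exact (cycle_chains \<Sigma> ori (Suc i)) (null_chains \<Sigma> (Suc i)) j"
      proof (rule cyc)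
        fix j assume "CARD('n) \<le> j + i"
        moreover have "i < CARD('n)" using i by simp
        ultimately show "fun_koszul.koszul_exact (boundary_chains \<Sigma> ori i) (null_chains \<Sigma> i) j"
          using Suc by blast
      qed (rule j)
      ultimately show "fun_koszul.koszul_exact (boundary_chains \<Sigma> ori (Suc i)) (null_chains \<Sigma> (Suc i)) j"
        by (intro fun_koszul.koszul_exact_sub[OF subspace_cycle_chains subspace_boundary_chains subspace_null_chains
              null_subset_boundary_chains boundary_subset_cycle_chains[OF fan ori]])
    qed
  qed
  show "i < CARD('n) \<Longrightarrow> CARD('n) \<le> j + i \<Longrightarrow>
      fun_koszul.koszul_exact (boundary_chains \<Sigma> ori i) (null_chains \<Sigma> i) j"
    using bd by blast
  show "0 < i \<Longrightarrow> i \<le> CARD('n) \<Longrightarrow> CARD('n) \<le> j + i \<Longrightarrow>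
      fun_koszul.koszul_exact (cycle_chains \<Sigma> ori i) (null_chains \<Sigma> i) j"
    using cyc[of "i - 1" j] bd by (cases i) auto
qed

section \<open>Piecewise polynomials as top cycles\<close>

text \<open>
  The piecewise polynomials of \<open>\<Sigma>\<close>, as functions that are zero away from the full-dimensional cones.
\<close>

definition pp_chains :: "(rat ^ 'n::finite) set set \<Rightarrow> ((rat ^ 'n) set \<Rightarrow> 'n mpoly) set" where
  "pp_chains \<Sigma> = {f. (\<forall>\<sigma>. \<sigma> \<notin> cones_of_dim \<Sigma> CARD('n) \<longrightarrow> f \<sigma> = 0) \<and>
     (\<forall>\<sigma>\<in>cones_of_dim \<Sigma> CARD('n). \<forall>\<sigma>'\<in>cones_of_dim \<Sigma> CARD('n). \<forall>\<tau>\<in>cones_of_dim \<Sigma> (CARD('n) - 1).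
        cone_face \<tau> \<sigma> \<and> cone_face \<tau> \<sigma>' \<longrightarrow> f \<sigma> - f \<sigma>' \<in> cone_ideal \<tau>)}"

lemma subspace_pp_chains: "fun_mod.subspace (pp_chains \<Sigma>)"
proof (rule fun_mod.subspaceI)
  show "0 \<in> pp_chains \<Sigma>" by (simp add: pp_chains_def ring_mod.subspace_0[OF subspace_cone_ideal])
next
  fix f g assume fg: "f \<in> pp_chains \<Sigma>" "g \<in> pp_chains \<Sigma>"
  have "(f + g) \<sigma> - (f + g) \<sigma>' = (f \<sigma> - f \<sigma>') + (g \<sigma> - g \<sigma>')" for \<sigma> \<sigma>' by simp
  then show "f + g \<in> pp_chains \<Sigma>"
    using fg unfolding pp_chains_def
    by (auto simp del: plus_fun_apply intro!: ring_mod.subspace_add[OF subspace_cone_ideal]) (simp add: plus_fun_apply)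
next
  fix r f assume f: "f \<in> pp_chains \<Sigma>"
  have "fscale r f \<sigma> - fscale r f \<sigma>' = r * (f \<sigma> - f \<sigma>')" for \<sigma> \<sigma>' by (simp add: right_diff_distrib)
  then show "fscale r f \<in> pp_chains \<Sigma>"
    using f unfolding pp_chains_def
    by (auto simp del: fscale_apply intro!: ring_mod.subspace_scale[OF subspace_cone_ideal]) simp
qed

lemma homcomp_pp_chains:
  assumes "f \<in> pp_chains \<Sigma>"
  shows "homcomp t f \<in> pp_chains \<Sigma>"
  using assms unfolding pp_chains_def homcomp_def
  by (simp add: hcomp_diff[symmetric] hcomp_cone_ideal)

lemma presentation_piecewise_polys:
  fixes \<Sigma> :: "(rat ^ 'n::finite) set set"
  shows "presentation fscale (pp_chains \<Sigma>) {0} (piecewise_polys \<Sigma>) (\<lambda>f. restrict f (cones_of_dim \<Sigma> CARD('n)))"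
proof -
  let ?A = "cones_of_dim \<Sigma> CARD('n)"
  let ?Z = "{f :: (rat ^ 'n) set \<Rightarrow> 'n mpoly. \<forall>a. a \<notin> ?A \<longrightarrow> f a = 0}"
  have K: "{f :: (rat ^ 'n) set \<Rightarrow> 'n mpoly. \<forall>a. (a \<in> ?A \<longrightarrow> f a \<in> {0}) \<and> (a \<notin> ?A \<longrightarrow> f a = 0)} = {0}"
    by (auto simp: fun_eq_iff)
  have pres: "presentation fscale ?Z {0} (direct_sum_module ?A (\<lambda>_. ring_as_module poly_ring)) (\<lambda>f. restrict f ?A)"
    by (subst K[symmetric]) (rule presentation_direct_sum[OF presentation_ring])
  show ?thesis
    unfolding piecewise_polys_def
  proof (rule presentation_subcarrier[OF pres subspace_pp_chains])
    show "{0} \<subseteq> pp_chains \<Sigma>" using fun_mod.subspace_0[OF subspace_pp_chains] by blast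
    show "pp_chains \<Sigma> \<subseteq> ?Z" by (auto simp: pp_chains_def)
    show "{f \<in> ?A \<rightarrow>\<^sub>E UNIV. \<forall>\<sigma>\<in>?A. \<forall>\<sigma>'\<in>?A. \<forall>\<tau>\<in>cones_of_dim \<Sigma> (CARD('n) - 1).
          cone_face \<tau> \<sigma> \<and> cone_face \<tau> \<sigma>' \<longrightarrow> f \<sigma> - f \<sigma>' \<in> cone_ideal \<tau>} = (\<lambda>f. restrict f ?A) ` pp_chains \<Sigma>" (is "?C = _")
    proof (intro subset_antisym subsetI)
      fix g assume g: "g \<in> ?C"
      define f where "f \<sigma> = (if \<sigma> \<in> ?A then g \<sigma> else 0)" for \<sigma>
      have "f \<in> pp_chains \<Sigma>" using g by (simp add: f_def pp_chains_def)
      moreover have "g = restrict f ?A"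
        using g by (auto simp: f_def fun_eq_iff restrict_def PiE_def extensional_def)
      ultimately show "g \<in> (\<lambda>f. restrict f ?A) ` pp_chains \<Sigma>" by blast
    qed (auto simp: pp_chains_def)
  qed
qed

text \<open>
  Let \<open>\<epsilon> \<sigma>\<close> be the sign of the orientation of \<open>\<sigma>\<close> with respect to a fixed basis.  At an interior facet \<open>\<tau>\<close>,
  the boundary of \<open>(\<epsilon> \<sigma> f\<^sub>\<sigma>)\<close> is \<open>s (f\<^sub>\<sigma>\<^sub>1 - f\<^sub>\<sigma>\<^sub>2)\<close> for the two cones at \<open>\<tau>\<close> and some \<open>s \<noteq> 0\<close>, so that being a cycle
  means agreeing along \<open>\<tau>\<close>.  If a facet is not interior, there is no pair of cones to compare.  For
  \<open>d > 1\<close> all interior facets take part in the complex.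
\<close>

lemma koszul_exact_pp_chains:
  fixes \<Sigma> :: "(rat ^ 'n::finite) set set"
  assumes fan: "fan \<Sigma>" and ori: "\<And>\<xi>. \<xi> \<in> \<Sigma> \<Longrightarrow> orients (ori \<xi>) \<xi>" and d: "1 < CARD('n)"
    and ex: "fun_koszul.koszul_exact (cycle_chains \<Sigma> ori CARD('n)) (null_chains \<Sigma> CARD('n)) 0"
  shows "fun_koszul.koszul_exact (pp_chains \<Sigma>) {0} 0"
proof -
  let ?A = "cones_of_dim \<Sigma> CARD('n)"
  have A: "chain_cones \<Sigma> CARD('n) = ?A"
    using full_dimensional_interior[OF fan] by (auto simp: chain_cones_def interior_cones_def cones_of_dim_def)
  have null: "null_chains \<Sigma> CARD('n) = {0}"
  proof -
    have "cone_ideal \<sigma> = {0}" if "\<sigma> \<in> ?A" for \<sigma>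
      using that by (intro cone_ideal_full span_eq_UNIV) (simp add: cones_of_dim_def)
    then show ?thesis unfolding null_chains_def A by (auto simp: fun_eq_iff)
  qed
  obtain E :: "(rat ^ 'n) list" where E: "basis_list E" "length E = CARD('n)" by (rule full_basis_list_exists)
  define \<epsilon> where "\<epsilon> \<sigma> = (if \<sigma> \<in> ?A then sgn (coord_det (ori \<sigma>) E) else 1)" for \<sigma>
  have \<epsilon>\<epsilon>: "\<epsilon> \<sigma> * \<epsilon> \<sigma> = 1" for \<sigma>
  proof (cases "\<sigma> \<in> ?A")
    case True
    then have s: "\<sigma> \<in> \<Sigma>" "vec.dim \<sigma> = CARD('n)" by (auto simp: cones_of_dim_def)
    have "vec.dim (set E) = CARD('n)"
      using E by (metis basis_list_def distinct_card vec.dim_eq_card_independent)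
    then have "coord_det (ori \<sigma>) E \<noteq> 0"
      using s ori[OF s(1)] E span_eq_UNIV[of \<sigma>] span_eq_UNIV[of "set E"]
      by (intro coord_det_nonzero) (simp_all add: orients_basis_list orients_length orients_span)
    then show ?thesis using True by (simp add: \<epsilon>_def sgn_if)
  qed (simp add: \<epsilon>_def)
  have pair: "\<exists>\<sigma>1 \<sigma>2 s. {\<sigma>\<in>?A. cone_face \<tau> \<sigma>} = {\<sigma>1, \<sigma>2} \<and> \<sigma>1 \<noteq> \<sigma>2 \<and> s \<noteq> 0 \<and> \<tau> \<in> chain_cones \<Sigma> (CARD('n) - 1) \<and>
      incidence ori \<sigma>1 \<tau> = \<epsilon> \<sigma>1 * s \<and> incidence ori \<sigma>2 \<tau> = - (\<epsilon> \<sigma>2 * s)"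
    if \<tau>: "\<tau> \<in> cones_of_dim \<Sigma> (CARD('n) - 1)" and \<sigma>: "\<sigma>1 \<in> ?A" "\<sigma>2 \<in> ?A" "\<sigma>1 \<noteq> \<sigma>2" "cone_face \<tau> \<sigma>1" "cone_face \<tau> \<sigma>2" for \<tau> \<sigma>1 \<sigma>2
  proof -
    have dim: "CARD('n) = Suc (vec.dim \<tau>)" "\<tau> \<in> \<Sigma>" using \<tau> d by (auto simp: cones_of_dim_def)
    note star = facet_star[OF fan \<sigma>(1-3) dim(1) \<sigma>(4,5)]
    obtain u w1 w2 where u: "w1 \<in> \<sigma>1" "w2 \<in> \<sigma>2" "rdot u w1 > 0" "rdot u w2 < 0" "\<And>x. x \<in> \<tau> \<Longrightarrow> rdot u x = 0"
      using star(3) by blast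
    have s: "\<sigma>1 \<in> \<Sigma>" "\<sigma>2 \<in> \<Sigma>" "vec.dim \<sigma>1 = CARD('n)" "vec.dim \<sigma>2 = CARD('n)"
      using \<sigma> by (auto simp: cones_of_dim_def)
    obtain t where "t \<noteq> 0" "incidence ori \<sigma>1 \<tau> = \<epsilon> \<sigma>1 * t" "incidence ori \<sigma>2 \<tau> = - (\<epsilon> \<sigma>2 * t)"
      using incidence_opposite[OF ori[OF s(1)] ori[OF s(2)] ori[OF dim(2)] s(3,4) dim(1) \<sigma>(4,5) u E] \<sigma>(1,2)
      by (auto simp: \<epsilon>_def)
    moreover have "\<tau> \<in> chain_cones \<Sigma> (CARD('n) - 1)"
      using \<tau> star(2) d by (auto simp: chain_cones_def interior_cones_def)
    ultimately show ?thesis using star(1) \<sigma>(3) by blast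
  qed
  define h where "h f = (\<lambda>\<sigma>. const_poly (\<epsilon> \<sigma>) * f \<sigma>)" for f :: "(rat ^ 'n) set \<Rightarrow> 'n mpoly"
  have hh: "h (h f) = f" for f
    by (simp add: h_def fun_eq_iff mult.assoc[symmetric] const_poly_mult[symmetric] \<epsilon>\<epsilon>)
  have bdry_pair: "bdry \<Sigma> ori CARD('n) (h f) \<tau> = const_poly s * (f \<sigma>1 - f \<sigma>2)"
    if "{\<sigma>\<in>?A. cone_face \<tau> \<sigma>} = {\<sigma>1, \<sigma>2}" "\<sigma>1 \<noteq> \<sigma>2" "\<tau> \<in> chain_cones \<Sigma> (CARD('n) - 1)"
      "incidence ori \<sigma>1 \<tau> = \<epsilon> \<sigma>1 * s" "incidence ori \<sigma>2 \<tau> = - (\<epsilon> \<sigma>2 * s)" for f \<tau> \<sigma>1 \<sigma>2 s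
  proof -
    have c: "const_poly (\<epsilon> \<sigma> * s) * (const_poly (\<epsilon> \<sigma>) * p) = const_poly s * p" for \<sigma> and p :: "'n mpoly"
    proof -
      have "const_poly (\<epsilon> \<sigma> * s) * (const_poly (\<epsilon> \<sigma>) * p) = const_poly ((\<epsilon> \<sigma> * \<epsilon> \<sigma>) * s) * p"
        by (simp only: const_poly_mult mult_ac)
      then show ?thesis by (simp add: \<epsilon>\<epsilon>)
    qed
    have "bdry \<Sigma> ori CARD('n) (h f) \<tau> = const_poly (\<epsilon> \<sigma>1 * s) * (const_poly (\<epsilon> \<sigma>1) * f \<sigma>1) +
        const_poly (- (\<epsilon> \<sigma>2 * s)) * (const_poly (\<epsilon> \<sigma>2) * f \<sigma>2)"
      using that by (simp add: bdry_def A h_def)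
    then show ?thesis by (simp add: c const_poly_minus right_diff_distrib)
  qed
  have hpp: "h f \<in> cycle_chains \<Sigma> ori CARD('n)" if f: "f \<in> pp_chains \<Sigma>" for f
  proof -
    have "bdry \<Sigma> ori CARD('n) (h f) \<tau> \<in> cone_ideal \<tau>" if t: "\<tau> \<in> chain_cones \<Sigma> (CARD('n) - 1)" for \<tau>
    proof -
      have \<tau>: "\<tau> \<in> cones_of_dim \<Sigma> (CARD('n) - 1)" "\<tau> \<in> \<Sigma>" "CARD('n) = Suc (vec.dim \<tau>)" "\<not> \<tau> \<subseteq> boundary_set (\<Union>\<Sigma>)"
        using chain_cones_dim[OF t] d by (auto simp: cones_of_dim_def)
      obtain \<rho>1 \<rho>2 where \<rho>: "\<rho>1 \<in> ?A" "\<rho>2 \<in> ?A" "\<rho>1 \<noteq> \<rho>2" "cone_face \<tau> \<rho>1" "cone_face \<tau> \<rho>2"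
        by (rule interior_facet_two_cones[OF fan \<tau>(2-4)])
      obtain \<sigma>1 \<sigma>2 s where s: "{\<sigma>\<in>?A. cone_face \<tau> \<sigma>} = {\<sigma>1, \<sigma>2}" "\<sigma>1 \<noteq> \<sigma>2" "\<tau> \<in> chain_cones \<Sigma> (CARD('n) - 1)"
        "incidence ori \<sigma>1 \<tau> = \<epsilon> \<sigma>1 * s" "incidence ori \<sigma>2 \<tau> = - (\<epsilon> \<sigma>2 * s)"
        using pair[OF \<tau>(1) \<rho>] by blast
      have "\<sigma>1 \<in> ?A" "\<sigma>2 \<in> ?A" "cone_face \<tau> \<sigma>1" "cone_face \<tau> \<sigma>2" using s(1) by auto
      then have "f \<sigma>1 - f \<sigma>2 \<in> cone_ideal \<tau>" using f \<tau>(1) by (simp add: pp_chains_def)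
      then show ?thesis
        unfolding bdry_pair[OF s] by (rule ring_mod.subspace_scale[OF subspace_cone_ideal])
    qed
    then have "bdry \<Sigma> ori CARD('n) (h f) \<in> null_chains \<Sigma> (CARD('n) - 1)"
      by (simp add: null_chains_def bdry_def)
    moreover have "h f \<in> lifted_chains \<Sigma> CARD('n)" using f by (simp add: lifted_chains_def A h_def pp_chains_def)
    ultimately show ?thesis by (simp add: cycle_chains_def)
  qed
  have hcyc: "h f \<in> pp_chains \<Sigma>" if f: "f \<in> cycle_chains \<Sigma> ori CARD('n)" for f
  proof -
    have "h f \<sigma> - h f \<sigma>' \<in> cone_ideal \<tau>"
      if \<sigma>: "\<sigma> \<in> ?A" "\<sigma>' \<in> ?A" "\<tau> \<in> cones_of_dim \<Sigma> (CARD('n) - 1)" "cone_face \<tau> \<sigma>" "cone_face \<tau> \<sigma>'" for \<sigma> \<sigma>' \<tau>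
    proof (cases "\<sigma> = \<sigma>'")
      case False
      obtain \<sigma>1 \<sigma>2 s where s: "{\<sigma>\<in>?A. cone_face \<tau> \<sigma>} = {\<sigma>1, \<sigma>2}" "\<sigma>1 \<noteq> \<sigma>2" "\<tau> \<in> chain_cones \<Sigma> (CARD('n) - 1)"
        "incidence ori \<sigma>1 \<tau> = \<epsilon> \<sigma>1 * s" "incidence ori \<sigma>2 \<tau> = - (\<epsilon> \<sigma>2 * s)" "s \<noteq> 0"
        using pair[OF \<sigma>(3,1,2) False \<sigma>(4,5)] by blast
      have "bdry \<Sigma> ori CARD('n) (h (h f)) \<tau> \<in> cone_ideal \<tau>"
        using f s(3) by (simp add: hh cycle_chains_def null_chains_def)
      then have "const_poly (1 / s) * (const_poly s * (h f \<sigma>1 - h f \<sigma>2)) \<in> cone_ideal \<tau>"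
        unfolding bdry_pair[OF s(1-5)] by (rule ring_mod.subspace_scale[OF subspace_cone_ideal])
      moreover have "const_poly (1 / s) * (const_poly s * p) = p" for p :: "'n mpoly"
        using s(6) by (simp add: mult.assoc[symmetric] const_poly_mult[symmetric])
      ultimately have 12: "h f \<sigma>1 - h f \<sigma>2 \<in> cone_ideal \<tau>" by simp
      have "{\<sigma>, \<sigma>'} \<subseteq> {\<sigma>1, \<sigma>2}" using \<sigma> s(1) by blast
      then have "\<sigma> = \<sigma>1 \<and> \<sigma>' = \<sigma>2 \<or> \<sigma> = \<sigma>2 \<and> \<sigma>' = \<sigma>1" using False by blast
      then show ?thesis using 12 ring_mod.subspace_neg[OF subspace_cone_ideal 12] by auto
    qed (simp add: ring_mod.subspace_0[OF subspace_cone_ideal])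
    moreover have "h f \<sigma> = 0" if "\<sigma> \<notin> ?A" for \<sigma>
      using f that by (simp add: h_def cycle_chains_def lifted_chains_def A)
    ultimately show ?thesis by (simp add: pp_chains_def)
  qed
  have h0: "h f = 0 \<longleftrightarrow> f = 0" for f
  proof
    assume "h f = 0"
    then have "h (h f) = 0" by (simp add: h_def fun_eq_iff)
    then show "f = 0" by (simp add: hh)
  qed (simp add: h_def fun_eq_iff)
  show ?thesis
  proof (rule koszul_exact_pullback[OF koszul_fscale koszul_fscale])
    show "fun_koszul.koszul_exact (cycle_chains \<Sigma> ori CARD('n)) {0} 0" using ex by (simp add: null)
    show "h (f + g) = h f + h g" for f g by (simp add: h_def fun_eq_iff distrib_left)
    show "h (fscale r f) = fscale r (h f)" for r f by (simp add: h_def fun_eq_iff mult.left_commute)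
    show "h ` pp_chains \<Sigma> \<subseteq> cycle_chains \<Sigma> ori CARD('n)" using hpp by blast
    show "cycle_chains \<Sigma> ori CARD('n) \<subseteq> {h y + l | y l. y \<in> pp_chains \<Sigma> \<and> l \<in> {0}}"
    proof
      fix f assume f: "f \<in> cycle_chains \<Sigma> ori CARD('n)"
      have "f = h (h f) + 0" by (simp add: hh)
      then show "f \<in> {h y + l | y l. y \<in> pp_chains \<Sigma> \<and> l \<in> {0}}" using hcyc[OF f] by blast
    qed
    show "h y \<in> {0} \<longleftrightarrow> y \<in> {0}" for y using h0 by simp
  qed (simp_all add: subspace_pp_chains)
qed

theorem theorem2:
  fixes \<Sigma> :: "(rat ^ 'n::finite) set set"
    and ori :: "(rat ^ 'n) set \<Rightarrow> (rat ^ 'n) list"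
  assumes "fan \<Sigma>"
    and "fan_dim \<Sigma> = CARD('n)"
    and "hereditary \<Sigma>"
    and "\<And>\<xi>. \<xi> \<in> \<Sigma> \<Longrightarrow> orients (ori \<xi>) \<xi>"
    and "\<And>i. i < CARD('n) \<Longrightarrow> zero_module (homology \<Sigma> ori i) \<or>
           (cohen_macaulay (homology \<Sigma> ori i) \<and>
            codimension (homology \<Sigma> ori i) = enat (CARD('n) - i + 1))"
  shows "free_module poly_ring (piecewise_polys \<Sigma>)"
proof -
  have exact: "fun_koszul.koszul_exact (pp_chains \<Sigma>) {0} 0"
  proof (cases "CARD('n) = 1")
    case True
    \<comment> \<open>over a single variable it suffices that this variable is a nonzerodivisor\<close>
    obtain i :: 'n where True by blast
    show ?thesis
    proof (rule fun_koszul.koszul_exact_regular_sequence[of _ _ "[var_poly i]"])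
      have "p = 0" if "var_poly i * p = 0" for p :: "'n mpoly"
      proof (rule poly_mapping_eqI)
        fix m
        have "Poly_Mapping.lookup (var_poly i * p) (Poly_Mapping.single i 1 + m) = Poly_Mapping.lookup p m"
          unfolding var_poly_def lookup_single_mult by simp
        then show "Poly_Mapping.lookup p m = Poly_Mapping.lookup 0 m" using that by simp
      qed
      then show "fun_koszul.regular_on (pp_chains \<Sigma>) {0} [var_poly i]" by (auto simp: fun_eq_iff)
      show "\<exists>g. f = (\<Sum>i\<in>UNIV. g i * var_poly i)" if "f \<in> set [var_poly i]" for f :: "'n mpoly"
        unfolding var_ideal_iff using that by (auto simp: var_poly_def) (metis lookup_single_eq zero_less_Suc)
    qed (simp_all add: True subspace_pp_chains)
  next
    case False
    have d: "1 < CARD('n)" using False zero_less_card_finite[where 'a='n] by linarith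
    show ?thesis
      using d by (intro koszul_exact_pp_chains[OF assms(1,4)] koszul_exact_cycles_boundaries(2)[OF assms(1,4,5)]) auto
  qed
  have fin: "finite (cones_of_dim \<Sigma> CARD('n))"
    using fan_finite[OF assms(1)] by (simp add: cones_of_dim_def)
  have supp: "f \<sigma> = 0" if "f \<in> pp_chains \<Sigma>" "\<sigma> \<notin> cones_of_dim \<Sigma> CARD('n)" for f \<sigma>
    using that by (simp add: pp_chains_def)
  obtain B where B: "B \<subseteq> pp_chains \<Sigma>" "pp_chains \<Sigma> \<subseteq> fun_mod.span B" "fun_mod.independent B"
    by (rule graded_koszul_exact_free[of "pp_chains \<Sigma>" "cones_of_dim \<Sigma> CARD('n)"])
       (use subspace_pp_chains fin supp homcomp_pp_chains exact that in blast)+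
  show ?thesis
    by (rule presentation.free_moduleI[OF presentation_piecewise_polys refl B])
qed

end
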